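(* Every amenable countable measured groupoid $(G,\mu)$ has property (H) (the Haagerup property).
   Context: **Groupoids.** A Borel groupoid is a groupoid $G$ with a standard Borel structure such that range $r$, source $s$, inverse and product are Borel; $X=G^{(0)}$ is its unit space, $G^x=r^{-1}(x)$, $G_x=s^{-1}(x)$. It is countable if all $G^x$ are countable. Given a probability measure $\mu$ on $X$, the $\sigma$-finite measure $\nu$ on $G$ is $\int_G F\,d\nu=\int_X\sum_{s(\gamma)=x}F(\gamma)\,d\mu(x)$; $\mu$ is quasi-invariant if $\nu$ is equivalent to its image under $\gamma\mapsto\gamma^{-1}$. A countable measured groupoid $(G,\mu)$ is a countable Borel groupoid with a quasi-invariant probability measure $\mu$ on $X$. **Amenability.** $(G,\mu)$ is amenable if there is a sequence $(\xi_n)$ of Borel functions on $G$ such that (i) $\sum_{r(\gamma)=x}|\xi_n(\gamma)|^2=1$ for almost every $x\in X$; (ii) setting $F_n(\gamma)=\sum_{r(\gamma_1)=r(\gamma)}\overline{\xi_n(\gamma_1)}\,\xi_n(\gamma^{-1}\gamma_1)$, one has $\lim_nF_n=1$ in the weak* topology of $L^\infty(G,\nu)$. **Haagerup property.** A Borel function $F:G\to\mathbb{C}$ is positive definite if there is a $\mu$-null set $N\subset X$ such that for all $x\notin N$ and $\gamma_1,\dots,\gamma_k\in G^x$ the matrix $[F(\gamma_i^{-1}\gamma_j)]$ is positive (semi-definite). $(G,\mu)$ has property (H) if there is a sequence $(F_n)$ of positive definite functions on $G$ with (i) $(F_n)_{|X}=1$ a.e.; (ii) $\nu(\{|F_n|>\varepsilon\})<+\infty$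 for every $\varepsilon>0$; (iii) $\lim_nF_n=1$ a.e. *)

theory Defs
  imports "HOL-Probability.Probability"
begin

text \<open>
  A groupoid is carried by a set of arrows, with the unit space realised as the subset
  of identity arrows. The field \<open>arrows\<close> is a \<open>measure\<close> used only as a
  measurable space (its \<open>space\<close> and \<open>sets\<close>); its \<open>emeasure\<close> plays no role.
  The operations are meaningful on \<open>space (arrows G)\<close> only, and the product
  \<open>gmul G \<gamma> \<eta>\<close> only when \<open>src G \<gamma> = rng G \<eta>\<close>.
\<close>

record 'a groupoid_data =
  arrows :: "'a measure"
  rng :: "'a \<Rightarrow> 'a"
  src :: "'a \<Rightarrow> 'a"
  ginv :: "'a \<Rightarrow> 'a"
  gmul :: "'a \<Rightarrow> 'a \<Rightarrow> 'a"

definition units :: "'a groupoid_data \<Rightarrow> 'a set" where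
  "units G = rng G ` space (arrows G)"

definition rng_fibre :: "'a groupoid_data \<Rightarrow> 'a \<Rightarrow> 'a set" where
  "rng_fibre G x = {\<gamma> \<in> space (arrows G). rng G \<gamma> = x}"

definition src_fibre :: "'a groupoid_data \<Rightarrow> 'a \<Rightarrow> 'a set" where
  "src_fibre G x = {\<gamma> \<in> space (arrows G). src G \<gamma> = x}"

definition composable :: "'a groupoid_data \<Rightarrow> ('a \<times> 'a) set" where
  "composable G =
     {(\<gamma>, \<eta>). \<gamma> \<in> space (arrows G) \<and> \<eta> \<in> space (arrows G) \<and> src G \<gamma> = rng G \<eta>}"

locale groupoid =
  fixes G :: "'a groupoid_data"
  assumes rng_closed: "\<gamma> \<in> space (arrows G) \<Longrightarrow> rng G \<gamma> \<in> space (arrows G)"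
    and src_closed: "\<gamma> \<in> space (arrows G) \<Longrightarrow> src G \<gamma> \<in> space (arrows G)"
    and ginv_closed: "\<gamma> \<in> space (arrows G) \<Longrightarrow> ginv G \<gamma> \<in> space (arrows G)"
    and gmul_closed: "(\<gamma>, \<eta>) \<in> composable G \<Longrightarrow> gmul G \<gamma> \<eta> \<in> space (arrows G)"
    and rng_rng: "\<gamma> \<in> space (arrows G) \<Longrightarrow> rng G (rng G \<gamma>) = rng G \<gamma>"
    and src_rng: "\<gamma> \<in> space (arrows G) \<Longrightarrow> src G (rng G \<gamma>) = rng G \<gamma>"
    and rng_src: "\<gamma> \<in> space (arrows G) \<Longrightarrow> rng G (src G \<gamma>) = src G \<gamma>"
    and src_src: "\<gamma> \<in> space (arrows G) \<Longrightarrow> src G (src G \<gamma>) = src G \<gamma>"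
    and rng_gmul: "(\<gamma>, \<eta>) \<in> composable G \<Longrightarrow> rng G (gmul G \<gamma> \<eta>) = rng G \<gamma>"
    and src_gmul: "(\<gamma>, \<eta>) \<in> composable G \<Longrightarrow> src G (gmul G \<gamma> \<eta>) = src G \<eta>"
    and gmul_assoc: "(\<gamma>, \<eta>) \<in> composable G \<Longrightarrow> (\<eta>, \<zeta>) \<in> composable G \<Longrightarrow>
          gmul G (gmul G \<gamma> \<eta>) \<zeta> = gmul G \<gamma> (gmul G \<eta> \<zeta>)"
    and rng_unit: "\<gamma> \<in> space (arrows G) \<Longrightarrow> gmul G (rng G \<gamma>) \<gamma> = \<gamma>"
    and src_unit: "\<gamma> \<in> space (arrows G) \<Longrightarrow> gmul G \<gamma> (src G \<gamma>) = \<gamma>"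
    and rng_ginv: "\<gamma> \<in> space (arrows G) \<Longrightarrow> rng G (ginv G \<gamma>) = src G \<gamma>"
    and src_ginv: "\<gamma> \<in> space (arrows G) \<Longrightarrow> src G (ginv G \<gamma>) = rng G \<gamma>"
    and gmul_ginv: "\<gamma> \<in> space (arrows G) \<Longrightarrow> gmul G \<gamma> (ginv G \<gamma>) = rng G \<gamma>"
    and ginv_gmul: "\<gamma> \<in> space (arrows G) \<Longrightarrow> gmul G (ginv G \<gamma>) \<gamma> = src G \<gamma>"

text \<open>Standard Borel: the \<open>\<sigma>\<close>-algebra is generated by some Polish topology on the space.\<close>

definition standard_borel :: "'a measure \<Rightarrow> bool" where
  "standard_borel M \<longleftrightarrow>
     (\<exists>T. completely_metrizable_space T \<and> separable_space T \<and> topspace T = space M \<and>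
          sets M = sigma_sets (space M) {U. openin T U})"

locale borel_groupoid = groupoid G for G :: "'a groupoid_data" +
  assumes standard: "standard_borel (arrows G)"
    and rng_borel: "rng G \<in> arrows G \<rightarrow>\<^sub>M arrows G"
    and src_borel: "src G \<in> arrows G \<rightarrow>\<^sub>M arrows G"
    and ginv_borel: "ginv G \<in> arrows G \<rightarrow>\<^sub>M arrows G"
    and gmul_borel: "(\<lambda>(\<gamma>, \<eta>). gmul G \<gamma> \<eta>) \<in>
          restrict_space (arrows G \<Otimes>\<^sub>M arrows G) (composable G) \<rightarrow>\<^sub>M arrows G"

locale countable_borel_groupoid = borel_groupoid G for G :: "'a groupoid_data" +
  assumes countable_fibre: "x \<in> units G \<Longrightarrow> countable (rng_fibre G x)"

text \<open>
  The measure \<open>\<nu>\<close> on the arrows, given on a Borel set \<open>A\<close> by the formula for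
  \<open>\<integral> F \<partial>\<nu>\<close> with \<open>F\<close> the indicator function of \<open>A\<close>. For a countable Borel groupoid
  this set function is countably additive because the inner sum is a Borel function of
  \<open>x\<close> (Lusin-Novikov), so \<open>measure_of\<close> does not fall back to the zero measure.
\<close>

definition arrow_measure :: "'a groupoid_data \<Rightarrow> 'a measure \<Rightarrow> 'a measure" where
  "arrow_measure G \<mu> = measure_of (space (arrows G)) (sets (arrows G))
     (\<lambda>A. \<integral>\<^sup>+ x. (\<integral>\<^sup>+ \<gamma>. indicator A \<gamma> \<partial>count_space (src_fibre G x)) \<partial>\<mu>)"

definition quasi_invariant :: "'a groupoid_data \<Rightarrow> 'a measure \<Rightarrow> bool" where
  "quasi_invariant G \<mu> \<longleftrightarrow>
     (let \<nu> = arrow_measure G \<mu>; \<nu>' = distr \<nu> \<nu> (ginv G)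
      in absolutely_continuous \<nu> \<nu>' \<and> absolutely_continuous \<nu>' \<nu>)"

locale countable_measured_groupoid = countable_borel_groupoid G + prob_space \<mu>
  for G :: "'a groupoid_data" and \<mu> :: "'a measure" +
  assumes sets_units: "sets \<mu> = sets (restrict_space (arrows G) (units G))"
    and quasi_inv: "quasi_invariant G \<mu>"

definition in_L_infinity :: "'a measure \<Rightarrow> ('a \<Rightarrow> complex) \<Rightarrow> bool" where
  "in_L_infinity \<nu> f \<longleftrightarrow> f \<in> borel_measurable \<nu> \<and> (\<exists>C. AE \<gamma> in \<nu>. cmod (f \<gamma>) \<le> C)"

text \<open>Weak* convergence in \<open>L\<^sup>\<infinity>(\<nu>)\<close>, the dual of \<open>L\<^sup>1(\<nu>)\<close>.\<close>

definition weak_star_tendsto ::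
    "'a measure \<Rightarrow> (nat \<Rightarrow> 'a \<Rightarrow> complex) \<Rightarrow> ('a \<Rightarrow> complex) \<Rightarrow> bool" where
  "weak_star_tendsto \<nu> F f \<longleftrightarrow>
     (\<forall>n. in_L_infinity \<nu> (F n)) \<and> in_L_infinity \<nu> f \<and>
     (\<forall>g :: 'a \<Rightarrow> complex. integrable \<nu> g \<longrightarrow>
        (\<lambda>n. \<integral>\<gamma>. F n \<gamma> * g \<gamma> \<partial>\<nu>) \<longlonglongrightarrow> (\<integral>\<gamma>. f \<gamma> * g \<gamma> \<partial>\<nu>))"

definition fibre_coeff :: "'a groupoid_data \<Rightarrow> ('a \<Rightarrow> complex) \<Rightarrow> 'a \<Rightarrow> complex" where
  "fibre_coeff G \<xi> \<gamma> =
     (\<Sum>\<^sub>\<infinity>\<gamma>\<^sub>1\<in>rng_fibre G (rng G \<gamma>). cnj (\<xi> \<gamma>\<^sub>1) * \<xi> (gmul G (ginv G \<gamma>) \<gamma>\<^sub>1))"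

definition amenable :: "'a groupoid_data \<Rightarrow> 'a measure \<Rightarrow> bool" where
  "amenable G \<mu> \<longleftrightarrow>
     (\<exists>\<xi> :: nat \<Rightarrow> 'a \<Rightarrow> complex.
        (\<forall>n. \<xi> n \<in> borel_measurable (arrows G)) \<and>
        (\<forall>n. AE x in \<mu>. ((\<lambda>\<gamma>. (cmod (\<xi> n \<gamma>))\<^sup>2) has_sum 1) (rng_fibre G x)) \<and>
        weak_star_tendsto (arrow_measure G \<mu>) (\<lambda>n. fibre_coeff G (\<xi> n)) (\<lambda>_. 1))"

text \<open>
  Positive semidefiniteness of the complex matrix \<open>(A i j)\<close> for \<open>i, j < k\<close>; membership in
  \<open>\<real>\<^sub>\<ge>\<^sub>0\<close> includes that the form is real-valued, hence that the matrix is Hermitian.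
\<close>

definition pos_semidef :: "nat \<Rightarrow> (nat \<Rightarrow> nat \<Rightarrow> complex) \<Rightarrow> bool" where
  "pos_semidef k A \<longleftrightarrow>
     (\<forall>c :: nat \<Rightarrow> complex. (\<Sum>i<k. \<Sum>j<k. cnj (c i) * A i j * c j) \<in> \<real>\<^sub>\<ge>\<^sub>0)"

definition positive_definite ::
    "'a groupoid_data \<Rightarrow> 'a measure \<Rightarrow> ('a \<Rightarrow> complex) \<Rightarrow> bool" where
  "positive_definite G \<mu> F \<longleftrightarrow>
     F \<in> borel_measurable (arrows G) \<and>
     (\<exists>N \<in> null_sets \<mu>. \<forall>x \<in> units G - N. \<forall>k. \<forall>\<gamma> :: nat \<Rightarrow> 'a.
        (\<forall>i<k. \<gamma> i \<in> rng_fibre G x) \<longrightarrow>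
        pos_semidef k (\<lambda>i j. F (gmul G (ginv G (\<gamma> i)) (\<gamma> j))))"

definition property_H :: "'a groupoid_data \<Rightarrow> 'a measure \<Rightarrow> bool" where
  "property_H G \<mu> \<longleftrightarrow>
     (\<exists>F :: nat \<Rightarrow> 'a \<Rightarrow> complex.
        (\<forall>n. positive_definite G \<mu> (F n)) \<and>
        (\<forall>n. AE x in \<mu>. F n x = 1) \<and>
        (\<forall>n. \<forall>\<epsilon>>0. emeasure (arrow_measure G \<mu>)
                 {\<gamma> \<in> space (arrows G). cmod (F n \<gamma>) > \<epsilon>} < \<infinity>) \<and>
        (AE \<gamma> in arrow_measure G \<mu>. (\<lambda>n. F n \<gamma>) \<longlonglongrightarrow> 1))"

end

theory Submission
  imports Defs
begin

text \<open>
  Let \<open>F\<^sub>n\<close> be the coefficient of the \<open>n\<close>-th vector field \<open>\<xi>\<^sub>n\<close> of an amenability sequence. It is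
  positive definite, but \<open>\<nu> {|F\<^sub>n| > \<epsilon>}\<close> may be infinite. Instead of truncating \<open>\<xi>\<^sub>n\<close>, which would
  require Borel measurability of fibrewise sums, one cuts \<open>F\<^sub>n\<close> down to the arrows with both ends in
  a Borel set \<open>Y\<close> of units and repairs the diagonal: \<open>F\<^sub>n 1\<^sub>Y(r) 1\<^sub>Y(s) + 1\<^sub>X (1 - 1\<^sub>Y F\<^sub>n)\<close>. By
  quasi-invariance, \<open>\<xi>\<^sub>n\<close> is approximated in \<open>\<ell>\<^sup>2(G\<^sup>x)\<close> by its restrictions to sets \<open>A\<^sub>j\<close> whose range and
  source fibres have bounded cardinality; on a set \<open>Y\<close> of almost full measure the approximation is
  uniform, and then \<open>|F\<^sub>n(\<gamma>)| > \<epsilon>\<close> with both ends in \<open>Y\<close> forces \<open>\<gamma> \<in> A\<^sub>j A\<^sub>j\<^sup>-\<^sup>1\<close> for some \<open>j\<close> depending on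
  \<open>\<epsilon>\<close> only, a set of finite measure. It follows that \<open>\<nu>\<close> is \<open>\<sigma>\<close>-finite, and weak* convergence gives a
  subsequence that converges almost everywhere, because \<open>|1 - F\<^sub>n|\<^sup>2 \<le> 2 (1 - Re F\<^sub>n)\<close>.

  In place of the Lusin-Novikov theorem it suffices to know that images of Borel sets under a Borel
  map are measurable for the completed measure and that such a set contains sections over sets
  of positive measure. Both follow from the capacitability of Suslin sets.
\<close>

section \<open>Capacitability and sections of Suslin sets\<close>

text \<open>The obstacle is measurability. Property (H) asks for Borel functions, whereas fibrewise
  sums are only shown to be measurable for the completion of \<mu>. The given coefficients are Borel
  because weak* convergence places them in \<open>L\<^sup>\<infinity>(\<nu>)\<close>. Multiplication
  by Borel functions of range and source preserves this, and the cut-down coefficient is again a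
  coefficient, that of \<open>1\<^sub>Y(r) \<xi>\<^sub>n\<close>. After passing to fibre norms at
  most 1, \<open>F\<^sub>n\<close> lies in [0,1] on units, so the repair term is a nonnegative
  diagonal. Bounded fibres need two controls. Along range fibres, the sum of
  \<open>|\<xi>\<^sub>n|\<^sup>2\<close> is at most 1, so few arrows carry a large value. Along
  source fibres no such bound is given, and a \<nu>-integrable weight, positive where
  \<open>\<xi>\<^sub>n\<close> does not vanish, takes its place. It exists because quasi-invariance
  makes \<nu> on that set absolutely continuous with respect to a finite measure with density
  \<open>|\<xi>\<^sub>n|\<^sup>2\<close>, and because sections make \<nu> semifinite. Global
  sigma-finiteness comes only later: the weak* limit 1 leaves no room for a non-null set on which
  all coefficients vanish.\<close>

text \<open>As the outer measure is continuous along increasing unions, the branches \<open>s\<close> can be bounded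
  coordinatewise at an arbitrarily small loss of outer measure. The bounded branches form a compact
  set, on which the leftmost branch depends measurably on the point (Koenig's lemma).\<close>

lemma suslin_selection:
  fixes B :: "nat \<Rightarrow> (nat \<Rightarrow> nat) \<Rightarrow> 'a set"
  assumes fin: "finite_measure M"
    and meas: "\<And>n s. B n s \<in> sets M"
    and dec: "\<And>n s. B (Suc n) s \<subseteq> B n s"
    and det: "\<And>n s t. (\<forall>i<L n. s i = t i) \<Longrightarrow> B n s = B n t"
    and e: "e < outer_measure_of M (\<Union>s. \<Inter>n. B n s)"
  obtains P sel where "P \<in> sets M" "e \<le> emeasure M P"
    "\<And>x n. x \<in> P \<Longrightarrow> x \<in> B n (sel x)" "\<And>i v. {x \<in> P. sel x i = v} \<in> sets M"
proof -
  interpret finite_measure M by fact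
  \<comment> \<open>The first \<open>n\<close> coordinates are capped by \<open>k\<close>, the
    others are free. These sets need not be measurable, hence the outer measure; raising the cap on
    coordinate \<open>n\<close> exhausts \<open>E k n\<close> along an increasing sequence.\<close>
  define E where "E k n = {x. \<exists>s. (\<forall>i<n. s i \<le> k i) \<and> (\<forall>m. x \<in> B m s)}" for k :: "nat \<Rightarrow> nat" and n :: nat
  have Esub: "E k n \<subseteq> space M" for k n
    using meas sets.sets_into_space by (fastforce simp: E_def)
  have Estep: "\<exists>k'. e < outer_measure_of M (E k' (Suc n)) \<and> (\<forall>i<n. k' i = k i)"
    if h: "e < outer_measure_of M (E k n)" for k n
  proof -
    let ?A = "\<lambda>v. E (k(n := v)) (Suc n)"
    have inc: "incseq ?A"
      unfolding incseq_def E_def by (auto simp: less_Suc_eq intro: le_trans)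
    have "E k n \<subseteq> (\<Union>v. ?A v)"
      unfolding E_def by (auto simp: less_Suc_eq)
    then have "outer_measure_of M (E k n) \<le> outer_measure_of M (\<Union>v. ?A v)"
      by (rule outer_measure_of_mono)
    also have "\<dots> = (SUP v. outer_measure_of M (?A v))"
      by (rule SUP_outer_measure_of_incseq[symmetric]) (use Esub inc in auto)
    finally obtain v where "e < outer_measure_of M (?A v)"
      using h by (meson less_SUP_iff order_less_le_trans)
    then show ?thesis by (intro exI[of _ "k(n := v)"]) auto
  qed
  have "\<exists>f. \<forall>n. e < outer_measure_of M (E (f n) n) \<and> (\<forall>i<n. f (Suc n) i = f n i)"
  proof (rule dependent_nat_choice)
    have "E (\<lambda>_. 0) 0 = (\<Union>s. \<Inter>n. B n s)" by (auto simp: E_def)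
    then show "\<exists>x. e < outer_measure_of M (E x 0)" using e by metis
  qed (use Estep in blast)
  then obtain f where f: "\<And>n. e < outer_measure_of M (E (f n) n)" "\<And>n i. i < n \<Longrightarrow> f (Suc n) i = f n i"
    by blast
  \<comment> \<open>The cap on coordinate \<open>i\<close> no longer changes after stage
    \<open>Suc i\<close>, so the diagonal agrees with every later stage.\<close>
  define K where "K i = f (Suc i) i" for i
  have fK: "f n i = K i" if "i < n" for n i
    using that by (induction n) (auto simp: less_Suc_eq f(2) K_def)
  have EK: "e < outer_measure_of M (E K n)" for n
    using f(1)[of n] by (simp add: E_def fK cong: all_cong1)
  define S where "S u = {s. (\<forall>i. s i \<le> K i) \<and> (\<forall>i<length u. s i = u ! i)}" for u :: "nat list"
  define Q where "Q u m = (\<Union>s\<in>S u. B m s)" for u m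
  \<comment> \<open>Membership allows a different branch at each depth \<open>m\<close>; merging
    these into one branch is the compactness step \<open>koenig\<close>.\<close>
  define R where "R u = (\<Inter>m. Q u m)" for u
  \<comment> \<open>\<open>S u\<close> may be uncountable, but by \<open>det\<close> only countably
    many distinct sets \<open>B m s\<close> occur at each depth.\<close>
  have Qmeas: "Q u m \<in> sets M" for u m
  proof -
    have *: "B m s = B m (\<lambda>i. if i < L m then map s [0..<L m] ! i else 0)" for s
      by (rule det) auto
    have "B m ` S u = (\<lambda>l. B m (\<lambda>i. if i < L m then l ! i else 0)) ` ((\<lambda>s. map s [0..<L m]) ` S u)"
      unfolding image_image by (rule image_cong[OF refl *])
    then have "countable (B m ` S u)"
      by (rule ssubst) (intro countable_image countableI_type)
    then show ?thesis unfolding Q_def using meas by (intro sets.countable_Union) auto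
  qed
  have Rmeas: "R u \<in> sets M" for u
    unfolding R_def by (intro sets.countable_INT) (auto simp: Qmeas)
  have Bmono: "B n s \<subseteq> B m s" if "m \<le> n" for m n s
    by (rule lift_Suc_antimono_le[of "\<lambda>n. B n s", OF dec that])
  have Qdec: "decseq (Q u)" for u
    unfolding Q_def using Bmono by (fastforce simp: decseq_def)
  \<comment> \<open>Depth \<open>m\<close> reads only \<open>L m\<close> coordinates, so capping
    these suffices. The lower bound on the outer measure thereby passes to the measurable sets
    \<open>Q [] m\<close>.\<close>
  have Eroot: "E K (L m) \<subseteq> Q [] m" for m
  proof
    fix x assume "x \<in> E K (L m)"
    then obtain s where s: "\<forall>i<L m. s i \<le> K i" "x \<in> B m s" by (auto simp: E_def)
    let ?t = "\<lambda>i. if i < L m then s i else 0"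
    have "B m ?t = B m s" by (rule det) simp
    moreover have "?t \<in> S []" using s by (auto simp: S_def)
    ultimately show "x \<in> Q [] m" using s unfolding Q_def by blast
  qed
  have "e \<le> emeasure M (Q [] m)" for m
    using EK[of "L m"] outer_measure_of_mono[OF Eroot[of m], of M] outer_measure_of_eq[OF Qmeas[of "[]" m]]
    by auto
  moreover have "emeasure M (R []) = (INF m. emeasure M (Q [] m))"
    unfolding R_def by (rule INF_emeasure_decseq[symmetric]) (use Qmeas Qdec in auto)
  ultimately have eR: "e \<le> emeasure M (R [])" by (simp add: le_INF_iff)
  have koenig: "\<exists>v. x \<in> R (u @ [v])" if x: "x \<in> R u" for x u
  proof (rule ccontr)
    assume "\<nexists>v. x \<in> R (u @ [v])"
    then have "\<forall>v. \<exists>m. x \<notin> Q (u @ [v]) m" by (auto simp: R_def)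
    then obtain m where m: "\<And>v. x \<notin> Q (u @ [v]) (m v)" by metis
    \<comment> \<open>There are finitely many admissible values of the next coordinate. If each
      failed at some depth, all would fail at depth \<open>N\<close>, because the sets
      \<open>B\<close> decrease.\<close>
    define N where "N = Max (m ` {..K (length u)})"
    obtain s where s: "s \<in> S u" "x \<in> B N s" using x by (auto simp: R_def Q_def)
    have "m (s (length u)) \<le> N" unfolding N_def using s by (intro Max_ge) (auto simp: S_def)
    moreover have "s \<in> S (u @ [s (length u)])" using s(1) by (auto simp: S_def nth_append less_Suc_eq)
    ultimately have "x \<in> Q (u @ [s (length u)]) (m (s (length u)))"
      using s(2) Bmono unfolding Q_def by blast
    then show False using m by blast
  qed
  define pre where "pre x n = rec_nat [] (\<lambda>_ u. u @ [LEAST v. x \<in> R (u @ [v])]) n" for x n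
  have pre0: "pre x 0 = []" and preS: "pre x (Suc n) = pre x n @ [LEAST v. x \<in> R (pre x n @ [v])]" for x n
    by (simp_all add: pre_def)
  define sel where "sel x i = (LEAST v. x \<in> R (pre x i @ [v]))" for x i
  have preR: "x \<in> R (pre x n)" if "x \<in> R []" for x n
  proof (induction n)
    case (Suc n)
    then show ?case unfolding preS using koenig[OF Suc] by (metis LeastI_ex)
  qed (use that pre0 in auto)
  have pre_eq: "pre x n = map (sel x) [0..<n]" for x n
    by (induction n) (auto simp: pre0 preS sel_def)
  have premeas: "{x \<in> R []. pre x n = u} \<in> sets M" for n u
  proof (induction n arbitrary: u)
    case 0
    then show ?case using Rmeas by (cases u) (auto simp: pre0)
  next
    case (Suc n)
    show ?case
    proof (cases u rule: rev_cases)
      case Nil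
      then show ?thesis by (simp add: preS)
    next
      case (snoc w v)
      have *: "(LEAST v'. x \<in> R (w @ [v'])) = v \<longleftrightarrow> x \<in> R (w @ [v]) \<and> (\<forall>v'<v. x \<notin> R (w @ [v']))"
        if "x \<in> R w" for x
      proof -
        have "x \<in> R (w @ [LEAST v'. x \<in> R (w @ [v'])])" using koenig[OF that] by (rule LeastI_ex)
        then show ?thesis
          by (auto dest: not_less_Least intro!: Least_equality simp: not_less[symmetric])
      qed
      have "x \<in> {x \<in> R []. pre x (Suc n) = u} \<longleftrightarrow>
          x \<in> {x \<in> R []. pre x n = w} \<inter> (R (w @ [v]) - (\<Union>v'\<in>{..<v}. R (w @ [v'])))" for x
      proof (cases "x \<in> R [] \<and> pre x n = w")
        case True
        then have "x \<in> R w" using preR by blast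
        from *[OF this] True show ?thesis by (simp add: preS snoc Ball_def)
      qed (auto simp: preS snoc)
      then have "{x \<in> R []. pre x (Suc n) = u} =
          {x \<in> R []. pre x n = w} \<inter> (R (w @ [v]) - (\<Union>v'\<in>{..<v}. R (w @ [v'])))"
        by blast
      then show ?thesis using Suc[of w] Rmeas by auto
    qed
  qed
  show thesis
  proof (rule that[of "R []" sel])
    fix x n assume "x \<in> R []"
    \<comment> \<open>The branch provided at depth \<open>n\<close> agrees with \<open>sel x\<close>
      on the \<open>L n\<close> coordinates that \<open>B n\<close> reads.\<close>
    then have "x \<in> R (map (sel x) [0..<L n])" using preR pre_eq by metis
    then obtain s where s: "s \<in> S (map (sel x) [0..<L n])" "x \<in> B n s" by (auto simp: R_def Q_def)
    then have "B n s = B n (sel x)" by (intro det) (auto simp: S_def)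
    then show "x \<in> B n (sel x)" using s by simp
  next
    fix i v
    have "sel x i = v \<longleftrightarrow> pre x (Suc i) \<in> {u. u ! i = v \<and> length u = Suc i}" for x
      by (simp add: pre_eq nth_append)
    then have "{x \<in> R []. sel x i = v} = (\<Union>u\<in>{u. u ! i = v \<and> length u = Suc i}. {x \<in> R []. pre x (Suc i) = u})"
      by blast
    also have "\<dots> \<in> sets M" using premeas by (intro sets.countable_UN') auto
    finally show "{x \<in> R []. sel x i = v} \<in> sets M" .
  qed (use Rmeas eR in auto)
qed

text \<open>The Suslin operation applied to rectangles. \<open>L\<close> is a modulus: level
  \<open>n\<close> reads only \<open>L n\<close> coordinates of the branch, which replaces indexing
  by finite sequences. The second factor is kept closed so that completeness can later produce a
  point in it; for the first factor measurability is enough.\<close>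

definition suslin_scheme ::
    "'a measure \<Rightarrow> 'b topology \<Rightarrow> (nat \<Rightarrow> (nat \<Rightarrow> nat) \<Rightarrow> 'a set) \<Rightarrow>
     (nat \<Rightarrow> (nat \<Rightarrow> nat) \<Rightarrow> 'b set) \<Rightarrow> (nat \<Rightarrow> nat) \<Rightarrow> ('a \<times> 'b) set \<Rightarrow> bool" where
  "suslin_scheme M T A C L D \<longleftrightarrow>
     (\<forall>n s. A n s \<in> sets M \<and> closedin T (C n s)) \<and>
     (\<forall>n s t. (\<forall>i<L n. s i = t i) \<longrightarrow> A n s = A n t \<and> C n s = C n t) \<and>
     D = (\<Union>s. \<Inter>n. A n s \<times> C n s)"

definition suslin_product :: "'a measure \<Rightarrow> 'b topology \<Rightarrow> ('a \<times> 'b) set \<Rightarrow> bool" where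
  "suslin_product M T D \<longleftrightarrow> (\<exists>A C L. suslin_scheme M T A C L D)"

lemma suslin_product_Times:
  assumes "A \<in> sets M" "closedin T C"
  shows "suslin_product M T (A \<times> C)"
  unfolding suslin_product_def suslin_scheme_def
  by (rule exI[of _ "\<lambda>_ _. A"], rule exI[of _ "\<lambda>_ _. C"]) (use assms in auto)

lemma suslin_product_UN:
  assumes "\<And>i::nat. suslin_product M T (D i)"
  shows "suslin_product M T (\<Union>i. D i)"
proof -
  have "\<forall>i. \<exists>A C L. suslin_scheme M T A C L (D i)"
    using assms unfolding suslin_product_def by simp
  then obtain A C L where sch: "\<And>i. suslin_scheme M T (A i) (C i) (L i) (D i)"
    by metis
  have meas: "A i n s \<in> sets M" "closedin T (C i n s)" for i n s
    using sch[of i] unfolding suslin_scheme_def by blast+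
  have det: "A i n s = A i n t" "C i n s = C i n t" if "\<forall>j<L i n. s j = t j" for i n s t
    using sch[of i] that unfolding suslin_scheme_def by blast+
  have D: "D i = (\<Union>s. \<Inter>n. A i n s \<times> C i n s)" for i
    using sch[of i] unfolding suslin_scheme_def by blast
  \<comment> \<open>The coordinate \<open>s 0\<close> selects the set. The modulus of the \<open>m\<close>-th condition depends on
    \<open>s 0\<close>, so this condition is imposed only at those indices \<open>(m, l)\<close> for which it is determined
    by the first \<open>l\<close> of the remaining coordinates.\<close>
  define on where "on n s \<longleftrightarrow> L (s 0) (fst (prod_decode n)) \<le> snd (prod_decode n)"
    for n and s :: "nat \<Rightarrow> nat"
  define A' where "A' n s = (if on n s then A (s 0) (fst (prod_decode n)) (\<lambda>j. s (Suc j)) else space M)" for n s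
  define C' where "C' n s = (if on n s then C (s 0) (fst (prod_decode n)) (\<lambda>j. s (Suc j)) else topspace T)" for n s
  have det': "A' n s = A' n t \<and> C' n s = C' n t" if "\<forall>i<Suc (snd (prod_decode n)). s i = t i" for n s t
  proof -
    have "s 0 = t 0" using that by auto
    moreover have "\<forall>j<L (s 0) (fst (prod_decode n)). s (Suc j) = t (Suc j)" if "on n s"
      using \<open>\<forall>i<_. s i = t i\<close> that by (auto simp: on_def)
    ultimately show ?thesis
      unfolding A'_def C'_def using det[of "s 0" "fst (prod_decode n)" "\<lambda>j. s (Suc j)" "\<lambda>j. t (Suc j)"]
      by (auto simp: on_def)
  qed
  have key: "(x, y) \<in> (\<Inter>n. A' n s \<times> C' n s) \<longleftrightarrow>
      (\<forall>m. x \<in> A (s 0) m (\<lambda>j. s (Suc j)) \<and> y \<in> C (s 0) m (\<lambda>j. s (Suc j)))" (is "?l \<longleftrightarrow> ?r") for x y s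
  proof
    assume l: ?l
    show ?r
    proof
      fix m
      have "(x, y) \<in> A' (prod_encode (m, L (s 0) m)) s \<times> C' (prod_encode (m, L (s 0) m)) s"
        using l by blast
      then show "x \<in> A (s 0) m (\<lambda>j. s (Suc j)) \<and> y \<in> C (s 0) m (\<lambda>j. s (Suc j))"
        by (simp add: A'_def C'_def on_def)
    qed
  next
    assume r: ?r
    then have "x \<in> space M" "y \<in> topspace T"
      using meas(1)[THEN sets.sets_into_space] meas(2)[THEN closedin_subset] by blast+
    then show ?l using r by (auto simp: A'_def C'_def)
  qed
  have "(\<Union>i. D i) = (\<Union>s. \<Inter>n. A' n s \<times> C' n s)"
  proof (intro set_eqI)
    fix p :: "'a \<times> 'b"
    obtain x y where p: "p = (x, y)" by (cases p)
    have "p \<in> (\<Union>i. D i) \<longleftrightarrow> (\<exists>i s. \<forall>m. x \<in> A i m s \<and> y \<in> C i m s)"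
      unfolding D p by auto
    also have "\<dots> \<longleftrightarrow> (\<exists>s. \<forall>m. x \<in> A (s 0) m (\<lambda>j. s (Suc j)) \<and> y \<in> C (s 0) m (\<lambda>j. s (Suc j)))"
    proof (intro iffI)
      assume "\<exists>i s. \<forall>m. x \<in> A i m s \<and> y \<in> C i m s"
      then obtain i s where "\<forall>m. x \<in> A i m s \<and> y \<in> C i m s" by blast
      then show "\<exists>s. \<forall>m. x \<in> A (s 0) m (\<lambda>j. s (Suc j)) \<and> y \<in> C (s 0) m (\<lambda>j. s (Suc j))"
        by (intro exI[of _ "case_nat i s"]) simp
    qed blast
    also have "\<dots> \<longleftrightarrow> p \<in> (\<Union>s. \<Inter>n. A' n s \<times> C' n s)"
      unfolding p by (simp only: UN_iff key bex_UNIV)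
    finally show "p \<in> (\<Union>i. D i) \<longleftrightarrow> p \<in> (\<Union>s. \<Inter>n. A' n s \<times> C' n s)" .
  qed
  moreover have "\<forall>n s. A' n s \<in> sets M \<and> closedin T (C' n s)"
    using meas by (auto simp: A'_def C'_def)
  ultimately have "suslin_scheme M T A' C' (\<lambda>n. Suc (snd (prod_decode n))) (\<Union>i. D i)"
    unfolding suslin_scheme_def using det' by simp
  then show ?thesis unfolding suslin_product_def by blast
qed

text \<open>A single branch codes countably many: the pairing function assigns to the
  \<open>i\<close>-th set the branch \<open>\<lambda>j. s (prod_encode (i, j))\<close>.\<close>

lemma suslin_product_INT:
  assumes "\<And>i::nat. suslin_product M T (D i)"
  shows "suslin_product M T (\<Inter>i. D i)"
proof -
  have "\<forall>i. \<exists>A C L. suslin_scheme M T A C L (D i)"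
    using assms unfolding suslin_product_def by simp
  then obtain A C L where sch: "\<And>i. suslin_scheme M T (A i) (C i) (L i) (D i)"
    by metis
  have meas: "A i n s \<in> sets M" "closedin T (C i n s)" for i n s
    using sch[of i] unfolding suslin_scheme_def by blast+
  have det: "A i n s = A i n t" "C i n s = C i n t" if "\<forall>j<L i n. s j = t j" for i n s t
    using sch[of i] that unfolding suslin_scheme_def by blast+
  have D: "D i = (\<Union>s. \<Inter>n. A i n s \<times> C i n s)" for i
    using sch[of i] unfolding suslin_scheme_def by blast
  define A' where "A' n s = (case prod_decode n of (i, m) \<Rightarrow> A i m (\<lambda>j. s (prod_encode (i, j))))" for n s
  define C' where "C' n s = (case prod_decode n of (i, m) \<Rightarrow> C i m (\<lambda>j. s (prod_encode (i, j))))" for n s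
  \<comment> \<open>A crude bound: the sum dominates each position \<open>prod_encode (i, j)\<close>
    with \<open>j < L i m\<close>, and \<open>Suc\<close> makes the inequality strict.\<close>
  define L' where "L' n = (case prod_decode n of (i, m) \<Rightarrow> Suc (\<Sum>j<L i m. prod_encode (i, j)))" for n
  have det': "A' n s = A' n t \<and> C' n s = C' n t" if st: "\<forall>i<L' n. s i = t i" for n s t
  proof -
    obtain i m where n: "prod_decode n = (i, m)" by (cases "prod_decode n")
    have "\<forall>j<L i m. s (prod_encode (i, j)) = t (prod_encode (i, j))"
    proof (intro allI impI)
      fix j assume "j < L i m"
      then have "prod_encode (i, j) \<le> (\<Sum>j<L i m. prod_encode (i, j))"
        by (intro member_le_sum) auto
      then show "s (prod_encode (i, j)) = t (prod_encode (i, j))" using st by (simp add: L'_def n)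
    qed
    then show ?thesis using det by (simp add: A'_def C'_def n)
  qed
  have "(\<Inter>i. D i) = (\<Union>s. \<Inter>n. A' n s \<times> C' n s)"
  proof (intro set_eqI)
    fix p :: "'a \<times> 'b"
    obtain x y where p: "p = (x, y)" by (cases p)
    have "p \<in> (\<Inter>i. D i) \<longleftrightarrow> (\<forall>i. \<exists>s. \<forall>m. x \<in> A i m s \<and> y \<in> C i m s)"
      unfolding D p by auto
    also have "\<dots> \<longleftrightarrow> (\<exists>s. \<forall>i m. x \<in> A i m (\<lambda>j. s (prod_encode (i, j))) \<and> y \<in> C i m (\<lambda>j. s (prod_encode (i, j))))"
    proof (intro iffI)
      assume "\<forall>i. \<exists>s. \<forall>m. x \<in> A i m s \<and> y \<in> C i m s"
      then obtain S where "\<forall>i. \<forall>m. x \<in> A i m (S i) \<and> y \<in> C i m (S i)" by metis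
      then show "\<exists>s. \<forall>i m. x \<in> A i m (\<lambda>j. s (prod_encode (i, j))) \<and> y \<in> C i m (\<lambda>j. s (prod_encode (i, j)))"
        by (intro exI[of _ "\<lambda>n. case prod_decode n of (i, j) \<Rightarrow> S i j"]) simp
    qed blast
    also have "\<dots> \<longleftrightarrow> (\<exists>s. \<forall>n. x \<in> A' n s \<and> y \<in> C' n s)"
    proof (intro ex_cong1 iffI allI)
      fix s n
      assume "\<forall>i m. x \<in> A i m (\<lambda>j. s (prod_encode (i, j))) \<and> y \<in> C i m (\<lambda>j. s (prod_encode (i, j)))"
      then show "x \<in> A' n s \<and> y \<in> C' n s" by (simp add: A'_def C'_def split: prod.split)
    next
      fix s i m
      assume "\<forall>n. x \<in> A' n s \<and> y \<in> C' n s"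
      then have "x \<in> A' (prod_encode (i, m)) s \<and> y \<in> C' (prod_encode (i, m)) s" by blast
      then show "x \<in> A i m (\<lambda>j. s (prod_encode (i, j))) \<and> y \<in> C i m (\<lambda>j. s (prod_encode (i, j)))"
        by (simp add: A'_def C'_def)
    qed
    also have "\<dots> \<longleftrightarrow> p \<in> (\<Union>s. \<Inter>n. A' n s \<times> C' n s)"
      unfolding p by auto
    finally show "p \<in> (\<Inter>i. D i) \<longleftrightarrow> p \<in> (\<Union>s. \<Inter>n. A' n s \<times> C' n s)" .
  qed
  moreover have "\<forall>n s. A' n s \<in> sets M \<and> closedin T (C' n s)"
    using meas by (auto simp: A'_def C'_def split: prod.split)
  ultimately have "suslin_scheme M T A' C' L' (\<Inter>i. D i)"
    unfolding suslin_scheme_def using det' by simp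
  then show ?thesis unfolding suslin_product_def by blast
qed

text \<open>Suslin sets are not closed under complement, so the induction runs over sets that are
  Suslin together with their complements. Complements are then free, and countable unions use both
  closure lemmas. Rectangles with an open side qualify because open sets in a metrizable space are
  countable unions of closed sets.\<close>

lemma suslin_product_sets:
  fixes M :: "'a measure" and N :: "'b measure"
  assumes T: "metrizable_space T" "topspace T = space N"
    and N: "sets N = sigma_sets (space N) {U. openin T U}"
    and D: "D \<in> sets (M \<Otimes>\<^sub>M N)"
  shows "suslin_product M T D"
proof -
  let ?\<Omega> = "space M \<times> space N"
  define K where "K D \<longleftrightarrow> D \<subseteq> ?\<Omega> \<and> suslin_product M T D \<and> suslin_product M T (?\<Omega> - D)" for D
  have compl: "K (?\<Omega> - D)" if "K D" for D
    using that by (auto simp: K_def double_diff)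
  have UN: "K (\<Union>i. D i)" if "\<And>i::nat. K (D i)" for D
  proof -
    have "?\<Omega> - (\<Union>i. D i) = (\<Inter>i. ?\<Omega> - D i)" by auto
    moreover have "suslin_product M T (\<Union>i. D i)"
      by (rule suslin_product_UN) (use that K_def in blast)
    moreover have "suslin_product M T (\<Inter>i. ?\<Omega> - D i)"
      by (rule suslin_product_INT) (use that K_def in blast)
    moreover have "(\<Union>i. D i) \<subseteq> ?\<Omega>" using that unfolding K_def by blast
    ultimately show ?thesis by (simp add: K_def)
  qed
  have left: "K (A \<times> space N)" if "A \<in> sets M" for A
  proof -
    have "?\<Omega> - A \<times> space N = (space M - A) \<times> space N" by auto
    moreover have "suslin_product M T (A' \<times> space N)" if "A' \<in> sets M" for A'
      using that T(2) by (intro suslin_product_Times) (metis closedin_topspace)+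
    ultimately show ?thesis
      using that sets.sets_into_space[OF that] sets.compl_sets[OF that] by (simp add: K_def Sigma_mono)
  qed
  have right: "K (space M \<times> B)" if "B \<in> sigma_sets (space N) {U. openin T U}" for B
    using that
  proof induction
    case (Basic U)
    then have U: "openin T U" "U \<subseteq> space N" using openin_subset T(2) by auto
    then obtain C :: "nat \<Rightarrow> 'b set" where C: "\<And>n. closedin T (C n)" "(\<Union>n. C n) = U"
      using open_imp_fsigma_in[OF T(1)] unfolding fsigma_in_ascending by metis
    have "space M \<times> U = (\<Union>n. space M \<times> C n)" using C(2) by auto
    then have "suslin_product M T (space M \<times> U)"
      by (simp only:) (intro suslin_product_UN suslin_product_Times sets.top C(1))
    moreover have "?\<Omega> - space M \<times> U = space M \<times> (space N - U)" by auto
    moreover have "closedin T (space N - U)" using U T(2) by (metis closedin_diff closedin_topspace)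
    ultimately show ?case using U(2) suslin_product_Times[OF sets.top[of M]] by (simp add: K_def Sigma_mono)
  next
    case Empty
    then show ?case using left[of "{}"] by simp
  next
    case (Compl B)
    have "?\<Omega> - space M \<times> B = space M \<times> (space N - B)" by auto
    then show ?case using compl[OF Compl.IH] by simp
  next
    case (Union B)
    have "space M \<times> (\<Union>i. B i) = (\<Union>i. space M \<times> B i)" by auto
    then show ?case using UN[of "\<lambda>i. space M \<times> B i"] Union.IH by simp
  qed
  have Int: "K (D \<inter> E)" if "K D" "K E" for D E
  proof -
    let ?F = "\<lambda>i::nat. if i = 0 then ?\<Omega> - D else ?\<Omega> - E"
    have "(\<Union>i. ?F i) = (?\<Omega> - D) \<union> (?\<Omega> - E)" by (auto split: if_splits intro: exI[of _ 1])
    moreover have "D \<inter> E = ?\<Omega> - ((?\<Omega> - D) \<union> (?\<Omega> - E))"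
      using that unfolding K_def by blast
    moreover have "K (?F i)" for i using compl that by simp
    ultimately show ?thesis using compl UN[of ?F] by metis
  qed
  have "D \<in> sigma_sets ?\<Omega> {a \<times> b |a b. a \<in> sets M \<and> b \<in> sets N}"
    using D by (simp add: sets_pair_measure)
  then have "K D"
  proof induction
    case (Basic R)
    then obtain a b where ab: "R = a \<times> b" "a \<in> sets M" "b \<in> sets N" by blast
    have "K (a \<times> space N \<inter> space M \<times> b)"
      by (intro Int left right) (use ab N in auto)
    moreover have "R = a \<times> space N \<inter> space M \<times> b"
      unfolding ab(1) using sets.sets_into_space[OF ab(2)] sets.sets_into_space[OF ab(3)] by auto
    ultimately show ?case by simp
  next
    case Empty
    then show ?case using left[of "{}"] by simp
  qed (use compl UN in auto)
  then show ?thesis by (simp add: K_def)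
qed

section \<open>Uniformization over a Polish factor, up to a small loss of measure\<close>

lemma standard_borelE:
  assumes "standard_borel N"
  obtains d where "Metric_space (space N) d" "Metric_space.mcomplete (space N) d"
    "separable_space (Metric_space.mtopology (space N) d)"
    "sets N = sigma_sets (space N) {U. openin (Metric_space.mtopology (space N) d) U}"
proof -
  obtain T where T: "completely_metrizable_space T" "separable_space T" "topspace T = space N"
      "sets N = sigma_sets (space N) {U. openin T U}"
    using assms unfolding standard_borel_def by blast
  then obtain S d where S: "Metric_space S d" "Metric_space.mcomplete S d" "T = Metric_space.mtopology S d"
    unfolding completely_metrizable_space_def by blast
  then have "S = space N" using T(3) Metric_space.topspace_mtopology by metis
  then show thesis using that[of d] S T by auto
qed

lemma (in Metric_space) separable_dense_sequence:
  assumes "separable_space mtopology" "M \<noteq> {}"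
  obtains c :: "nat \<Rightarrow> 'a" where "\<And>n. c n \<in> M" "\<And>x r. x \<in> M \<Longrightarrow> 0 < r \<Longrightarrow> \<exists>n. d (c n) x < r"
proof -
  obtain C where C: "countable C" "C \<subseteq> M" "mtopology closure_of C = M"
    using assms(1) unfolding separable_space_def by auto
  have "C \<noteq> {}" using C(3) assms(2) by auto
  then have r: "range (from_nat_into C) = C" using C(1) by (rule range_from_nat_into)
  show thesis
  proof (rule that[of "from_nat_into C"])
    show "from_nat_into C n \<in> M" for n using r C(2) by blast
    fix x r :: _ assume x: "x \<in> M" and "0 < (r::real)"
    then obtain y where "y \<in> C" "y \<in> mball x r" using C(3) unfolding metric_closure_of by blast
    then show "\<exists>n. d (from_nat_into C n) x < r"
      using r by (metis in_mball commute rangeE)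
  qed
qed

text \<open>The branch is enriched by a choice of closed balls with radii tending to 0. A selected
  branch then determines nested nonempty closed sets of vanishing diameter, whose intersection is
  one point by Cantor's theorem; this point is the value of the section.\<close>

lemma measurable_uniformization:
  fixes M :: "'a measure" and N :: "'b measure"
  assumes fin: "finite_measure M" and N: "standard_borel N"
    and D: "D \<in> sets (M \<Otimes>\<^sub>M N)" and e: "e < outer_measure_of M (fst ` D)"
  obtains D' where "D' \<in> sets (M \<Otimes>\<^sub>M N)" "D' \<subseteq> D"
    "\<And>x y z. (x, y) \<in> D' \<Longrightarrow> (x, z) \<in> D' \<Longrightarrow> y = z"
    "fst ` D' \<in> sets M" "e \<le> emeasure M (fst ` D')"
proof -
  obtain d where d: "Metric_space (space N) d" and compl: "Metric_space.mcomplete (space N) d"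
    and sep: "separable_space (Metric_space.mtopology (space N) d)"
    and setsN: "sets N = sigma_sets (space N) {U. openin (Metric_space.mtopology (space N) d) U}"
    using standard_borelE[OF N] by metis
  interpret Y: Metric_space "space N" d by fact
  have "D \<noteq> {}" using e by auto
  then have ne: "space N \<noteq> {}" using sets.sets_into_space[OF D] by (auto simp: space_pair_measure)
  obtain c where c: "\<And>n. c n \<in> space N" "\<And>x r. x \<in> space N \<Longrightarrow> 0 < r \<Longrightarrow> \<exists>n::nat. d (c n) x < r"
    using Y.separable_dense_sequence[OF sep ne] by metis
  have "suslin_product M Y.mtopology D"
    by (rule suslin_product_sets[OF _ _ setsN D]) (auto intro: Y.metrizable_space_mtopology)
  then obtain A C L where "suslin_scheme M Y.mtopology A C L D"
    unfolding suslin_product_def by blast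
  then have meas: "\<And>n s. A n s \<in> sets M" "\<And>n s. closedin Y.mtopology (C n s)"
    and det: "\<And>n s t. \<forall>i<L n. s i = t i \<Longrightarrow> A n s = A n t" "\<And>n s t. \<forall>i<L n. s i = t i \<Longrightarrow> C n s = C n t"
    and Deq: "D = (\<Union>s. \<Inter>n. A n s \<times> C n s)"
    unfolding suslin_scheme_def by blast+
  \<comment> \<open>The odd coordinates of \<open>s\<close> choose balls whose radii tend to \<open>0\<close>.\<close>
  define ev where "ev s i = s (2 * i)" for s :: "nat \<Rightarrow> nat" and i
  define F where "F n s = C n (ev s) \<inter> Y.mcball (c (s (2 * n + 1))) (1 / Suc n)" for n s
  \<comment> \<open>\<open>2 * L m\<close> covers the even positions that encode the first
    \<open>L m\<close> coordinates of \<open>ev s\<close>, and \<open>2 * m + 2\<close> covers the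
    odd position \<open>2 * m + 1\<close>; summing over \<open>m \<le> n\<close> makes the bound
    valid for all earlier levels too.\<close>
  define L' where "L' n = (\<Sum>m\<le>n. 2 * L m + 2 * m + 2)" for n
  have L': "2 * L m + 2 * m + 2 \<le> L' n" if "m \<le> n" for m n
    unfolding L'_def using that by (intro member_le_sum) auto
  have det': "A m (ev s) = A m (ev t)" "F m s = F m t" if "m \<le> n" "\<forall>i<L' n. s i = t i" for n m s t
  proof -
    have "\<forall>i<L m. ev s i = ev t i" "s (2 * m + 1) = t (2 * m + 1)"
      using that(2) L'[OF that(1)] by (auto simp: ev_def)
    then show "A m (ev s) = A m (ev t)" "F m s = F m t" using det unfolding F_def by metis+
  qed
  have closedF: "closedin Y.mtopology (F n s)" for n s
    unfolding F_def by (intro closedin_Int meas Y.closedin_mcball)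
  \<comment> \<open>Emptying the level when the closed sets have no common point lets membership of
    \<open>x\<close> certify the nonemptiness that Cantor's theorem needs. The finite intersections
    make the levels decrease.\<close>
  define B where "B n s = (if (\<Inter>m\<le>n. F m s) = {} then {} else (\<Inter>m\<le>n. A m (ev s)))" for n s
  have Bmem: "(\<Inter>m\<le>n. F m s) \<noteq> {}" "x \<in> A n (ev s)" if "x \<in> B n s" for x n s
    using that by (simp_all add: B_def split: if_split_asm)
  have Bsets: "B n s \<in> sets M" for n s
    using meas(1) by (auto simp: B_def intro!: sets.finite_INT)
  have Bdec: "B (Suc n) s \<subseteq> B n s" for n s
    by (auto simp: B_def atMost_Suc)
  have Bdet: "B n s = B n t" if "\<forall>i<L' n. s i = t i" for n s t
  proof -
    have "(\<Inter>m\<le>n. F m s) = (\<Inter>m\<le>n. F m t)" "(\<Inter>m\<le>n. A m (ev s)) = (\<Inter>m\<le>n. A m (ev t))"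
      using det'[OF _ that] by auto
    then show ?thesis unfolding B_def by simp
  qed
  have "fst ` D \<subseteq> (\<Union>s. \<Inter>n. B n s)"
  proof
    fix x assume "x \<in> fst ` D"
    then obtain y where "(x, y) \<in> D" by force
    then obtain s where "(x, y) \<in> (\<Inter>n. A n s \<times> C n s)" unfolding Deq by blast
    then have xy: "\<And>n. x \<in> A n s" "\<And>n. y \<in> C n s" by auto
    have y: "y \<in> space N" using closedin_subset[OF meas(2)] xy(2)[of 0] by auto
    have "\<forall>n. \<exists>k. d (c k) y < 1 / Suc n" using c(2)[OF y] by simp
    then obtain k where k: "\<And>n. d (c (k n)) y < 1 / Suc n" by metis
    define t where "t i = (if even i then s (i div 2) else k (i div 2))" for i
    have "ev t = s" by (auto simp: ev_def t_def)
    moreover have "y \<in> F n t" for n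
      using xy(2) k[of n] c(1) y by (auto simp: F_def \<open>ev t = s\<close> t_def less_imp_le)
    ultimately have "x \<in> B n t" for n using xy(1) by (auto simp: B_def)
    then show "x \<in> (\<Union>s. \<Inter>n. B n s)" by blast
  qed
  then have eB: "e < outer_measure_of M (\<Union>s. \<Inter>n. B n s)"
    using e outer_measure_of_mono by (metis order_less_le_trans)
  obtain P sel where P: "P \<in> sets M" "e \<le> emeasure M P"
      "\<And>x n. x \<in> P \<Longrightarrow> x \<in> B n (sel x)" "\<And>i v. {x \<in> P. sel x i = v} \<in> sets M"
    by (rule suslin_selection[OF fin Bsets Bdec Bdet eB]) (assumption, rule that)
  define D' where "D' = {(x, y). x \<in> P \<and> (\<forall>n. y \<in> F n (sel x))}"
  have single: "\<exists>l. (\<Inter>n. F n (sel x)) = {l}" if "x \<in> P" for x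
  proof -
    let ?K = "\<lambda>n. \<Inter>m\<le>n. F m (sel x)"
    have f1: "\<forall>n. closedin Y.mtopology (?K n)" using closedF by (intro allI closedin_INT) auto
    have f2: "\<forall>n. ?K n \<noteq> {}" using Bmem(1) P(3)[OF that] by blast
    have f3: "decseq ?K" by (auto simp: decseq_def)
    have f4: "\<forall>e>0. \<exists>n a. ?K n \<subseteq> Y.mcball a e"
    proof (intro allI impI)
      fix e :: real assume "0 < e"
      then obtain n where "1 / Suc n < e" using nat_approx_posE by blast
      moreover have "?K n \<subseteq> Y.mcball (c (sel x (2 * n + 1))) (1 / Suc n)" by (auto simp: F_def)
      ultimately have "?K n \<subseteq> Y.mcball (c (sel x (2 * n + 1))) e"
        using Y.mcball_subset_concentric[of "1 / Suc n" e] by auto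
      then show "\<exists>n a. ?K n \<subseteq> Y.mcball a e" by blast
    qed
    have "\<exists>l. l \<in> space N \<and> \<Inter> (range ?K) = {l}"
      by (rule Y.mcomplete_nest_sing[THEN iffD1, OF compl, THEN spec, THEN mp])
        (intro conjI f1 f2 f3 f4)
    moreover have "\<Inter> (range ?K) = (\<Inter>n. F n (sel x))" by auto
    ultimately show ?thesis by auto
  qed
  have fstD': "fst ` D' = P"
  proof
    show "P \<subseteq> fst ` D'"
    proof
      fix x assume x: "x \<in> P"
      then obtain l where "l \<in> (\<Inter>n. F n (sel x))" using single by blast
      then have "(x, l) \<in> D'" using x by (auto simp: D'_def)
      then show "x \<in> fst ` D'" by force
    qed
  qed (auto simp: D'_def)
  show thesis
  proof (rule that[of D'])
    show "D' \<subseteq> D"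
    proof (clarsimp simp: D'_def Deq)
      fix x y assume x: "x \<in> P" "\<forall>n. y \<in> F n (sel x)"
      have "x \<in> A n (ev (sel x))" for n
        using P(3)[OF x(1)] by (rule Bmem(2))
      then show "\<exists>s. \<forall>n. x \<in> A n s \<and> y \<in> C n s" using x(2) by (auto simp: F_def)
    qed
    show "y = z" if yz: "(x, y) \<in> D'" "(x, z) \<in> D'" for x y z
    proof -
      have "x \<in> P" "y \<in> (\<Inter>n. F n (sel x))" "z \<in> (\<Inter>n. F n (sel x))" using yz by (auto simp: D'_def)
      with single[of x] show "y = z" by (metis singletonD)
    qed
    show "fst ` D' \<in> sets M" "e \<le> emeasure M (fst ` D')" using P fstD' by auto
    have closed_sets: "K \<in> sets N" if "closedin Y.mtopology K" for K
    proof -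
      have "K = space N - (space N - K)" using closedin_subset[OF that] by auto
      moreover have "space N - K \<in> sets N"
        unfolding setsN using that by (intro sigma_sets.Basic) (auto simp: closedin_def)
      ultimately show ?thesis by (metis sets.compl_sets)
    qed
    \<comment> \<open>The part of the selected branch that \<open>F n\<close> reads, as a list. As
      there are countably many lists, \<open>D'\<close> becomes a countable intersection of
      countable unions of measurable rectangles.\<close>
    define u where "u n x = map (sel x) [0..<L' n]" for n x
    have umeas: "{x \<in> P. u n x = w} \<in> sets M" for n w
    proof -
      have "{x \<in> P. u n x = w} = (if length w = L' n then P \<inter> (\<Inter>i\<in>{..<L' n}. {x \<in> P. sel x i = w ! i}) else {})"
        by (auto simp: u_def list_eq_iff_nth_eq)
      also have "\<dots> \<in> sets M"
        using P by (cases "L' n = 0") (auto intro!: sets.Int sets.finite_INT)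
      finally show ?thesis .
    qed
    have Fu: "F n (sel x) = F n (\<lambda>i. if i < L' n then u n x ! i else 0)" for n x
      by (rule det'(2)[of n n]) (auto simp: u_def)
    have "D' = (\<Inter>n. \<Union>w. {x \<in> P. u n x = w} \<times> F n (\<lambda>i. if i < L' n then w ! i else 0))"
      unfolding D'_def using Fu by (auto; blast)
    also have "\<dots> \<in> sets (M \<Otimes>\<^sub>M N)"
      by (intro sets.countable_INT sets.countable_UN' pair_measureI umeas closed_sets closedF image_subsetI) auto
    finally show "D' \<in> sets (M \<Otimes>\<^sub>M N)" .
  qed
qed

section \<open>Counting measures along the fibres of a Borel map\<close>

text \<open>This is what makes the graph of a measurable map into \<open>M\<close> measurable, by
  expressing equality through countably many sets. It passes directly to subspaces such as the unit
  space.\<close>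

definition countably_separated :: "'a measure \<Rightarrow> bool" where
  "countably_separated M \<longleftrightarrow> (\<exists>U :: nat \<Rightarrow> 'a set. (\<forall>n. U n \<in> sets M) \<and>
     (\<forall>x\<in>space M. \<forall>y\<in>space M. (\<forall>n. x \<in> U n \<longleftrightarrow> y \<in> U n) \<longrightarrow> x = y))"

lemma standard_borel_countably_separated:
  assumes "standard_borel N"
  shows "countably_separated N"
proof (cases "space N = {}")
  case True
  then show ?thesis unfolding countably_separated_def by (intro exI[of _ "\<lambda>_. {}"]) auto
next
  case False
  obtain d where d: "Metric_space (space N) d"
    and sep: "separable_space (Metric_space.mtopology (space N) d)"
    and setsN: "sets N = sigma_sets (space N) {U. openin (Metric_space.mtopology (space N) d) U}"
    using standard_borelE[OF assms] by metis
  interpret Y: Metric_space "space N" d by fact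
  obtain c where c: "\<And>n. c n \<in> space N" "\<And>x r. x \<in> space N \<Longrightarrow> 0 < r \<Longrightarrow> \<exists>n::nat. d (c n) x < r"
    using Y.separable_dense_sequence[OF sep False] by metis
  define U where "U n = (case prod_decode n of (i, k) \<Rightarrow> Y.mball (c i) (1 / Suc k))" for n
  have "U n \<in> sets N" for n
    unfolding setsN U_def by (auto split: prod.split intro!: sigma_sets.Basic)
  moreover have "x = y" if xy: "x \<in> space N" "y \<in> space N" "\<forall>n. x \<in> U n \<longleftrightarrow> y \<in> U n" for x y
  proof (rule ccontr)
    assume "x \<noteq> y"
    then have "0 < d x y / 2" using xy by simp
    then obtain k where k: "1 / Suc k < d x y / 2" using nat_approx_posE by blast
    obtain i where i: "d (c i) x < 1 / Suc k" using c(2)[OF xy(1), of "1 / Suc k"] by auto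
    then have "x \<in> U (prod_encode (i, k))" using c(1) xy(1) by (simp add: U_def)
    then have "y \<in> U (prod_encode (i, k))" using xy(3) by blast
    then have "d (c i) y < 1 / Suc k" by (simp add: U_def)
    moreover have "d x y \<le> d (c i) x + d (c i) y"
      using Y.triangle[of x "c i" y] xy(1,2) c(1)[of i] Y.commute[of x "c i"] by simp
    ultimately show False using i k by linarith
  qed
  ultimately show ?thesis unfolding countably_separated_def by blast
qed

lemma countably_separated_restrict_space:
  assumes "countably_separated M" "sets L = sets (restrict_space M \<Omega>)"
  shows "countably_separated L"
proof -
  obtain U :: "nat \<Rightarrow> 'a set" where U: "\<And>n. U n \<in> sets M"
    "\<And>x y. x \<in> space M \<Longrightarrow> y \<in> space M \<Longrightarrow> (\<And>n. x \<in> U n \<longleftrightarrow> y \<in> U n) \<Longrightarrow> x = y"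
    using assms(1) unfolding countably_separated_def by metis
  have sp: "space L = \<Omega> \<inter> space M" using sets_eq_imp_space_eq[OF assms(2)] by (simp add: space_restrict_space)
  have "\<Omega> \<inter> U n \<in> sets L" for n using U(1) assms(2) by (auto simp: sets_restrict_space)
  moreover have "x = y" if "x \<in> space L" "y \<in> space L" "\<forall>n. x \<in> \<Omega> \<inter> U n \<longleftrightarrow> y \<in> \<Omega> \<inter> U n" for x y
    using U(2)[of x y] that sp by auto
  ultimately show ?thesis unfolding countably_separated_def by (intro exI[of _ "\<lambda>n. \<Omega> \<inter> U n"]) blast
qed

definition fibre :: "'b measure \<Rightarrow> ('b \<Rightarrow> 'a) \<Rightarrow> 'a \<Rightarrow> 'b set" where
  "fibre N f x = {y \<in> space N. f y = x}"

text \<open>Stated for an arbitrary projection so that it serves twice: with the source map it is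
  the arrow measure, with the range map the image of the arrow measure under inversion.\<close>

definition fibre_measure :: "'b measure \<Rightarrow> ('b \<Rightarrow> 'a) \<Rightarrow> 'a measure \<Rightarrow> 'b measure" where
  "fibre_measure N f M = measure_of (space N) (sets N)
     (\<lambda>A. \<integral>\<^sup>+ x. (\<integral>\<^sup>+ y. indicator A y \<partial>count_space (fibre N f x)) \<partial>M)"

lemma space_fibre_measure [simp]: "space (fibre_measure N f M) = space N"
  and sets_fibre_measure [simp, measurable_cong]: "sets (fibre_measure N f M) = sets N"
  by (simp_all add: fibre_measure_def)

locale standard_fibration = finite_measure M for M :: "'a measure" +
  fixes N :: "'b measure" and f :: "'b \<Rightarrow> 'a"
  assumes total: "standard_borel N"
    and base: "countably_separated M"
    and proj [measurable]: "f \<in> N \<rightarrow>\<^sub>M M"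
begin

lemma graph_sets:
  assumes [measurable]: "B \<in> sets N"
  shows "{(x, y). x \<in> space M \<and> y \<in> B \<and> f y = x} \<in> sets (M \<Otimes>\<^sub>M N)"
proof -
  obtain U :: "nat \<Rightarrow> 'a set" where U [measurable]: "\<And>n. U n \<in> sets M"
    and sep: "\<And>x y. x \<in> space M \<Longrightarrow> y \<in> space M \<Longrightarrow> (\<And>n. x \<in> U n \<longleftrightarrow> y \<in> U n) \<Longrightarrow> x = y"
    using base unfolding countably_separated_def by metis
  have "{(x, y). x \<in> space M \<and> y \<in> B \<and> f y = x} =
      {p \<in> space (M \<Otimes>\<^sub>M N). snd p \<in> B \<and> (\<forall>n. fst p \<in> U n \<longleftrightarrow> f (snd p) \<in> U n)}" (is "?l = ?r")
  proof
    show "?l \<subseteq> ?r" using sets.sets_into_space[OF assms] by (auto simp: space_pair_measure)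
    show "?r \<subseteq> ?l"
    proof
      fix p assume p: "p \<in> ?r"
      then have "fst p = f (snd p)"
        using measurable_space[OF proj] by (intro sep) (auto simp: space_pair_measure)
      with p show "p \<in> ?l" by (auto simp: space_pair_measure)
    qed
  qed
  also have "\<dots> \<in> sets (M \<Otimes>\<^sub>M N)" by measurable
  finally show ?thesis .
qed

text \<open>A uniformization of the flipped graph of \<open>f\<close> over \<open>B\<close> is
  pulled back along \<open>y \<mapsto> (f y, y)\<close>; its uniqueness of second coordinates
  becomes injectivity of \<open>f\<close>.\<close>

lemma partial_section:
  assumes B: "B \<in> sets N" and e: "e < outer_measure_of M (f ` B)"
  obtains B' where "B' \<in> sets N" "B' \<subseteq> B" "inj_on f B'" "f ` B' \<in> sets M" "e \<le> emeasure M (f ` B')"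
proof -
  let ?D = "{(x, y). x \<in> space M \<and> y \<in> B \<and> f y = x}"
  have "f ` B \<subseteq> fst ` ?D"
    using sets.sets_into_space[OF B] measurable_space[OF proj] by force
  then have "e < outer_measure_of M (fst ` ?D)"
    by (intro order_less_le_trans[OF e] outer_measure_of_mono)
  then obtain D' where D': "D' \<in> sets (M \<Otimes>\<^sub>M N)" "D' \<subseteq> ?D"
    "\<And>x y z. (x, y) \<in> D' \<Longrightarrow> (x, z) \<in> D' \<Longrightarrow> y = z"
    "fst ` D' \<in> sets M" "e \<le> emeasure M (fst ` D')"
    by (rule measurable_uniformization[OF finite_measure_axioms total graph_sets[OF B]]) (rule that)
  define B' where "B' = {y \<in> space N. (f y, y) \<in> D'}"
  have im: "f ` B' = fst ` D'"
  proof
    show "fst ` D' \<subseteq> f ` B'"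
      using D'(2) sets.sets_into_space[OF B] by (force simp: B'_def)
  qed (force simp: B'_def)
  show thesis
  proof (rule that[of B'])
    have [measurable]: "D' \<in> sets (M \<Otimes>\<^sub>M N)" by fact
    show "B' \<in> sets N" unfolding B'_def by measurable
    show "B' \<subseteq> B" using D'(2) by (auto simp: B'_def)
    show "inj_on f B'" using D'(3) by (auto simp: inj_on_def B'_def)
  qed (use D' im in auto)
qed

lemma image_completion:
  assumes B: "B \<in> sets N"
  shows "f ` B \<in> sets (completion M)"
proof -
  have "f ` B \<subseteq> space M" using sets.sets_into_space[OF B] measurable_space[OF proj] by auto
  then obtain H where H: "H \<in> sets M" "f ` B \<subseteq> H" "emeasure M H = outer_measure_of M (f ` B)"
    using outer_measure_of_attain[of "f ` B" M] by metis
  have "\<exists>P \<in> sets M. P \<subseteq> f ` B \<and> emeasure M H \<le> emeasure M P"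
  proof (cases "emeasure M H = 0")
    case False
    then have "0 < emeasure M H" by (simp add: zero_less_iff_neq_zero)
    then obtain u where u: "\<And>n. u n < emeasure M H" "u \<longlonglongrightarrow> emeasure M H"
      using approx_from_below_dense_linorder by metis
    have "\<exists>P \<in> sets M. P \<subseteq> f ` B \<and> u n \<le> emeasure M P" for n
      using partial_section[OF B, of "u n"] u(1)[of n] H(3) by (metis image_mono)
    then obtain P where P: "\<And>n. P n \<in> sets M" "\<And>n. P n \<subseteq> f ` B" "\<And>n. u n \<le> emeasure M (P n)"
      by metis
    have "u n \<le> emeasure M (\<Union>n. P n)" for n
      using P(3)[of n] emeasure_mono[of "P n" "\<Union>n. P n" M] P(1) by (force intro: order_trans)
    then have "emeasure M H \<le> emeasure M (\<Union>n. P n)"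
      using u(2) by (intro LIMSEQ_le_const2) auto
    then show ?thesis using P by (intro bexI[of _ "\<Union>n. P n"]) auto
  qed auto
  then obtain P where P: "P \<in> sets M" "P \<subseteq> f ` B" "emeasure M H \<le> emeasure M P" by blast
  have "emeasure M (H - P) = emeasure M H - emeasure M P"
    using H P by (intro emeasure_Diff) auto
  then have null: "H - P \<in> null_sets M"
    using P(3) H P by (auto simp: null_sets_def diff_eq_0_iff_ennreal less_top[symmetric])
  show ?thesis
    by (rule sets_completionI[of "f ` B" P "f ` B - P" "H - P"]) (use P H null in auto)
qed

text \<open>The first \<open>n\<close> sets of a separating sequence cut \<open>A\<close> into
  finitely many Borel pieces. A piece meets the fibre over \<open>x\<close> exactly when
  \<open>x\<close> lies in its image, which \<open>image_completion\<close> makes measurable; the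
  number of pieces met has the cardinality of the fibre as its supremum.\<close>

lemma count_fibre_measurable:
  assumes A: "A \<in> sets N"
  shows "(\<lambda>x. emeasure (count_space UNIV) (A \<inter> fibre N f x)) \<in> borel_measurable (completion M)"
proof -
  obtain V :: "nat \<Rightarrow> 'b set" where V [measurable]: "\<And>n. V n \<in> sets N"
    and sep: "\<And>x y. x \<in> space N \<Longrightarrow> y \<in> space N \<Longrightarrow> (\<And>n. x \<in> V n \<longleftrightarrow> y \<in> V n) \<Longrightarrow> x = y"
    using standard_borel_countably_separated[OF total] unfolding countably_separated_def by metis
  define q where "q n y = {i. i < n \<and> y \<in> V i}" for n :: nat and y
  have finq: "finite (q n ` S)" for n S
    by (rule finite_subset[of _ "Pow {..<n}"]) (auto simp: q_def)
  have inj: "\<exists>n. inj_on (q n) F" if F: "finite F" "F \<subseteq> space N" for F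
  proof -
    have "\<forall>y\<in>F. \<forall>z\<in>F. \<exists>i. y \<noteq> z \<longrightarrow> (y \<in> V i) \<noteq> (z \<in> V i)" using F(2) sep by blast
    then obtain i where i: "\<And>y z. y \<in> F \<Longrightarrow> z \<in> F \<Longrightarrow> y \<noteq> z \<Longrightarrow> (y \<in> V (i y z)) \<noteq> (z \<in> V (i y z))"
      by metis
    define n where "n = Suc (Max (case_prod i ` (F \<times> F)))"
    have "i y z < n" if "y \<in> F" "z \<in> F" for y z
      unfolding n_def less_Suc_eq_le using F(1) that by (intro Max_ge) auto
    then have "inj_on (q n) F" using i unfolding inj_on_def q_def by blast
    then show ?thesis by blast
  qed
  have eq: "emeasure (count_space UNIV) S = (SUP n. of_nat (card (q n ` S)))" if S: "S \<subseteq> space N" for S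
  proof (rule antisym)
    have F: "\<exists>n. card F \<le> card (q n ` S)" if F: "finite F" "F \<subseteq> S" for F
    proof -
      obtain n where "inj_on (q n) F" using inj[OF F(1) order_trans[OF F(2) S]] by blast
      then have "card F \<le> card (q n ` S)"
        using card_mono[OF finq image_mono[OF F(2)], of n] card_image[of "q n" F] by simp
      then show ?thesis by blast
    qed
    show "emeasure (count_space UNIV) S \<le> (SUP n. of_nat (card (q n ` S)))"
    proof (cases "finite S")
      case True
      then obtain n where "card S \<le> card (q n ` S)" using F by blast
      then show ?thesis using True by (auto intro!: SUP_upper2[of n])
    next
      case False
      have "\<exists>n\<in>UNIV. of_nat k \<le> (of_nat (card (q n ` S)) :: ennreal)" for k
      proof -
        obtain F where "finite F" "card F = k" "F \<subseteq> S"
          using infinite_arbitrarily_large[OF False] by blast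
        then show ?thesis using F by (metis UNIV_I of_nat_mono)
      qed
      then have "(SUP n. of_nat (card (q n ` S))) = (top :: ennreal)" by (rule ennreal_SUP_eq_top)
      then show ?thesis by (simp only: top_greatest)
    qed
    show "(SUP n. of_nat (card (q n ` S))) \<le> emeasure (count_space UNIV) S"
      by (cases "finite S") (auto intro!: SUP_least of_nat_mono card_image_le)
  qed
  \<comment> \<open>\<open>card (q n ` S)\<close> is the number of atoms of the algebra generated by \<open>V 0, \<dots>, V (n - 1)\<close>
    that meet \<open>S\<close>.\<close>
  have card: "of_nat (card (q n ` (A \<inter> fibre N f x))) =
      (\<Sum>J\<in>Pow {..<n}. indicator (f ` {y \<in> A. q n y = J}) x :: ennreal)" for n x
  proof -
    have "(\<Sum>J\<in>Pow {..<n}. indicator (f ` {y \<in> A. q n y = J}) x :: ennreal) =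
        (\<Sum>J\<in>Pow {..<n}. indicator (q n ` (A \<inter> fibre N f x)) J)"
      using sets.sets_into_space[OF A]
      by (intro sum.cong refl) (auto simp: indicator_def fibre_def image_iff)
    also have "\<dots> = of_nat (card (Pow {..<n} \<inter> q n ` (A \<inter> fibre N f x)))"
      by (simp add: indicator_def sum.If_cases)
    also have "Pow {..<n} \<inter> q n ` (A \<inter> fibre N f x) = q n ` (A \<inter> fibre N f x)"
      by (auto simp: q_def)
    finally show ?thesis by simp
  qed
  have [measurable]: "f ` {y \<in> A. q n y = J} \<in> sets (completion M)" for n J
  proof (rule image_completion)
    have "{y \<in> A. q n y = J} = (if J \<subseteq> {..<n} then A \<inter> {y \<in> space N. \<forall>i<n. i \<in> J \<longleftrightarrow> y \<in> V i} else {})"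
      using sets.sets_into_space[OF A] by (auto simp: q_def)
    also have "\<dots> \<in> sets N" using A by auto
    finally show "{y \<in> A. q n y = J} \<in> sets N" .
  qed
  have "(\<lambda>x. SUP n. (\<Sum>J\<in>Pow {..<n}. indicator (f ` {y \<in> A. q n y = J}) x :: ennreal)) \<in> borel_measurable (completion M)"
    by measurable
  moreover have "emeasure (count_space UNIV) (A \<inter> fibre N f x) =
      (SUP n. (\<Sum>J\<in>Pow {..<n}. indicator (f ` {y \<in> A. q n y = J}) x :: ennreal))" for x
    unfolding card[symmetric] by (rule eq) (auto simp: fibre_def)
  ultimately show ?thesis by simp
qed

lemma fibre_indicator:
  "(\<integral>\<^sup>+ y. indicator A y \<partial>count_space (fibre N f x)) = emeasure (count_space UNIV) (A \<inter> fibre N f x)"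
proof -
  have "(\<integral>\<^sup>+ y. indicator A y \<partial>count_space (fibre N f x)) =
      (\<integral>\<^sup>+ y. indicator A y * indicator (fibre N f x) y \<partial>count_space UNIV)"
    by (simp add: nn_integral_count_space_indicator)
  also have "\<dots> = (\<integral>\<^sup>+ y. indicator (A \<inter> fibre N f x) y \<partial>count_space UNIV)"
    by (simp add: indicator_inter_arith)
  finally show ?thesis by simp
qed

lemma fibre_nn_integral_measurable:
  assumes "h \<in> borel_measurable N"
  shows "(\<lambda>x. \<integral>\<^sup>+ y. h y \<partial>count_space (fibre N f x)) \<in> borel_measurable (completion M)"
  using assms
proof (induction rule: borel_measurable_induct)
  case (cong g h)
  have "(\<integral>\<^sup>+ y. g y \<partial>count_space (fibre N f x)) = (\<integral>\<^sup>+ y. h y \<partial>count_space (fibre N f x))" for x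
    using cong(3) by (intro nn_integral_cong) (auto simp: fibre_def)
  then show ?case using cong by simp
next
  case (set A)
  then show ?case using count_fibre_measurable by (simp add: fibre_indicator)
next
  case (mult u c)
  then show ?case by (simp add: nn_integral_cmult)
next
  case (add u v)
  then show ?case by (simp add: nn_integral_add)
next
  case (seq U)
  have "(\<lambda>x. \<integral>\<^sup>+ y. (SUP i. U i) y \<partial>count_space (fibre N f x)) =
      (\<lambda>x. SUP i. \<integral>\<^sup>+ y. U i y \<partial>count_space (fibre N f x))"
    using seq(3) by (simp add: nn_integral_monotone_convergence_SUP image_image)
  then show ?case using seq by simp
qed

text \<open>Countable additivity has to be proved to exclude the zero fallback of
  \<open>measure_of\<close>. The inner count is measurable only for the completion, but
  \<open>nn_integral\<close> takes the same value over \<open>M\<close> and its completion, so sums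
  may be exchanged there.\<close>

lemma emeasure_fibre_measure:
  assumes "A \<in> sets N"
  shows "emeasure (fibre_measure N f M) A =
    (\<integral>\<^sup>+ x. (\<integral>\<^sup>+ y. indicator A y \<partial>count_space (fibre N f x)) \<partial>M)"
proof (rule emeasure_measure_of[OF fibre_measure_def])
  show "countably_additive (sets (fibre_measure N f M))
      (\<lambda>A. \<integral>\<^sup>+ x. (\<integral>\<^sup>+ y. indicator A y \<partial>count_space (fibre N f x)) \<partial>M)"
  proof (rule countably_additiveI)
    fix B :: "nat \<Rightarrow> 'b set"
    assume B: "range B \<subseteq> sets (fibre_measure N f M)" "disjoint_family B"
    have "(\<integral>\<^sup>+ x. \<integral>\<^sup>+ y. indicator (\<Union>i. B i) y \<partial>count_space (fibre N f x) \<partial>M) =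
        (\<integral>\<^sup>+ x. (\<Sum>i. \<integral>\<^sup>+ y. indicator (B i) y \<partial>count_space (fibre N f x)) \<partial>completion M)"
      using B(2) by (simp add: suminf_indicator[symmetric] nn_integral_suminf nn_integral_completion)
    also have "\<dots> = (\<Sum>i. \<integral>\<^sup>+ x. \<integral>\<^sup>+ y. indicator (B i) y \<partial>count_space (fibre N f x) \<partial>completion M)"
      using B(1) by (intro nn_integral_suminf fibre_nn_integral_measurable) auto
    finally show "(\<Sum>i. \<integral>\<^sup>+ x. \<integral>\<^sup>+ y. indicator (B i) y \<partial>count_space (fibre N f x) \<partial>M) =
        (\<integral>\<^sup>+ x. \<integral>\<^sup>+ y. indicator (\<Union>i. B i) y \<partial>count_space (fibre N f x) \<partial>M)"
      by (simp add: nn_integral_completion)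
  qed
qed (use assms sets.space_closed in \<open>auto simp: positive_def\<close>)

lemma nn_integral_fibre_measure:
  assumes "h \<in> borel_measurable N"
  shows "(\<integral>\<^sup>+ y. h y \<partial>fibre_measure N f M) = (\<integral>\<^sup>+ x. (\<integral>\<^sup>+ y. h y \<partial>count_space (fibre N f x)) \<partial>M)"
  using assms
proof (induction rule: borel_measurable_induct)
  case (cong g h)
  have "(\<integral>\<^sup>+ y. g y \<partial>count_space (fibre N f x)) = (\<integral>\<^sup>+ y. h y \<partial>count_space (fibre N f x))" for x
    using cong(3) by (intro nn_integral_cong) (auto simp: fibre_def)
  moreover have "(\<integral>\<^sup>+ y. g y \<partial>fibre_measure N f M) = (\<integral>\<^sup>+ y. h y \<partial>fibre_measure N f M)"
    using cong(3) by (intro nn_integral_cong) auto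
  ultimately show ?case using cong by simp
next
  case (set A)
  then show ?case using emeasure_fibre_measure[of A] by simp
next
  case (mult u c)
  have "(\<integral>\<^sup>+ x. c * (\<integral>\<^sup>+ y. u y \<partial>count_space (fibre N f x)) \<partial>completion M) =
      c * (\<integral>\<^sup>+ x. (\<integral>\<^sup>+ y. u y \<partial>count_space (fibre N f x)) \<partial>completion M)"
    using mult by (intro nn_integral_cmult fibre_nn_integral_measurable)
  then show ?case using mult by (simp add: nn_integral_cmult nn_integral_completion)
next
  case (add u v)
  have "(\<integral>\<^sup>+ x. (\<integral>\<^sup>+ y. u y \<partial>count_space (fibre N f x)) + (\<integral>\<^sup>+ y. v y \<partial>count_space (fibre N f x)) \<partial>completion M) =
      (\<integral>\<^sup>+ x. (\<integral>\<^sup>+ y. u y \<partial>count_space (fibre N f x)) \<partial>completion M) +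
      (\<integral>\<^sup>+ x. (\<integral>\<^sup>+ y. v y \<partial>count_space (fibre N f x)) \<partial>completion M)"
    using add by (intro nn_integral_add fibre_nn_integral_measurable)
  then show ?case using add by (simp add: nn_integral_add nn_integral_completion add.commute)
next
  case (seq U)
  have "(\<integral>\<^sup>+ x. \<integral>\<^sup>+ y. (SUP i. U i) y \<partial>count_space (fibre N f x) \<partial>completion M) =
      (\<integral>\<^sup>+ x. (SUP i. \<integral>\<^sup>+ y. U i y \<partial>count_space (fibre N f x)) \<partial>completion M)"
    using seq(3) by (simp add: nn_integral_monotone_convergence_SUP image_image)
  also have "\<dots> = (SUP i. \<integral>\<^sup>+ x. \<integral>\<^sup>+ y. U i y \<partial>count_space (fibre N f x) \<partial>completion M)"
    using seq(1,3) by (intro nn_integral_monotone_convergence_SUP fibre_nn_integral_measurable)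
      (auto simp: incseq_def le_fun_def intro!: nn_integral_mono)
  also have "\<dots> = (SUP i. \<integral>\<^sup>+ y. U i y \<partial>fibre_measure N f M)"
    using seq by (simp add: nn_integral_completion)
  also have "\<dots> = (\<integral>\<^sup>+ y. (SUP i. U i) y \<partial>fibre_measure N f M)"
    using seq by (simp add: nn_integral_monotone_convergence_SUP image_image)
  finally show ?case by (simp add: nn_integral_completion)
qed

lemma AE_fibre_measure:
  assumes [measurable]: "Measurable.pred N P"
  shows "(AE y in fibre_measure N f M. P y) \<longleftrightarrow> (AE x in M. \<forall>y\<in>fibre N f x. P y)"
proof -
  let ?A = "{y \<in> space N. \<not> P y}"
  have [measurable]: "?A \<in> sets N" by measurable
  have "(AE y in fibre_measure N f M. P y) \<longleftrightarrow> emeasure (fibre_measure N f M) ?A = 0"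
    by (subst AE_iff_measurable[of ?A]) auto
  also have "\<dots> \<longleftrightarrow> (\<integral>\<^sup>+ x. emeasure (count_space UNIV) (?A \<inter> fibre N f x) \<partial>completion M) = 0"
    by (simp add: emeasure_fibre_measure fibre_indicator nn_integral_completion)
  also have "\<dots> \<longleftrightarrow> (AE x in completion M. emeasure (count_space UNIV) (?A \<inter> fibre N f x) = 0)"
    by (intro nn_integral_0_iff_AE count_fibre_measurable) simp
  also have "\<dots> \<longleftrightarrow> (AE x in M. \<forall>y\<in>fibre N f x. P y)"
    unfolding AE_completion_iff by (rule AE_cong) (auto simp: emeasure_count_space_eq_0 fibre_def)
  finally show ?thesis .
qed

text \<open>A set of positive measure has an image of positive outer measure, since otherwise almost
  every fibre would miss it. A partial section over part of the image meets each fibre at most once,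
  so its measure is that of its image.\<close>

lemma fibre_measure_semifinite:
  assumes A: "A \<in> sets N" "emeasure (fibre_measure N f M) A > 0"
  obtains B where "B \<in> sets N" "B \<subseteq> A" "emeasure (fibre_measure N f M) B > 0"
    "emeasure (fibre_measure N f M) B < \<infinity>"
proof -
  have "outer_measure_of M (f ` A) \<noteq> 0"
  proof
    assume 0: "outer_measure_of M (f ` A) = 0"
    have "f ` A \<subseteq> space M" using sets.sets_into_space[OF A(1)] measurable_space[OF proj] by auto
    then obtain H where H: "H \<in> sets M" "f ` A \<subseteq> H" "emeasure M H = 0"
      using outer_measure_of_attain[of "f ` A" M] 0 by metis
    then have "AE x in M. x \<notin> H" by (intro AE_not_in) auto
    then have "AE x in M. \<forall>y\<in>fibre N f x. y \<notin> A"
      by (rule AE_mp) (use H(2) in \<open>auto simp: fibre_def\<close>)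
    then have "AE y in fibre_measure N f M. y \<notin> A" using A by (subst AE_fibre_measure) auto
    then have "A \<in> null_sets (fibre_measure N f M)" using A(1) by (subst AE_iff_null_sets) auto
    then show False using A(2) by auto
  qed
  then obtain e where e: "0 < e" "e < outer_measure_of M (f ` A)"
    using dense[of 0 "outer_measure_of M (f ` A)"] by (auto simp: zero_less_iff_neq_zero)
  obtain B where B: "B \<in> sets N" "B \<subseteq> A" "inj_on f B" "f ` B \<in> sets M" "e \<le> emeasure M (f ` B)"
    using partial_section[OF A(1) e(2)] by metis
  have "emeasure (count_space UNIV) (B \<inter> fibre N f x) = indicator (f ` B) x" for x
  proof (cases "x \<in> f ` B")
    case True
    then obtain y where y: "y \<in> B" "f y = x" by blast
    then have "B \<inter> fibre N f x = {y}"
      using B(3) sets.sets_into_space[OF B(1)] by (auto simp: fibre_def inj_on_def)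
    then show ?thesis using True by simp
  next
    case False
    then have "B \<inter> fibre N f x = {}" by (auto simp: fibre_def)
    then show ?thesis using False by simp
  qed
  then have "emeasure (fibre_measure N f M) B = emeasure M (f ` B)"
    using B by (simp add: emeasure_fibre_measure fibre_indicator)
  moreover have "0 < emeasure M (f ` B)" "emeasure M (f ` B) < \<infinity>"
    using B(5) e(1) emeasure_finite[of "f ` B"] by (auto simp: less_top[symmetric] intro: order_less_le_trans)
  ultimately show thesis using that[OF B(1,2)] by simp
qed

end

section \<open>Square summable functions and Gram matrices\<close>

lemma has_sum_finite_sum:
  fixes f :: "'i \<Rightarrow> 'b \<Rightarrow> 'c :: topological_comm_monoid_add"
  assumes "finite I" "\<And>i. i \<in> I \<Longrightarrow> (f i has_sum s i) E"
  shows "((\<lambda>x. \<Sum>i\<in>I. f i x) has_sum (\<Sum>i\<in>I. s i)) E"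
  using assms by (induction I rule: finite_induct) (auto intro: has_sum_add has_sum_0)

lemma norm_infsum_le_nn_integral:
  fixes f :: "'b \<Rightarrow> 'c :: banach"
  assumes "(\<integral>\<^sup>+ x. ennreal (norm (f x)) \<partial>count_space E) \<le> ennreal C" "0 \<le> C"
  shows "(\<lambda>x. norm (f x)) summable_on E" "norm (infsum f E) \<le> C"
proof -
  have fin: "(\<Sum>x\<in>F. norm (f x)) \<le> C" if F: "finite F" "F \<subseteq> E" for F
  proof -
    have "ennreal (\<Sum>x\<in>F. norm (f x)) = (\<integral>\<^sup>+ x. ennreal (norm (f x)) \<partial>count_space F)"
      using F(1) by (simp add: nn_integral_count_space_finite sum_ennreal)
    also have "\<dots> \<le> (\<integral>\<^sup>+ x. ennreal (norm (f x)) \<partial>count_space E)"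
      using F(2) by (auto simp: nn_integral_count_space_indicator indicator_def intro!: nn_integral_mono)
    finally show ?thesis using assms by (metis ennreal_le_iff order_trans)
  qed
  then show s: "(\<lambda>x. norm (f x)) summable_on E"
    by (intro nonneg_bdd_above_summable_on) (auto intro!: bdd_aboveI)
  then have "norm (infsum f E) \<le> infsum (\<lambda>x. norm (f x)) E" by (rule norm_infsum_bound)
  also have "\<dots> \<le> C" using s fin by (rule infsum_le_finite_sums)
  finally show "norm (infsum f E) \<le> C" .
qed

lemma nn_integral_count_space_has_sum:
  fixes f :: "'b \<Rightarrow> real"
  assumes "(f has_sum S) E" "\<And>x. x \<in> E \<Longrightarrow> 0 \<le> f x"
  shows "(\<integral>\<^sup>+ x. ennreal (f x) \<partial>count_space E) = ennreal S"
proof -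
  have "(\<lambda>x. norm (f x)) summable_on E"
    using assms by (auto simp: summable_on_def cong: summable_on_cong)
  then have s: "Infinite_Set_Sum.abs_summable_on f E" using abs_summable_equivalent by blast
  then have "(\<integral>\<^sup>+ x. ennreal (f x) \<partial>count_space E) = ennreal (infsetsum f E)"
    using assms(2) by (rule nn_integral_conv_infsetsum)
  also have "infsetsum f E = S" using s assms(1) by (simp add: infsetsum_infsum infsumI)
  finally show ?thesis .
qed

text \<open>The quadratic form is the sum over \<open>E\<close> of the squared moduli of the
  combinations with coefficients \<open>c j\<close>. The double sum is finite and each product is
  summable, so the sums may be exchanged.\<close>

lemma pos_semidef_gram:
  assumes a: "\<And>i. i < k \<Longrightarrow> (\<lambda>\<eta>. (cmod (a i \<eta>))\<^sup>2) summable_on E"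
  shows "pos_semidef k (\<lambda>i j. \<Sum>\<^sub>\<infinity>\<eta>\<in>E. cnj (a i \<eta>) * a j \<eta>)"
  unfolding pos_semidef_def
proof
  fix c :: "nat \<Rightarrow> complex"
  let ?s = "\<Sum>i<k. \<Sum>j<k. cnj (c i) * (\<Sum>\<^sub>\<infinity>\<eta>\<in>E. cnj (a i \<eta>) * a j \<eta>) * c j"
  have summ: "(\<lambda>\<eta>. cnj (a i \<eta>) * a j \<eta>) summable_on E" if ij: "i < k" "j < k" for i j
  proof (rule abs_summable_summable, rule Infinite_Sum.abs_summable_on_comparison_test)
    show "(\<lambda>\<eta>. norm ((cmod (a i \<eta>))\<^sup>2 + (cmod (a j \<eta>))\<^sup>2)) summable_on E"
      using summable_on_add[OF a[OF ij(1)] a[OF ij(2)]] by simp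
    fix \<eta>
    have "0 \<le> (cmod (a i \<eta>) - cmod (a j \<eta>))\<^sup>2" "0 \<le> (cmod (a i \<eta>))\<^sup>2 + (cmod (a j \<eta>))\<^sup>2" by auto
    then show "norm (cnj (a i \<eta>) * a j \<eta>) \<le> norm ((cmod (a i \<eta>))\<^sup>2 + (cmod (a j \<eta>))\<^sup>2)"
      unfolding norm_mult complex_mod_cnj real_norm_def by (simp only: power2_diff)
  qed
  have "((\<lambda>\<eta>. \<Sum>i<k. \<Sum>j<k. cnj (c i) * (cnj (a i \<eta>) * a j \<eta>) * c j) has_sum ?s) E"
    by (intro has_sum_finite_sum has_sum_cmult_left has_sum_cmult_right has_sum_infsum summ) auto
  moreover have "(\<Sum>i<k. \<Sum>j<k. cnj (c i) * (cnj (a i \<eta>) * a j \<eta>) * c j) =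
      complex_of_real ((cmod (\<Sum>j<k. a j \<eta> * c j))\<^sup>2)" for \<eta>
  proof -
    have "complex_of_real ((cmod (\<Sum>j<k. a j \<eta> * c j))\<^sup>2) =
        cnj (\<Sum>i<k. a i \<eta> * c i) * (\<Sum>j<k. a j \<eta> * c j)"
      by (metis complex_norm_square mult.commute of_real_power)
    also have "\<dots> = (\<Sum>i<k. \<Sum>j<k. (cnj (a i \<eta>) * cnj (c i)) * (a j \<eta> * c j))"
      by (simp only: sum_product cnj_sum complex_cnj_mult)
    also have "\<dots> = (\<Sum>i<k. \<Sum>j<k. cnj (c i) * (cnj (a i \<eta>) * a j \<eta>) * c j)"
      by (intro sum.cong refl) (simp only: mult_ac)
    finally show ?thesis by (rule sym)
  qed
  ultimately have hs: "((\<lambda>\<eta>. complex_of_real ((cmod (\<Sum>j<k. a j \<eta> * c j))\<^sup>2)) has_sum ?s) E"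
    by simp
  have "0 \<le> Re ?s" using has_sum_Re[OF hs] by (rule has_sum_nonneg) simp
  moreover have "Im ?s = 0"
    using has_sum_unique[OF has_sum_Im[OF hs] has_sum_0] by simp
  ultimately show "?s \<in> \<real>\<^sub>\<ge>\<^sub>0" by (simp add: complex_nonneg_Reals_iff)
qed

lemma pos_semidef_add:
  assumes "pos_semidef k A" "pos_semidef k B"
  shows "pos_semidef k (\<lambda>i j. A i j + B i j)"
  unfolding pos_semidef_def
proof
  fix c :: "nat \<Rightarrow> complex"
  have "(\<Sum>i<k. \<Sum>j<k. cnj (c i) * (A i j + B i j) * c j) =
      (\<Sum>i<k. \<Sum>j<k. cnj (c i) * A i j * c j) + (\<Sum>i<k. \<Sum>j<k. cnj (c i) * B i j * c j)"
    by (simp add: distrib_left distrib_right sum.distrib)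
  then show "(\<Sum>i<k. \<Sum>j<k. cnj (c i) * (A i j + B i j) * c j) \<in> \<real>\<^sub>\<ge>\<^sub>0"
    using assms unfolding pos_semidef_def by (simp add: nonneg_Reals_add_I)
qed

lemma pos_semidef_cong:
  assumes "pos_semidef k A" "\<And>i j. i < k \<Longrightarrow> j < k \<Longrightarrow> A i j = B i j"
  shows "pos_semidef k B"
proof -
  have "(\<Sum>i<k. \<Sum>j<k. cnj (c i) * B i j * c j) = (\<Sum>i<k. \<Sum>j<k. cnj (c i) * A i j * c j)" for c
    using assms(2) by (intro sum.cong refl) auto
  then show ?thesis using assms(1) by (simp add: pos_semidef_def)
qed

text \<open>Markov's inequality for counting: at most \<open>a * b\<close> points carry a value of
  at least \<open>1 / b\<close>. The multiplied form avoids division in \<open>ennreal\<close> and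
  remains meaningful for \<open>b = 0\<close>.\<close>

lemma nn_integral_count_space_markov:
  assumes "(\<integral>\<^sup>+ y. h y \<partial>count_space E) \<le> of_nat a" "\<And>y. y \<in> S \<Longrightarrow> y \<in> E \<and> 1 \<le> of_nat b * h y"
  shows "emeasure (count_space UNIV) S \<le> of_nat (a * b)"
proof -
  have "emeasure (count_space UNIV) S = (\<integral>\<^sup>+ y. indicator S y \<partial>count_space UNIV)" by simp
  also have "\<dots> \<le> (\<integral>\<^sup>+ y. of_nat b * h y * indicator E y \<partial>count_space UNIV)"
    using assms(2) by (intro nn_integral_mono) (auto simp: indicator_def)
  also have "\<dots> = of_nat b * (\<integral>\<^sup>+ y. h y \<partial>count_space E)"
    by (simp add: nn_integral_cmult mult.assoc nn_integral_count_space_indicator[symmetric])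
  also have "\<dots> \<le> of_nat b * of_nat a" using assms(1) by (rule mult_left_mono) simp
  finally show ?thesis by (simp add: mult.commute)
qed

section \<open>Coefficients of vector fields on a groupoid\<close>

context groupoid
begin

lemma ginv_ginv:
  assumes "\<gamma> \<in> space (arrows G)"
  shows "ginv G (ginv G \<gamma>) = \<gamma>"
proof -
  let ?i = "ginv G \<gamma>"
  have c: "(\<gamma>, ?i) \<in> composable G" "(?i, ginv G ?i) \<in> composable G"
    using assms by (auto simp: composable_def ginv_closed rng_ginv src_ginv)
  have "\<gamma> = gmul G \<gamma> (gmul G ?i (ginv G ?i))"
    using assms by (simp add: gmul_ginv ginv_closed rng_ginv src_unit)
  also have "\<dots> = gmul G (gmul G \<gamma> ?i) (ginv G ?i)"
    using gmul_assoc[OF c] by simp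
  also have "\<dots> = ginv G ?i"
    using assms rng_unit[of "ginv G ?i"] by (simp add: gmul_ginv ginv_closed rng_ginv src_ginv)
  finally show ?thesis by simp
qed

lemma ginv_gmul_cancel:
  assumes "\<gamma> \<in> space (arrows G)" "\<eta> \<in> space (arrows G)" "rng G \<eta> = rng G \<gamma>"
  shows "gmul G \<gamma> (gmul G (ginv G \<gamma>) \<eta>) = \<eta>"
proof -
  have "gmul G \<gamma> (gmul G (ginv G \<gamma>) \<eta>) = gmul G (gmul G \<gamma> (ginv G \<gamma>)) \<eta>"
    using assms by (intro gmul_assoc[symmetric]) (auto simp: composable_def ginv_closed rng_ginv src_ginv)
  then show ?thesis using assms by (metis gmul_ginv rng_unit)
qed

lemma gmul_ginv_cancel:
  assumes "\<gamma> \<in> space (arrows G)" "\<eta> \<in> space (arrows G)" "rng G \<eta> = src G \<gamma>"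
  shows "gmul G (ginv G \<gamma>) (gmul G \<gamma> \<eta>) = \<eta>"
  using ginv_gmul_cancel[of "ginv G \<gamma>" \<eta>] assms by (simp add: ginv_closed rng_ginv ginv_ginv)

lemma ginv_gmul_closed:
  assumes "\<gamma> \<in> space (arrows G)" "\<eta> \<in> space (arrows G)" "rng G \<eta> = rng G \<gamma>"
  shows "gmul G (ginv G \<gamma>) \<eta> \<in> space (arrows G)" "rng G (gmul G (ginv G \<gamma>) \<eta>) = src G \<gamma>"
    "src G (gmul G (ginv G \<gamma>) \<eta>) = src G \<eta>"
proof -
  have "(ginv G \<gamma>, \<eta>) \<in> composable G"
    using assms by (auto simp: composable_def ginv_closed src_ginv)
  then show "gmul G (ginv G \<gamma>) \<eta> \<in> space (arrows G)" "rng G (gmul G (ginv G \<gamma>) \<eta>) = src G \<gamma>"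
    "src G (gmul G (ginv G \<gamma>) \<eta>) = src G \<eta>"
    using assms by (simp_all add: gmul_closed rng_gmul src_gmul rng_ginv)
qed

lemma bij_betw_translate:
  assumes "\<gamma> \<in> space (arrows G)"
  shows "bij_betw (gmul G (ginv G \<gamma>)) (rng_fibre G (rng G \<gamma>)) (rng_fibre G (src G \<gamma>))"
proof (rule bij_betwI[where g = "gmul G \<gamma>"])
  show "gmul G (ginv G \<gamma>) \<in> rng_fibre G (rng G \<gamma>) \<rightarrow> rng_fibre G (src G \<gamma>)"
    using assms ginv_gmul_closed by (auto simp: rng_fibre_def)
  show "gmul G \<gamma> \<in> rng_fibre G (src G \<gamma>) \<rightarrow> rng_fibre G (rng G \<gamma>)"
    using assms by (auto simp: rng_fibre_def composable_def intro!: gmul_closed rng_gmul)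
qed (use assms ginv_gmul_cancel gmul_ginv_cancel in \<open>auto simp: rng_fibre_def\<close>)

lemma ginv_unique:
  assumes "\<alpha> \<in> space (arrows G)" "\<beta> \<in> space (arrows G)" "rng G \<beta> = src G \<alpha>"
    "gmul G \<alpha> \<beta> = rng G \<alpha>"
  shows "\<beta> = ginv G \<alpha>"
proof -
  have "\<beta> = gmul G (ginv G \<alpha>) (gmul G \<alpha> \<beta>)"
    using gmul_ginv_cancel[OF assms(1-3)] by (rule sym)
  also have "\<dots> = gmul G (ginv G \<alpha>) (src G (ginv G \<alpha>))" using assms by (simp add: src_ginv)
  finally show ?thesis using src_unit[OF ginv_closed[OF assms(1)]] by simp
qed

lemma ginv_quotient:
  assumes "\<gamma> \<in> space (arrows G)" "\<eta> \<in> space (arrows G)" "rng G \<eta> = rng G \<gamma>"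
  shows "ginv G (gmul G (ginv G \<gamma>) \<eta>) = gmul G (ginv G \<eta>) \<gamma>"
proof (rule ginv_unique[symmetric])
  note c = ginv_gmul_closed[OF assms] ginv_gmul_closed[OF assms(2,1) assms(3)[symmetric]]
  show "gmul G (ginv G \<gamma>) \<eta> \<in> space (arrows G)" "gmul G (ginv G \<eta>) \<gamma> \<in> space (arrows G)"
    "rng G (gmul G (ginv G \<eta>) \<gamma>) = src G (gmul G (ginv G \<gamma>) \<eta>)" using c by auto
  have "gmul G (gmul G (ginv G \<gamma>) \<eta>) (gmul G (ginv G \<eta>) \<gamma>) =
      gmul G (ginv G \<gamma>) (gmul G \<eta> (gmul G (ginv G \<eta>) \<gamma>))"
    using assms c by (intro gmul_assoc) (auto simp: composable_def ginv_closed src_ginv)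
  also have "\<dots> = src G \<gamma>" using assms by (simp add: ginv_gmul_cancel ginv_gmul)
  finally show "gmul G (gmul G (ginv G \<gamma>) \<eta>) (gmul G (ginv G \<eta>) \<gamma>) = rng G (gmul G (ginv G \<gamma>) \<eta>)"
    using c by simp
qed

lemma quotient_gmul:
  assumes "\<gamma> \<in> space (arrows G)" "\<eta> \<in> space (arrows G)" "\<zeta> \<in> space (arrows G)"
    "rng G \<eta> = rng G \<gamma>" "rng G \<zeta> = rng G \<gamma>"
  shows "gmul G (ginv G (gmul G (ginv G \<gamma>) \<eta>)) (gmul G (ginv G \<gamma>) \<zeta>) = gmul G (ginv G \<eta>) \<zeta>"
proof -
  have "gmul G (gmul G (ginv G \<eta>) \<gamma>) (gmul G (ginv G \<gamma>) \<zeta>) =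
      gmul G (ginv G \<eta>) (gmul G \<gamma> (gmul G (ginv G \<gamma>) \<zeta>))"
    using assms ginv_gmul_closed[of \<gamma> \<zeta>]
    by (intro gmul_assoc) (auto simp: composable_def ginv_closed src_ginv)
  then show ?thesis using assms by (simp add: ginv_quotient ginv_gmul_cancel)
qed

text \<open>Restricting a function to the units therefore leaves, in the matrix of quotients, only
  the entries with equal arrows.\<close>

lemma quotient_unit_iff:
  assumes "\<gamma> \<in> space (arrows G)" "\<eta> \<in> space (arrows G)" "rng G \<eta> = rng G \<gamma>"
  shows "gmul G (ginv G \<gamma>) \<eta> = rng G (gmul G (ginv G \<gamma>) \<eta>) \<longleftrightarrow> \<gamma> = \<eta>"
proof
  assume "gmul G (ginv G \<gamma>) \<eta> = rng G (gmul G (ginv G \<gamma>) \<eta>)"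
  then have "gmul G (ginv G \<gamma>) \<eta> = src G \<gamma>" using ginv_gmul_closed[OF assms] by simp
  then show "\<gamma> = \<eta>" using ginv_gmul_cancel[OF assms] src_unit[OF assms(1)] by simp
next
  assume "\<gamma> = \<eta>"
  then show "gmul G (ginv G \<gamma>) \<eta> = rng G (gmul G (ginv G \<gamma>) \<eta>)"
    using assms by (simp add: ginv_gmul rng_src)
qed

text \<open>The substitution of \<open>gmul G (ginv G \<gamma>) \<zeta>\<close> for the summation
  variable moves all sums to the one fibre containing \<gamma> and \<eta>. The matrix of a
  coefficient is thus the Gram matrix of translates of \<xi>.\<close>

lemma fibre_coeff_quotient:
  assumes "\<gamma> \<in> space (arrows G)" "\<eta> \<in> space (arrows G)" "rng G \<eta> = rng G \<gamma>"
  shows "fibre_coeff G \<xi> (gmul G (ginv G \<gamma>) \<eta>) =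
    (\<Sum>\<^sub>\<infinity>\<zeta>\<in>rng_fibre G (rng G \<gamma>). cnj (\<xi> (gmul G (ginv G \<gamma>) \<zeta>)) * \<xi> (gmul G (ginv G \<eta>) \<zeta>))"
proof -
  let ?\<beta> = "gmul G (ginv G \<gamma>) \<eta>"
  have "fibre_coeff G \<xi> ?\<beta> =
      (\<Sum>\<^sub>\<infinity>\<gamma>\<^sub>1\<in>rng_fibre G (src G \<gamma>). cnj (\<xi> \<gamma>\<^sub>1) * \<xi> (gmul G (ginv G ?\<beta>) \<gamma>\<^sub>1))"
    unfolding fibre_coeff_def using ginv_gmul_closed[OF assms] by simp
  also have "\<dots> = (\<Sum>\<^sub>\<infinity>\<zeta>\<in>rng_fibre G (rng G \<gamma>). cnj (\<xi> (gmul G (ginv G \<gamma>) \<zeta>)) *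
      \<xi> (gmul G (ginv G ?\<beta>) (gmul G (ginv G \<gamma>) \<zeta>)))"
    by (rule infsum_reindex_bij_betw[OF bij_betw_translate[OF assms(1)], symmetric])
  also have "\<dots> = (\<Sum>\<^sub>\<infinity>\<zeta>\<in>rng_fibre G (rng G \<gamma>). cnj (\<xi> (gmul G (ginv G \<gamma>) \<zeta>)) * \<xi> (gmul G (ginv G \<eta>) \<zeta>))"
    using assms by (intro infsum_cong) (auto simp: rng_fibre_def quotient_gmul)
  finally show ?thesis .
qed

text \<open>In the second factor the translated arrow has range \<open>src G \<gamma>\<close>, so
  both indicators are constant along the sum.\<close>

lemma fibre_coeff_cut:
  assumes "\<gamma> \<in> space (arrows G)"
  shows "fibre_coeff G (\<lambda>\<gamma>. indicator Y (rng G \<gamma>) * \<xi> \<gamma>) \<gamma> =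
    indicator Y (rng G \<gamma>) * indicator Y (src G \<gamma>) * fibre_coeff G \<xi> \<gamma>"
proof -
  have "fibre_coeff G (\<lambda>\<gamma>. indicator Y (rng G \<gamma>) * \<xi> \<gamma>) \<gamma> =
      (\<Sum>\<^sub>\<infinity>\<gamma>\<^sub>1\<in>rng_fibre G (rng G \<gamma>). (indicator Y (rng G \<gamma>) * indicator Y (src G \<gamma>)) *
        (cnj (\<xi> \<gamma>\<^sub>1) * \<xi> (gmul G (ginv G \<gamma>) \<gamma>\<^sub>1)))"
    unfolding fibre_coeff_def using assms
    by (intro infsum_cong) (auto simp: rng_fibre_def ginv_gmul_closed indicator_def)
  also have "\<dots> = indicator Y (rng G \<gamma>) * indicator Y (src G \<gamma>) * fibre_coeff G \<xi> \<gamma>"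
    unfolding fibre_coeff_def by (rule infsum_cmult_right')
  finally show ?thesis .
qed

lemma nn_integral_translate:
  assumes "\<gamma> \<in> space (arrows G)"
  shows "(\<integral>\<^sup>+ \<zeta>. h (gmul G (ginv G \<gamma>) \<zeta>) \<partial>count_space (rng_fibre G (rng G \<gamma>))) =
    (\<integral>\<^sup>+ \<zeta>. h \<zeta> \<partial>count_space (rng_fibre G (src G \<gamma>)))"
  by (rule nn_integral_bij_count_space[OF bij_betw_translate[OF assms]])

end

section \<open>Level sets of coefficients\<close>

lemma count_le_imp_card:
  assumes "emeasure (count_space UNIV) S \<le> of_nat n"
  shows "finite S" "card S \<le> n"
proof -
  show "finite S"
  proof (rule ccontr)
    assume "infinite S"
    then show False using assms by (simp add: top_unique)
  qed
  then show "card S \<le> n" using assms by simp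
qed

lemma ennreal_archimedean:
  fixes t :: ennreal
  assumes "0 < t"
  obtains n :: nat where "\<And>m. n \<le> m \<Longrightarrow> 1 \<le> of_nat m * t"
proof -
  obtain r where r: "0 < r" "ennreal r \<le> t"
  proof (cases t)
    case (real r)
    then show thesis using that[of r] assms by auto
  next
    case top
    then show thesis using that[of 1] by auto
  qed
  obtain n :: nat where n: "1 / r < real n" using reals_Archimedean2 by blast
  have "1 \<le> of_nat m * t" if "n \<le> m" for m
  proof -
    have "1 / r \<le> real m" using n that by (meson less_imp_le of_nat_mono order_trans)
    then have "1 \<le> real m * r" using r(1) by (simp add: field_simps)
    then have "1 \<le> ennreal (real m * r)" by simp
    also have "\<dots> = of_nat m * ennreal r" using r(1) by (simp add: ennreal_mult ennreal_of_nat_eq_real_of_nat)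
    also have "\<dots> \<le> of_nat m * t" using r(2) by (rule mult_left_mono) simp
    finally show ?thesis .
  qed
  then show thesis using that by blast
qed

text \<open>Each point of \<open>E\<close> lies outside \<open>Ta\<close> or outside
  \<open>Tb\<close>, where one of the vectors has norm at most \<open>e\<close>. The weighted
  inequality \<open>s * t \<le> s\<^sup>2 / (2 * e) + e * t\<^sup>2 / 2\<close> replaces
  Cauchy-Schwarz: each of the two parts contributes \<open>e / 2 + e / 2\<close>.\<close>

lemma infsum_product_bound:
  fixes a b :: "'b \<Rightarrow> complex"
  assumes e: "0 < e" and disj: "E \<inter> Ta \<inter> Tb = {}"
    and a: "(\<integral>\<^sup>+ y. ennreal ((cmod (a y))\<^sup>2) \<partial>count_space E) \<le> 1"
      "(\<integral>\<^sup>+ y. ennreal ((cmod (a y))\<^sup>2) * indicator (- Ta) y \<partial>count_space E) \<le> ennreal (e\<^sup>2)"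
    and b: "(\<integral>\<^sup>+ y. ennreal ((cmod (b y))\<^sup>2) \<partial>count_space E) \<le> 1"
      "(\<integral>\<^sup>+ y. ennreal ((cmod (b y))\<^sup>2) * indicator (- Tb) y \<partial>count_space E) \<le> ennreal (e\<^sup>2)"
  shows "cmod (\<Sum>\<^sub>\<infinity>y\<in>E. cnj (a y) * b y) \<le> 2 * e"
proof (rule norm_infsum_le_nn_integral(2))
  let ?A = "\<lambda>y. ennreal ((cmod (a y))\<^sup>2)" and ?B = "\<lambda>y. ennreal ((cmod (b y))\<^sup>2)"
  let ?c = "ennreal (1 / (2 * e))" and ?d = "ennreal (e / 2)"
  have amgm: "s * t \<le> 1 / (2 * e) * s\<^sup>2 + e / 2 * t\<^sup>2" for s t :: real
  proof -
    have "0 \<le> (s - e * t)\<^sup>2 / (2 * e)" using e by simp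
    also have "\<dots> = 1 / (2 * e) * s\<^sup>2 + e / 2 * t\<^sup>2 - s * t"
      using e by (simp add: power2_eq_square field_simps)
    finally show ?thesis by simp
  qed
  have pt: "ennreal (cmod (cnj (a y) * b y)) \<le>
      (?c * (?A y * indicator (- Ta) y) + ?d * ?B y) + (?c * (?B y * indicator (- Tb) y) + ?d * ?A y)"
    if "y \<in> E" for y
  proof (cases "y \<in> Ta")
    case False
    have "ennreal (cmod (cnj (a y) * b y)) \<le> ennreal (1 / (2 * e) * (cmod (a y))\<^sup>2 + e / 2 * (cmod (b y))\<^sup>2)"
      using amgm[of "cmod (a y)" "cmod (b y)"] by (intro ennreal_leI) (simp add: norm_mult)
    also have "\<dots> = ?c * (?A y * indicator (- Ta) y) + ?d * ?B y"
      using e False by (simp add: ennreal_plus ennreal_mult[symmetric])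
    finally show ?thesis by (rule order_trans) simp
  next
    case True
    then have "y \<notin> Tb" using that disj by blast
    have "ennreal (cmod (cnj (a y) * b y)) \<le> ennreal (1 / (2 * e) * (cmod (b y))\<^sup>2 + e / 2 * (cmod (a y))\<^sup>2)"
      using amgm[of "cmod (b y)" "cmod (a y)"] by (intro ennreal_leI) (simp add: norm_mult mult.commute)
    also have "\<dots> = ?c * (?B y * indicator (- Tb) y) + ?d * ?A y"
      using e \<open>y \<notin> Tb\<close> by (simp add: ennreal_plus ennreal_mult[symmetric])
    finally show ?thesis by (rule order_trans) simp
  qed
  have "(\<integral>\<^sup>+ y. ennreal (cmod (cnj (a y) * b y)) \<partial>count_space E) \<le>
      (\<integral>\<^sup>+ y. (?c * (?A y * indicator (- Ta) y) + ?d * ?B y) + (?c * (?B y * indicator (- Tb) y) + ?d * ?A y) \<partial>count_space E)"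
    using pt by (intro nn_integral_mono) simp
  also have "\<dots> = (?c * (\<integral>\<^sup>+ y. ?A y * indicator (- Ta) y \<partial>count_space E) + ?d * (\<integral>\<^sup>+ y. ?B y \<partial>count_space E)) +
      (?c * (\<integral>\<^sup>+ y. ?B y * indicator (- Tb) y \<partial>count_space E) + ?d * (\<integral>\<^sup>+ y. ?A y \<partial>count_space E))"
    by (simp add: nn_integral_add nn_integral_cmult)
  also have "\<dots> \<le> (?c * ennreal (e\<^sup>2) + ?d * 1) + (?c * ennreal (e\<^sup>2) + ?d * 1)"
    using a b by (intro add_mono mult_left_mono) auto
  also have "\<dots> = ennreal (2 * e)"
    using e by (simp add: ennreal_mult[symmetric] ennreal_plus[symmetric] power2_eq_square del: ennreal_plus)
  finally show "(\<integral>\<^sup>+ y. ennreal (cmod (cnj (a y) * b y)) \<partial>count_space E) \<le> ennreal (2 * e)" .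
qed (use e in simp)

context countable_measured_groupoid
begin

section \<open>The source and range fibre measures and quasi-invariance\<close>

lemma space_unit_measure: "space \<mu> = units G"
  using sets_eq_imp_space_eq[OF sets_units] rng_closed
  by (auto simp: space_restrict_space units_def)

lemma rng_measurable [measurable]: "rng G \<in> arrows G \<rightarrow>\<^sub>M \<mu>"
  and src_measurable [measurable]: "src G \<in> arrows G \<rightarrow>\<^sub>M \<mu>"
proof -
  have "rng G \<in> arrows G \<rightarrow>\<^sub>M restrict_space (arrows G) (units G)"
    by (intro measurable_restrict_space2 rng_borel) (auto simp: units_def)
  then show "rng G \<in> arrows G \<rightarrow>\<^sub>M \<mu>" using measurable_cong_sets[OF refl sets_units] by blast
  have "src G \<gamma> \<in> units G" if "\<gamma> \<in> space (arrows G)" for \<gamma>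
    using that rng_src[OF that] src_closed[OF that] unfolding units_def by (metis image_eqI)
  then have "src G \<in> arrows G \<rightarrow>\<^sub>M restrict_space (arrows G) (units G)"
    by (intro measurable_restrict_space2 src_borel) auto
  then show "src G \<in> arrows G \<rightarrow>\<^sub>M \<mu>" using measurable_cong_sets[OF refl sets_units] by blast
qed

sublocale S: standard_fibration \<mu> "arrows G" "src G"
  using standard countably_separated_restrict_space[OF standard_borel_countably_separated[OF standard] sets_units]
  by unfold_locales auto

sublocale R: standard_fibration \<mu> "arrows G" "rng G"
  using standard countably_separated_restrict_space[OF standard_borel_countably_separated[OF standard] sets_units]
  by unfold_locales auto

abbreviation "\<nu> \<equiv> fibre_measure (arrows G) (src G) \<mu>"
abbreviation "\<nu>' \<equiv> fibre_measure (arrows G) (rng G) \<mu>"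

lemma arrow_measure_eq: "arrow_measure G \<mu> = \<nu>"
  by (simp add: arrow_measure_def fibre_measure_def fibre_def src_fibre_def)

lemma fibre_src: "fibre (arrows G) (src G) x = src_fibre G x"
  and fibre_rng: "fibre (arrows G) (rng G) x = rng_fibre G x"
  by (simp_all add: fibre_def src_fibre_def rng_fibre_def)

text \<open>Inversion exchanges source and range fibres bijectively. Quasi-invariance thereby
  becomes mutual absolute continuity of the two fibre measures.\<close>

lemma distr_ginv: "distr \<nu> \<nu> (ginv G) = \<nu>'"
proof (rule measure_eqI)
  have inv: "ginv G \<in> \<nu> \<rightarrow>\<^sub>M \<nu>" using ginv_borel by (simp cong: measurable_cong_sets)
  fix B assume "B \<in> sets (distr \<nu> \<nu> (ginv G))"
  then have B: "B \<in> sets (arrows G)" by simp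
  let ?B = "ginv G -` B \<inter> space (arrows G)"
  have B': "?B \<in> sets (arrows G)" using ginv_borel B by (rule measurable_sets)
  have "emeasure (distr \<nu> \<nu> (ginv G)) B = emeasure \<nu> ?B"
    using B inv by (simp add: emeasure_distr)
  also have "\<dots> = (\<integral>\<^sup>+ x. (\<integral>\<^sup>+ \<gamma>. indicator ?B \<gamma> \<partial>count_space (src_fibre G x)) \<partial>\<mu>)"
    using S.emeasure_fibre_measure[OF B'] by (simp add: fibre_src)
  also have "\<dots> = (\<integral>\<^sup>+ x. (\<integral>\<^sup>+ \<gamma>. indicator B \<gamma> \<partial>count_space (rng_fibre G x)) \<partial>\<mu>)"
  proof (intro nn_integral_cong)
    fix x
    have bij: "bij_betw (ginv G) (src_fibre G x) (rng_fibre G x)"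
      by (rule bij_betwI[where g = "ginv G"])
        (auto simp: src_fibre_def rng_fibre_def ginv_closed rng_ginv src_ginv ginv_ginv)
    have "(\<integral>\<^sup>+ \<gamma>. indicator ?B \<gamma> \<partial>count_space (src_fibre G x)) =
        (\<integral>\<^sup>+ \<gamma>. indicator B (ginv G \<gamma>) \<partial>count_space (src_fibre G x))"
      by (intro nn_integral_cong) (auto simp: src_fibre_def indicator_def)
    also have "\<dots> = (\<integral>\<^sup>+ \<gamma>. indicator B \<gamma> \<partial>count_space (rng_fibre G x))"
      by (rule nn_integral_bij_count_space[OF bij])
    finally show "(\<integral>\<^sup>+ \<gamma>. indicator ?B \<gamma> \<partial>count_space (src_fibre G x)) =
        (\<integral>\<^sup>+ \<gamma>. indicator B \<gamma> \<partial>count_space (rng_fibre G x))" .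
  qed
  also have "\<dots> = emeasure \<nu>' B"
    using R.emeasure_fibre_measure[OF B] by (simp add: fibre_rng)
  finally show "emeasure (distr \<nu> \<nu> (ginv G)) B = emeasure \<nu>' B" .
qed simp

lemma arrow_measures_equivalent: "absolutely_continuous \<nu> \<nu>'" "absolutely_continuous \<nu>' \<nu>"
  using quasi_inv by (simp_all add: quasi_invariant_def Let_def arrow_measure_eq distr_ginv)

lemma AE_rng_iff: "(AE \<gamma> in \<nu>'. P \<gamma>) \<longleftrightarrow> (AE \<gamma> in \<nu>. P \<gamma>)"
  using absolutely_continuous_AE[OF _ arrow_measures_equivalent(1)]
    absolutely_continuous_AE[OF _ arrow_measures_equivalent(2)] by auto

text \<open>For the source this is built into \<open>\<nu>\<close>. For the range it holds for
  \<open>\<nu>'\<close> and is transferred by quasi-invariance.\<close>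

lemma AE_units:
  assumes "AE x in \<mu>. Q x"
  shows "AE \<gamma> in \<nu>. Q (rng G \<gamma>) \<and> Q (src G \<gamma>)"
proof -
  obtain N where N: "{x \<in> space \<mu>. \<not> Q x} \<subseteq> N" "N \<in> sets \<mu>" "emeasure \<mu> N = 0"
    using assms by (rule AE_E)
  have [measurable]: "N \<in> sets \<mu>" by fact
  have nN: "AE x in \<mu>. x \<notin> N" using N by (intro AE_not_in) auto
  then have "AE x in \<mu>. \<forall>\<gamma>\<in>fibre (arrows G) (src G) x. src G \<gamma> \<notin> N"
    by (rule AE_mp) (auto simp: fibre_def)
  then have s: "AE \<gamma> in \<nu>. src G \<gamma> \<notin> N" by (subst S.AE_fibre_measure) auto
  have "AE x in \<mu>. \<forall>\<gamma>\<in>fibre (arrows G) (rng G) x. rng G \<gamma> \<notin> N"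
    using nN by (rule AE_mp) (auto simp: fibre_def)
  then have "AE \<gamma> in \<nu>'. rng G \<gamma> \<notin> N" by (subst R.AE_fibre_measure) auto
  then have r: "AE \<gamma> in \<nu>. rng G \<gamma> \<notin> N" by (simp add: AE_rng_iff)
  show ?thesis
    using s r AE_space
  proof eventually_elim
    case (elim \<gamma>)
    then show ?case using N(1) measurable_space[OF rng_measurable] measurable_space[OF src_measurable] by auto
  qed
qed

text \<open>The measure with density \<open>|\<xi>|\<^sup>2\<close> against \<open>\<nu>'\<close>
  has mass at most 1, as it is computed along range fibres, and it dominates \<open>\<nu>\<close> on
  the support of \<xi> by quasi-invariance. This makes \<open>\<nu>\<close> sigma-finite there,
  which provides a positive integrable weight. The weight controls cardinalities along source
  fibres.\<close>

lemma sigma_finite_weight_on_support: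
  assumes [measurable]: "\<xi> \<in> borel_measurable (arrows G)"
    and norm: "\<And>x. x \<in> units G \<Longrightarrow> (\<integral>\<^sup>+ \<gamma>. ennreal ((cmod (\<xi> \<gamma>))\<^sup>2) \<partial>count_space (rng_fibre G x)) \<le> 1"
  obtains \<theta> :: "'a \<Rightarrow> ennreal" where "\<theta> \<in> borel_measurable (arrows G)" "(\<integral>\<^sup>+ \<gamma>. \<theta> \<gamma> \<partial>\<nu>) < \<infinity>"
    "\<And>\<gamma>. \<gamma> \<in> space (arrows G) \<Longrightarrow> \<xi> \<gamma> \<noteq> 0 \<Longrightarrow> 0 < \<theta> \<gamma>"
proof -
  let ?W = "{\<gamma> \<in> space (arrows G). \<xi> \<gamma> \<noteq> 0}"
  have [measurable]: "?W \<in> sets (arrows G)" by measurable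
  define m where "m = density \<nu>' (\<lambda>\<gamma>. ennreal ((cmod (\<xi> \<gamma>))\<^sup>2))"
  define N where "N = density \<nu> (indicator ?W)"
  have sets_mN: "sets m = sets (arrows G)" "sets N = sets (arrows G)" by (simp_all add: m_def N_def)
  have em: "emeasure m A = (\<integral>\<^sup>+ \<gamma>. ennreal ((cmod (\<xi> \<gamma>))\<^sup>2) * indicator A \<gamma> \<partial>\<nu>')" if "A \<in> sets (arrows G)" for A
    unfolding m_def using that by (subst emeasure_density) auto
  have eN: "emeasure N A = emeasure \<nu> (?W \<inter> A)" if A: "A \<in> sets (arrows G)" for A
  proof -
    have "emeasure N A = (\<integral>\<^sup>+ \<gamma>. indicator ?W \<gamma> * indicator A \<gamma> \<partial>\<nu>)"
      unfolding N_def using A by (subst emeasure_density) auto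
    also have "\<dots> = (\<integral>\<^sup>+ \<gamma>. indicator (?W \<inter> A) \<gamma> \<partial>\<nu>)"
      by (simp only: indicator_inter_arith)
    also have "\<dots> = emeasure \<nu> (?W \<inter> A)" using A by (intro nn_integral_indicator) auto
    finally show ?thesis .
  qed
  have "emeasure m (space m) < \<infinity>"
  proof -
    have "emeasure m (space m) = (\<integral>\<^sup>+ \<gamma>. ennreal ((cmod (\<xi> \<gamma>))\<^sup>2) \<partial>\<nu>')"
      using sets_eq_imp_space_eq[OF sets_mN(1)] em[OF sets.top]
      by (auto intro!: nn_integral_cong simp: indicator_def)
    also have "\<dots> = (\<integral>\<^sup>+ x. (\<integral>\<^sup>+ \<gamma>. ennreal ((cmod (\<xi> \<gamma>))\<^sup>2) \<partial>count_space (rng_fibre G x)) \<partial>\<mu>)"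
      by (subst R.nn_integral_fibre_measure) (auto simp: fibre_rng)
    also have "\<dots> \<le> (\<integral>\<^sup>+ x. 1 \<partial>\<mu>)"
      using norm by (intro nn_integral_mono) (simp add: space_unit_measure)
    also have "\<dots> < \<infinity>" by (simp add: emeasure_space_1)
    finally show ?thesis .
  qed
  then interpret m: finite_measure m by (intro finite_measureI) simp
  have "absolutely_continuous m N"
    unfolding absolutely_continuous_def
  proof
    fix A assume A: "A \<in> null_sets m"
    then have As [measurable]: "A \<in> sets (arrows G)" using sets_mN by auto
    have "(\<integral>\<^sup>+ \<gamma>. ennreal ((cmod (\<xi> \<gamma>))\<^sup>2) * indicator A \<gamma> \<partial>\<nu>') = 0" using A em[OF As] by auto
    then have "AE \<gamma> in \<nu>'. ennreal ((cmod (\<xi> \<gamma>))\<^sup>2) * indicator A \<gamma> = 0"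
      by (subst (asm) nn_integral_0_iff_AE) auto
    then have "AE \<gamma> in \<nu>. \<gamma> \<notin> ?W \<inter> A"
      unfolding AE_rng_iff by (rule AE_mp) (auto simp: indicator_def)
    then have "?W \<inter> A \<in> null_sets \<nu>" by (subst AE_iff_null_sets) auto
    then show "A \<in> null_sets N" using eN[OF As] As sets_mN by (simp add: null_sets_def)
  qed
  \<comment> \<open>Exhaustion against the finite measure \<open>m\<close>; semifiniteness of \<open>\<nu>\<close> excludes a remainder.\<close>
  then obtain B :: "nat \<Rightarrow> 'a set" where B: "range B \<subseteq> sets m" "\<And>i. emeasure N (B i) \<noteq> \<infinity>"
    "\<And>A. A \<in> sets m \<Longrightarrow> A \<inter> (\<Union>i. B i) = {} \<Longrightarrow>
      (emeasure m A = 0 \<and> emeasure N A = 0) \<or> (emeasure m A > 0 \<and> emeasure N A = \<infinity>)"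
    using m.split_space_into_finite_sets_and_rest[of N] sets_mN by metis
  let ?Z = "space (arrows G) - (\<Union>i. B i)"
  have Z: "?Z \<in> sets (arrows G)" using B(1) sets_mN by auto
  have "emeasure N ?Z = 0"
  proof (rule ccontr)
    assume "emeasure N ?Z \<noteq> 0"
    then have "0 < emeasure \<nu> (?W \<inter> ?Z)" using eN[OF Z] by (simp add: zero_less_iff_neq_zero)
    then obtain C where C: "C \<in> sets (arrows G)" "C \<subseteq> ?W \<inter> ?Z" "0 < emeasure \<nu> C" "emeasure \<nu> C < \<infinity>"
      using S.fibre_measure_semifinite[of "?W \<inter> ?Z"] Z by auto
    moreover have "?W \<inter> C = C" using C(2) by auto
    moreover have "C \<inter> (\<Union>i. B i) = {}" using C(2) by blast
    ultimately have "emeasure \<nu> C = 0 \<or> emeasure \<nu> C = \<infinity>"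
      using B(3)[of C] eN[of C] sets_mN by auto
    then show False using C(3,4) by auto
  qed
  moreover have "B i \<subseteq> space (arrows G)" for i
    using B(1) sets_mN sets.sets_into_space by blast
  ultimately have "sigma_finite_measure N"
    using B(1,2) sets_mN Z sets_eq_imp_space_eq[OF sets_mN(2)]
    by (intro sigma_finite_measure.intro exI[of _ "insert ?Z (range B)"]) auto
  then interpret N: sigma_finite_measure N .
  obtain h where h: "h \<in> borel_measurable N" "integral\<^sup>N N h \<noteq> \<infinity>" "\<And>\<gamma>. \<gamma> \<in> space N \<Longrightarrow> 0 < h \<gamma>"
    using N.Ex_finite_integrable_function by blast
  have hm [measurable]: "h \<in> borel_measurable (arrows G)"
    using h(1) measurable_cong_sets[OF sets_mN(2) refl] by blast
  have "integral\<^sup>N N h = (\<integral>\<^sup>+ \<gamma>. indicator ?W \<gamma> * h \<gamma> \<partial>\<nu>)"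
    unfolding N_def by (subst nn_integral_density) auto
  then show thesis
    using h sets_eq_imp_space_eq[OF sets_mN(2)]
    by (intro that[of "\<lambda>\<gamma>. indicator ?W \<gamma> * h \<gamma>"]) (auto simp: less_top indicator_def)
qed

text \<open>Dominated convergence makes the tails of \<xi> small on average, and Markov's inequality
  turns this into uniform smallness on \<open>Y\<close>. A large coefficient then comes from
  products of arrows in a set with bounded fibres. \<open>Y\<close> is fixed before \<epsilon>, so
  the tails are controlled at all scales at once.\<close>

lemma finite_level_sets:
  assumes [measurable]: "\<xi> \<in> borel_measurable (arrows G)" "fibre_coeff G \<xi> \<in> borel_measurable (arrows G)"
    and norm: "\<And>x. x \<in> units G \<Longrightarrow> (\<integral>\<^sup>+ \<gamma>. ennreal ((cmod (\<xi> \<gamma>))\<^sup>2) \<partial>count_space (rng_fibre G x)) \<le> 1"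
    and \<delta>: "0 < \<delta>"
  obtains Y where "Y \<in> sets \<mu>" "emeasure \<mu> (space \<mu> - Y) \<le> ennreal \<delta>"
    "\<And>\<epsilon>. 0 < \<epsilon> \<Longrightarrow> emeasure \<nu>
       {\<gamma> \<in> space (arrows G). rng G \<gamma> \<in> Y \<and> src G \<gamma> \<in> Y \<and> \<epsilon> < cmod (fibre_coeff G \<xi> \<gamma>)} < \<infinity>"
proof -
  define w where "w \<gamma> = ennreal ((cmod (\<xi> \<gamma>))\<^sup>2)" for \<gamma>
  have [measurable]: "w \<in> borel_measurable (arrows G)" unfolding w_def by measurable
  have norm_w: "(\<integral>\<^sup>+ \<gamma>. w \<gamma> \<partial>count_space (rng_fibre G x)) \<le> 1" if "x \<in> units G" for x
    unfolding w_def using norm that by blast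
  obtain \<theta> :: "'a \<Rightarrow> ennreal" where [measurable]: "\<theta> \<in> borel_measurable (arrows G)"
    and \<theta>: "(\<integral>\<^sup>+ \<gamma>. \<theta> \<gamma> \<partial>\<nu>) < \<infinity>" "\<And>\<gamma>. \<gamma> \<in> space (arrows G) \<Longrightarrow> \<xi> \<gamma> \<noteq> 0 \<Longrightarrow> 0 < \<theta> \<gamma>"
    using sigma_finite_weight_on_support[of \<xi>] norm assms(1) by metis
  let ?H = "\<lambda>z. \<integral>\<^sup>+ \<gamma>. \<theta> \<gamma> \<partial>count_space (src_fibre G z)"
  have "?H \<in> borel_measurable (completion \<mu>)"
    using S.fibre_nn_integral_measurable[of \<theta>] by (simp add: fibre_src)
  then obtain H where [measurable]: "H \<in> borel_measurable \<mu>" and H: "AE z in \<mu>. ?H z = H z"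
    using completion_ex_borel_measurable by blast
  obtain N where N: "{z \<in> space \<mu>. ?H z \<noteq> H z} \<subseteq> N" "N \<in> sets \<mu>" "emeasure \<mu> N = 0"
    using H by (rule AE_E)
  \<comment> \<open>Outside the null set \<open>N\<close> the Borel function \<open>H\<close> is the
    true sum of \<theta> over the source fibre, so \<open>Z j\<close> is Borel and the bound
    \<open>ZH\<close> holds at each of its points.\<close>
  define Z where "Z j = {z \<in> space \<mu> - N. H z \<le> of_nat j}" for j :: nat
  have [measurable]: "Z j \<in> sets \<mu>" for j unfolding Z_def using N(2) by measurable
  have ZH: "?H z \<le> of_nat j" if "z \<in> Z j" for z j
    using that N(1) unfolding Z_def by fastforce
  have Zmono: "Z i \<subseteq> Z j" if "i \<le> j" for i j
    unfolding Z_def using that by (auto intro: order_trans of_nat_mono)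
  have AE_Z: "AE z in \<mu>. \<exists>j. z \<in> Z j"
  proof -
    have "(\<integral>\<^sup>+ z. H z \<partial>\<mu>) = (\<integral>\<^sup>+ z. ?H z \<partial>\<mu>)"
      using H by (intro nn_integral_cong_AE) auto
    also have "\<dots> = (\<integral>\<^sup>+ \<gamma>. \<theta> \<gamma> \<partial>\<nu>)"
      by (subst S.nn_integral_fibre_measure) (auto simp: fibre_src)
    finally have "AE z in \<mu>. H z \<noteq> \<infinity>" using \<theta>(1) by (intro nn_integral_PInf_AE) auto
    moreover have "AE z in \<mu>. z \<notin> N" using N by (intro AE_not_in) auto
    ultimately show ?thesis
      using AE_space
    proof eventually_elim
      case (elim z)
      obtain n where "H z < of_nat n" using elim(1) ennreal_Ex_less_of_nat by (metis infinity_ennreal_def less_top)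
      then show ?case using elim by (auto simp: Z_def intro!: exI[of _ n])
    qed
  qed
  \<comment> \<open>With range-fibre sums of \<open>w\<close> at most 1 and source-fibre sums of
    \<theta> at most \<open>j\<close> over \<open>Z j\<close>, the two lower bounds
    \<open>1 / j\<close> give at most \<open>j\<close> arrows per range fibre and
    \<open>j * j\<close> per source fibre.\<close>
  define A where "A j = {\<gamma> \<in> space (arrows G). 1 \<le> of_nat j * w \<gamma> \<and> 1 \<le> of_nat j * \<theta> \<gamma> \<and> src G \<gamma> \<in> Z j}" for j :: nat
  have [measurable]: "A j \<in> sets (arrows G)" for j unfolding A_def by measurable
  have tend: "(\<lambda>j. \<integral>\<^sup>+ \<gamma>. w \<gamma> * indicator (- A j) \<gamma> \<partial>\<nu>') \<longlonglongrightarrow> (\<integral>\<^sup>+ \<gamma>. 0 \<partial>\<nu>')"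
  proof (rule nn_integral_dominated_convergence[where w = w])
    have "(\<integral>\<^sup>+ \<gamma>. w \<gamma> \<partial>\<nu>') = (\<integral>\<^sup>+ x. (\<integral>\<^sup>+ \<gamma>. w \<gamma> \<partial>count_space (rng_fibre G x)) \<partial>\<mu>)"
      by (subst R.nn_integral_fibre_measure) (auto simp: fibre_rng)
    also have "\<dots> \<le> (\<integral>\<^sup>+ x. 1 \<partial>\<mu>)"
      using norm_w by (intro nn_integral_mono) (simp add: space_unit_measure)
    also have "\<dots> < \<infinity>" by (simp add: emeasure_space_1)
    finally show "(\<integral>\<^sup>+ \<gamma>. w \<gamma> \<partial>\<nu>') < \<infinity>" .
    have "AE \<gamma> in \<nu>'. \<exists>j. src G \<gamma> \<in> Z j" using AE_units[OF AE_Z] unfolding AE_rng_iff by auto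
    then show "AE \<gamma> in \<nu>'. (\<lambda>j. w \<gamma> * indicator (- A j) \<gamma>) \<longlonglongrightarrow> 0"
      using AE_space
    proof eventually_elim
      case (elim \<gamma>)
      then obtain j0 where j0: "src G \<gamma> \<in> Z j0" by blast
      show ?case
      proof (cases "\<xi> \<gamma> = 0")
        case False
        then have "0 < w \<gamma>" "0 < \<theta> \<gamma>" using elim(2) \<theta>(2) by (auto simp: w_def)
        then obtain j1 j2 where j: "\<And>m. j1 \<le> m \<Longrightarrow> 1 \<le> of_nat m * w \<gamma>" "\<And>m. j2 \<le> m \<Longrightarrow> 1 \<le> of_nat m * \<theta> \<gamma>"
          using ennreal_archimedean by metis
        have "\<gamma> \<in> A m" if "max j0 (max j1 j2) \<le> m" for m
          using that j[of m] Zmono[of j0 m] j0 elim(2) by (auto simp: A_def)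
        then have "\<forall>\<^sub>F j in sequentially. w \<gamma> * indicator (- A j) \<gamma> = 0"
          unfolding eventually_sequentially by (intro exI[of _ "max j0 (max j1 j2)"]) auto
        then show ?thesis by (rule tendsto_eventually)
      qed (simp add: w_def)
    qed
  qed (auto simp: indicator_def)
  \<comment> \<open>The weights \<open>2 ^ i\<close> in \<open>V\<close> turn these bounds into
    \<open>\<delta> * (1 / 2) ^ Suc i\<close>, with sum \<delta>.\<close>
  have "\<exists>j. (\<integral>\<^sup>+ \<gamma>. w \<gamma> * indicator (- A j) \<gamma> \<partial>\<nu>') \<le> ennreal (\<delta> * (1 / 4) ^ i * (1 / 2))" for i
  proof -
    have "0 < ennreal (\<delta> * (1 / 4) ^ i * (1 / 2))" using \<delta> by simp
    then have "\<forall>\<^sub>F j in sequentially. (\<integral>\<^sup>+ \<gamma>. w \<gamma> * indicator (- A j) \<gamma> \<partial>\<nu>') < ennreal (\<delta> * (1 / 4) ^ i * (1 / 2))"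
      using order_tendstoD(2)[OF tend] by simp
    then obtain j where "(\<integral>\<^sup>+ \<gamma>. w \<gamma> * indicator (- A j) \<gamma> \<partial>\<nu>') < ennreal (\<delta> * (1 / 4) ^ i * (1 / 2))"
      unfolding eventually_sequentially by blast
    then show ?thesis by (intro exI[of _ j]) (rule less_imp_le)
  qed
  then obtain j where j: "\<And>i. (\<integral>\<^sup>+ \<gamma>. w \<gamma> * indicator (- A (j i)) \<gamma> \<partial>\<nu>') \<le> ennreal (\<delta> * (1 / 4) ^ i * (1 / 2))"
    by metis
  \<comment> \<open>Where the fibrewise sum of \<open>V\<close> is at most \<open>1\<close>, the tails outside \<open>A (j i)\<close> are bounded by
    \<open>(1 / 2) ^ i\<close> uniformly.\<close>
  define V where "V \<gamma> = (\<Sum>i. ennreal (2 ^ i) * (w \<gamma> * indicator (- A (j i)) \<gamma>))" for \<gamma>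
  have Vm [measurable]: "V \<in> borel_measurable (arrows G)" unfolding V_def by measurable
  have "(\<integral>\<^sup>+ \<gamma>. V \<gamma> \<partial>\<nu>') = (\<Sum>i. ennreal (2 ^ i) * (\<integral>\<^sup>+ \<gamma>. w \<gamma> * indicator (- A (j i)) \<gamma> \<partial>\<nu>'))"
    unfolding V_def by (simp add: nn_integral_suminf nn_integral_cmult)
  also have "\<dots> \<le> (\<Sum>i. ennreal (\<delta> * (1 / 2) ^ Suc i))"
  proof (rule suminf_le)
    fix i
    have "ennreal (2 ^ i) * (\<integral>\<^sup>+ \<gamma>. w \<gamma> * indicator (- A (j i)) \<gamma> \<partial>\<nu>') \<le>
        ennreal (2 ^ i) * ennreal (\<delta> * (1 / 4) ^ i * (1 / 2))"
      using j by (rule mult_left_mono) simp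
    also have "\<dots> = ennreal (2 ^ i * (\<delta> * (1 / 4) ^ i * (1 / 2)))"
      using \<delta> by (intro ennreal_mult[symmetric]) auto
    also have "2 ^ i * (\<delta> * (1 / 4) ^ i * (1 / 2)) = \<delta> * (1 / 2) ^ Suc i"
      by (simp add: power_divide field_simps power_mult_distrib[symmetric])
    finally show "ennreal (2 ^ i) * (\<integral>\<^sup>+ \<gamma>. w \<gamma> * indicator (- A (j i)) \<gamma> \<partial>\<nu>') \<le> ennreal (\<delta> * (1 / 2) ^ Suc i)" .
  qed auto
  also have "\<dots> = ennreal \<delta>"
    using sums_mult[OF power_half_series, of \<delta>] \<delta>
    by (intro suminf_ennreal_eq) auto
  finally have V\<delta>: "(\<integral>\<^sup>+ \<gamma>. V \<gamma> \<partial>\<nu>') \<le> ennreal \<delta>" .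
  define v where "v x = (\<integral>\<^sup>+ \<gamma>. V \<gamma> \<partial>count_space (rng_fibre G x))" for x
  have vm [measurable]: "v \<in> borel_measurable (completion \<mu>)"
    unfolding v_def using R.fibre_nn_integral_measurable[OF Vm] by (simp add: fibre_rng)
  let ?P = "{x \<in> space (completion \<mu>). 1 \<le> 1 * v x}"
  have P: "?P \<in> sets (completion \<mu>)" by measurable
  \<comment> \<open>\<open>?P\<close> is only completion-measurable; a Borel superset of the same
    measure makes \<open>Y\<close> Borel.\<close>
  obtain Q where Q: "Q \<in> sets \<mu>" "?P \<subseteq> Q" "emeasure (completion \<mu>) ?P = emeasure \<mu> Q"
    by (rule completion_upper[OF P]) (rule that)
  have "emeasure \<mu> Q \<le> 1 * (\<integral>\<^sup>+ x. v x * indicator (space (completion \<mu>)) x \<partial>completion \<mu>)"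
    unfolding Q(3)[symmetric] by (rule nn_integral_Markov_inequality) measurable
  also have "\<dots> = (\<integral>\<^sup>+ x. v x \<partial>\<mu>)"
    by (simp add: nn_integral_completion)
  also have "\<dots> = (\<integral>\<^sup>+ \<gamma>. V \<gamma> \<partial>\<nu>')"
    unfolding v_def by (subst R.nn_integral_fibre_measure[OF Vm]) (simp add: fibre_rng)
  finally have Q\<delta>: "emeasure \<mu> Q \<le> ennreal \<delta>" using V\<delta> by (rule order_trans)
  define Y where "Y = space \<mu> - Q"
  have [measurable]: "Y \<in> sets \<mu>" unfolding Y_def using Q(1) by auto
  have tail: "(\<integral>\<^sup>+ \<gamma>. w \<gamma> * indicator (- A (j i)) \<gamma> \<partial>count_space (rng_fibre G x)) \<le> ennreal ((1 / 2) ^ i)"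
    if "x \<in> Y" for x i
  proof -
    let ?u = "\<integral>\<^sup>+ \<gamma>. w \<gamma> * indicator (- A (j i)) \<gamma> \<partial>count_space (rng_fibre G x)"
    have "v x \<le> 1" using that Q(2) by (auto simp: Y_def not_le)
    have "ennreal (2 ^ i) * ?u = (\<integral>\<^sup>+ \<gamma>. ennreal (2 ^ i) * (w \<gamma> * indicator (- A (j i)) \<gamma>) \<partial>count_space (rng_fibre G x))"
      by (simp add: nn_integral_cmult)
    also have "\<dots> \<le> v x"
      unfolding v_def V_def
      using sum_le_suminf[OF summableI, of "{i}"] by (intro nn_integral_mono) fastforce
    finally have le: "ennreal (2 ^ i) * ?u \<le> 1" using \<open>v x \<le> 1\<close> by (rule order_trans)
    have "?u = ennreal ((1 / 2) ^ i) * (ennreal (2 ^ i) * ?u)"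
      by (simp add: mult.assoc[symmetric] ennreal_mult[symmetric] power_mult_distrib[symmetric])
    also have "\<dots> \<le> ennreal ((1 / 2) ^ i) * 1" using le by (rule mult_left_mono) simp
    finally show ?thesis by simp
  qed
  show thesis
  proof (rule that[of Y])
    show "Y \<in> sets \<mu>" by fact
    have "space \<mu> - Y \<subseteq> Q" by (auto simp: Y_def)
    then show "emeasure \<mu> (space \<mu> - Y) \<le> ennreal \<delta>"
      using emeasure_mono[of "space \<mu> - Y" Q \<mu>] Q(1) Q\<delta> by (auto intro: order_trans)
    fix \<epsilon> :: real assume "0 < \<epsilon>"
    \<comment> \<open>Half of \<epsilon>, to match the bound \<open>2 * e\<close> of
      \<open>infsum_product_bound\<close>; the tails at level \<open>i\<close> must then be at most
      \<open>e\<^sup>2\<close>.\<close>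
    define e where "e = \<epsilon> / 2"
    have e: "0 < e" "\<epsilon> = 2 * e" using \<open>0 < \<epsilon>\<close> by (auto simp: e_def)
    obtain i where i: "(1 / 2) ^ i < e\<^sup>2"
      using real_arch_pow_inv[of "e\<^sup>2" "1 / 2"] e by auto
    define n where "n = j i"
    let ?B = "{\<gamma> \<in> space (arrows G). rng G \<gamma> \<in> Y \<and> src G \<gamma> \<in> Y \<and> \<epsilon> < cmod (fibre_coeff G \<xi> \<gamma>)}"
    have tail_n: "(\<integral>\<^sup>+ \<gamma>. w \<gamma> * indicator (- A n) \<gamma> \<partial>count_space (rng_fibre G x)) \<le> ennreal (e\<^sup>2)" if "x \<in> Y" for x
      using tail[OF that, of i] i unfolding n_def by (meson ennreal_leI less_imp_le order_trans)
    \<comment> \<open>Outside \<open>A n\<close> the vectors at both ends of \<open>\<gamma>\<close> have norm at most \<open>e\<close>, so a coefficient larger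
      than \<open>2 e\<close> forces \<open>\<gamma>\<close> to be a quotient of two elements of \<open>A n\<close>.\<close>
    have factor: "\<exists>\<eta>\<in>A n \<inter> rng_fibre G (src G \<gamma>). \<exists>\<zeta>\<in>A n \<inter> src_fibre G (src G \<eta>). \<gamma> = gmul G \<zeta> (ginv G \<eta>)"
      if \<gamma>: "\<gamma> \<in> ?B" for \<gamma>
    proof -
      have \<gamma>s: "\<gamma> \<in> space (arrows G)" "rng G \<gamma> \<in> Y" "src G \<gamma> \<in> Y" using \<gamma> by auto
      have u: "rng G \<gamma> \<in> units G" "src G \<gamma> \<in> units G"
        using measurable_space[OF rng_measurable] measurable_space[OF src_measurable] \<gamma>s(1) space_unit_measure by auto
      let ?E = "rng_fibre G (rng G \<gamma>)" and ?T = "{\<zeta>. gmul G (ginv G \<gamma>) \<zeta> \<in> A n}"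
      have "\<not> cmod (fibre_coeff G \<xi> \<gamma>) \<le> 2 * e" using \<gamma> e by auto
      moreover have "cmod (fibre_coeff G \<xi> \<gamma>) \<le> 2 * e" if "?E \<inter> A n \<inter> ?T = {}"
        unfolding fibre_coeff_def
      proof (rule infsum_product_bound[OF e(1) that])
        show "(\<integral>\<^sup>+ y. ennreal ((cmod (\<xi> y))\<^sup>2) \<partial>count_space ?E) \<le> 1"
          "(\<integral>\<^sup>+ y. ennreal ((cmod (\<xi> y))\<^sup>2) * indicator (- A n) y \<partial>count_space ?E) \<le> ennreal (e\<^sup>2)"
          using norm[OF u(1)] tail_n[OF \<gamma>s(2)] by (simp_all add: w_def)
        show "(\<integral>\<^sup>+ y. ennreal ((cmod (\<xi> (gmul G (ginv G \<gamma>) y)))\<^sup>2) \<partial>count_space ?E) \<le> 1"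
          using norm[OF u(2)] nn_integral_translate[OF \<gamma>s(1), of "\<lambda>y. ennreal ((cmod (\<xi> y))\<^sup>2)"] by simp
        have "(\<integral>\<^sup>+ y. ennreal ((cmod (\<xi> (gmul G (ginv G \<gamma>) y)))\<^sup>2) * indicator (- ?T) y \<partial>count_space ?E) =
            (\<integral>\<^sup>+ y. w (gmul G (ginv G \<gamma>) y) * indicator (- A n) (gmul G (ginv G \<gamma>) y) \<partial>count_space ?E)"
          by (intro nn_integral_cong) (auto simp: indicator_def w_def)
        also have "\<dots> = (\<integral>\<^sup>+ y. w y * indicator (- A n) y \<partial>count_space (rng_fibre G (src G \<gamma>)))"
          by (rule nn_integral_translate[OF \<gamma>s(1)])
        finally show "(\<integral>\<^sup>+ y. ennreal ((cmod (\<xi> (gmul G (ginv G \<gamma>) y)))\<^sup>2) * indicator (- ?T) y \<partial>count_space ?E) \<le> ennreal (e\<^sup>2)"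
          using tail_n[OF \<gamma>s(3)] by simp
      qed
      ultimately obtain \<zeta> where \<zeta>: "\<zeta> \<in> ?E" "\<zeta> \<in> A n" "gmul G (ginv G \<gamma>) \<zeta> \<in> A n" by blast
      let ?\<eta> = "gmul G (ginv G \<gamma>) \<zeta>"
      have \<zeta>s: "\<zeta> \<in> space (arrows G)" "rng G \<zeta> = rng G \<gamma>" using \<zeta>(1) by (auto simp: rng_fibre_def)
      have "\<gamma> = gmul G \<zeta> (ginv G ?\<eta>)"
        using \<gamma>s \<zeta>s by (simp add: ginv_quotient ginv_gmul_cancel)
      moreover have "?\<eta> \<in> A n \<inter> rng_fibre G (src G \<gamma>)" "\<zeta> \<in> A n \<inter> src_fibre G (src G ?\<eta>)"
        using \<zeta> \<zeta>s ginv_gmul_closed[OF \<gamma>s(1) \<zeta>s] by (auto simp: rng_fibre_def src_fibre_def)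
      ultimately show ?thesis by blast
    qed
    have card_r: "emeasure (count_space UNIV) (A n \<inter> rng_fibre G y) \<le> of_nat (1 * n)" if "y \<in> units G" for y
      using norm_w[OF that] by (intro nn_integral_count_space_markov[where h = w and E = "rng_fibre G y"]) (auto simp: A_def)
    have card_s: "emeasure (count_space UNIV) (A n \<inter> src_fibre G z) \<le> of_nat (n * n)" for z
    proof (cases "z \<in> Z n")
      case True
      show ?thesis
        using ZH[OF True] by (intro nn_integral_count_space_markov[where h = \<theta> and E = "src_fibre G z"]) (auto simp: A_def)
    next
      case False
      then have "A n \<inter> src_fibre G z = {}" by (auto simp: A_def src_fibre_def)
      then show ?thesis by simp
    qed
    \<comment> \<open>In a factorisation of an arrow with source \<open>y\<close>, the arrow \<eta>
      has range \<open>y\<close>, leaving at most \<open>n\<close> choices, and \<zeta> shares its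
      source with \<eta>, leaving at most \<open>n * n\<close>.\<close>
    have bound: "emeasure (count_space UNIV) (?B \<inter> src_fibre G y) \<le> of_nat (n * (n * n))" if y: "y \<in> units G" for y
    proof -
      let ?K = "A n \<inter> rng_fibre G y" and ?L = "\<lambda>\<eta>. A n \<inter> src_fibre G (src G \<eta>)"
      let ?U = "\<Union>\<eta>\<in>?K. (\<lambda>\<zeta>. gmul G \<zeta> (ginv G \<eta>)) ` ?L \<eta>"
      have K: "finite ?K" "card ?K \<le> n" using count_le_imp_card[OF card_r[OF y]] by auto
      have L: "finite (?L \<eta>)" "card (?L \<eta>) \<le> n * n" for \<eta> using count_le_imp_card[OF card_s] by auto
      have "?B \<inter> src_fibre G y \<subseteq> ?U"
      proof
        fix \<gamma> assume "\<gamma> \<in> ?B \<inter> src_fibre G y"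
        then have "\<gamma> \<in> ?B" "src G \<gamma> = y" by (auto simp: src_fibre_def)
        then show "\<gamma> \<in> ?U" using factor[of \<gamma>] by blast
      qed
      then have "emeasure (count_space UNIV) (?B \<inter> src_fibre G y) \<le> emeasure (count_space UNIV) ?U"
        by (rule emeasure_mono) simp
      also have "\<dots> = of_nat (card ?U)" using K L by simp
      also have "card ?U \<le> (\<Sum>\<eta>\<in>?K. card ((\<lambda>\<zeta>. gmul G \<zeta> (ginv G \<eta>)) ` ?L \<eta>))" by (rule card_UN_le[OF K(1)])
      also have "\<dots> \<le> (\<Sum>\<eta>\<in>?K. n * n)"
        using L by (intro sum_mono) (meson card_image_le order_trans)
      also have "\<dots> \<le> n * (n * n)" using K(2) by simp
      finally show ?thesis by simp
    qed
    have B: "?B \<in> sets (arrows G)" by measurable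
    have "emeasure \<nu> ?B = (\<integral>\<^sup>+ y. emeasure (count_space UNIV) (?B \<inter> src_fibre G y) \<partial>\<mu>)"
      using S.emeasure_fibre_measure[OF B] S.fibre_indicator[where A = ?B] by (simp add: fibre_src)
    also have "\<dots> \<le> (\<integral>\<^sup>+ y. of_nat (n * (n * n)) \<partial>\<mu>)"
      using bound by (intro nn_integral_mono) (simp add: space_unit_measure)
    also have "\<dots> < \<infinity>" by (simp add: emeasure_space_1 ennreal_of_nat_eq_real_of_nat ennreal_mult_less_top)
    finally show "emeasure \<nu> ?B < \<infinity>" .
  qed
qed

subsection \<open>Localised coefficients\<close>

lemma unit_arrow:
  assumes "x \<in> units G"
  shows "x \<in> space (arrows G)" "rng G x = x" "src G x = x"
  using assms by (auto simp: units_def rng_closed rng_rng src_rng)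

lemma units_fibre:
  assumes "\<gamma> \<in> space (arrows G)"
  shows "rng G \<gamma> \<in> units G" "src G \<gamma> \<in> units G"
  using measurable_space[OF rng_measurable assms] measurable_space[OF src_measurable assms] space_unit_measure by auto

lemma units_sets [measurable]: "{\<gamma> \<in> space (arrows G). \<gamma> = rng G \<gamma>} \<in> sets (arrows G)"
proof -
  obtain U :: "nat \<Rightarrow> 'a set" where U [measurable]: "\<And>n. U n \<in> sets (arrows G)"
    and sep: "\<And>x y. x \<in> space (arrows G) \<Longrightarrow> y \<in> space (arrows G) \<Longrightarrow> (\<And>n. x \<in> U n \<longleftrightarrow> y \<in> U n) \<Longrightarrow> x = y"
    using standard_borel_countably_separated[OF standard] unfolding countably_separated_def by metis
  have [measurable]: "rng G \<in> arrows G \<rightarrow>\<^sub>M arrows G" by (rule rng_borel)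
  have "{\<gamma> \<in> space (arrows G). \<gamma> = rng G \<gamma>} = {\<gamma> \<in> space (arrows G). \<forall>n. \<gamma> \<in> U n \<longleftrightarrow> rng G \<gamma> \<in> U n}"
    using sep rng_closed by auto
  also have "\<dots> \<in> sets (arrows G)" by measurable
  finally show ?thesis .
qed

text \<open>A source fibre contains at most one unit. Hence the repaired diagonal, where the value
  is 1, cannot spoil finiteness of level sets.\<close>

lemma finite_units: "emeasure \<nu> {\<gamma> \<in> space (arrows G). \<gamma> = rng G \<gamma>} < \<infinity>"
proof -
  let ?X = "{\<gamma> \<in> space (arrows G). \<gamma> = rng G \<gamma>}"
  have le: "emeasure (count_space UNIV) (?X \<inter> src_fibre G z) \<le> 1" for z
  proof -
    have "\<gamma> = z" if "\<gamma> \<in> space (arrows G)" "\<gamma> = rng G \<gamma>" "src G \<gamma> = z" for \<gamma>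
      using that src_rng[OF that(1)] by metis
    then have "?X \<inter> src_fibre G z \<subseteq> {z}" by (auto simp: src_fibre_def)
    then have "emeasure (count_space UNIV) (?X \<inter> src_fibre G z) \<le> emeasure (count_space UNIV) {z}"
      by (rule emeasure_mono) simp
    then show ?thesis by simp
  qed
  have "emeasure \<nu> ?X = (\<integral>\<^sup>+ z. emeasure (count_space UNIV) (?X \<inter> src_fibre G z) \<partial>\<mu>)"
    using S.emeasure_fibre_measure[OF units_sets] S.fibre_indicator[where A = ?X] by (simp add: fibre_src)
  also have "\<dots> \<le> (\<integral>\<^sup>+ z. 1 \<partial>\<mu>)" using le by (intro nn_integral_mono)
  also have "\<dots> < \<infinity>" by (simp add: emeasure_space_1)
  finally show ?thesis .
qed

text \<open>Cutting with a Borel set of units, instead of with a set of arrows, multiplies the coefficient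
  by a Borel function, so that it stays Borel without any measurability of fibrewise sums.\<close>

lemma subnormalised_cut:
  assumes [measurable]: "\<xi> \<in> borel_measurable (arrows G)" "fibre_coeff G \<xi> \<in> borel_measurable (arrows G)"
    and norm: "AE x in \<mu>. ((\<lambda>\<gamma>. (cmod (\<xi> \<gamma>))\<^sup>2) has_sum 1) (rng_fibre G x)"
  obtains \<xi>' where "\<xi>' \<in> borel_measurable (arrows G)" "fibre_coeff G \<xi>' \<in> borel_measurable (arrows G)"
    "\<And>x. x \<in> units G \<Longrightarrow> (\<integral>\<^sup>+ \<gamma>. ennreal ((cmod (\<xi>' \<gamma>))\<^sup>2) \<partial>count_space (rng_fibre G x)) \<le> 1"
    "AE \<gamma> in \<nu>. fibre_coeff G \<xi>' \<gamma> = fibre_coeff G \<xi> \<gamma>"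
proof -
  obtain N where N: "{x \<in> space \<mu>. \<not> ((\<lambda>\<gamma>. (cmod (\<xi> \<gamma>))\<^sup>2) has_sum 1) (rng_fibre G x)} \<subseteq> N"
      "N \<in> sets \<mu>" "emeasure \<mu> N = 0"
    using norm by (rule AE_E)
  \<comment> \<open>Over the discarded null set the field becomes 0, so the norm bound holds at
    every unit, at the price of an inequality instead of norm 1.\<close>
  define Y where "Y = space \<mu> - N"
  have [measurable]: "Y \<in> sets \<mu>" unfolding Y_def using N(2) by auto
  define \<xi>' where "\<xi>' = (\<lambda>\<gamma>. indicator Y (rng G \<gamma>) * \<xi> \<gamma>)"
  have cut: "fibre_coeff G \<xi>' \<gamma> = indicator Y (rng G \<gamma>) * indicator Y (src G \<gamma>) * fibre_coeff G \<xi> \<gamma>"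
    if "\<gamma> \<in> space (arrows G)" for \<gamma>
    unfolding \<xi>'_def using that by (rule fibre_coeff_cut)
  show thesis
  proof (rule that)
    show "\<xi>' \<in> borel_measurable (arrows G)" unfolding \<xi>'_def by measurable
    have "fibre_coeff G \<xi>' \<in> borel_measurable (arrows G) \<longleftrightarrow>
        (\<lambda>\<gamma>. indicator Y (rng G \<gamma>) * indicator Y (src G \<gamma>) * fibre_coeff G \<xi> \<gamma>) \<in> borel_measurable (arrows G)"
      using cut by (rule measurable_cong)
    also have "\<dots>" by measurable
    finally show "fibre_coeff G \<xi>' \<in> borel_measurable (arrows G)" .
    show "(\<integral>\<^sup>+ \<gamma>. ennreal ((cmod (\<xi>' \<gamma>))\<^sup>2) \<partial>count_space (rng_fibre G x)) \<le> 1" if x: "x \<in> units G" for x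
    proof (cases "x \<in> Y")
      case True
      have "(\<integral>\<^sup>+ \<gamma>. ennreal ((cmod (\<xi>' \<gamma>))\<^sup>2) \<partial>count_space (rng_fibre G x)) =
          (\<integral>\<^sup>+ \<gamma>. ennreal ((cmod (\<xi> \<gamma>))\<^sup>2) \<partial>count_space (rng_fibre G x))"
        using True by (intro nn_integral_cong) (auto simp: \<xi>'_def rng_fibre_def)
      also have "\<dots> = ennreal 1"
        using True N(1) by (intro nn_integral_count_space_has_sum) (auto simp: Y_def)
      finally show ?thesis by simp
    next
      case False
      have "(\<integral>\<^sup>+ \<gamma>. ennreal ((cmod (\<xi>' \<gamma>))\<^sup>2) \<partial>count_space (rng_fibre G x)) =
          (\<integral>\<^sup>+ \<gamma>. 0 \<partial>count_space (rng_fibre G x))"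
        using False by (intro nn_integral_cong) (auto simp: \<xi>'_def rng_fibre_def)
      then show ?thesis by simp
    qed
    have "AE x in \<mu>. x \<notin> N" using N by (intro AE_not_in) auto
    then have "AE x in \<mu>. x \<in> Y" using AE_space by eventually_elim (auto simp: Y_def)
    from AE_units[OF this] AE_space show "AE \<gamma> in \<nu>. fibre_coeff G \<xi>' \<gamma> = fibre_coeff G \<xi> \<gamma>"
      by eventually_elim (auto simp: cut)
  qed
qed

lemma fibre_coeff_pos_semidef:
  assumes norm: "\<And>x. x \<in> units G \<Longrightarrow> (\<integral>\<^sup>+ \<gamma>. ennreal ((cmod (\<xi> \<gamma>))\<^sup>2) \<partial>count_space (rng_fibre G x)) \<le> 1"
    and g: "\<And>i. i < k \<Longrightarrow> g i \<in> rng_fibre G x"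
  shows "pos_semidef k (\<lambda>i j. fibre_coeff G \<xi> (gmul G (ginv G (g i)) (g j)))"
proof (rule pos_semidef_cong)
  show "pos_semidef k (\<lambda>i j. \<Sum>\<^sub>\<infinity>\<eta>\<in>rng_fibre G x. cnj (\<xi> (gmul G (ginv G (g i)) \<eta>)) * \<xi> (gmul G (ginv G (g j)) \<eta>))"
  proof (rule pos_semidef_gram)
    fix i assume "i < k"
    then have gi: "g i \<in> space (arrows G)" "rng G (g i) = x" using g by (auto simp: rng_fibre_def)
    have "(\<integral>\<^sup>+ \<eta>. ennreal ((cmod (\<xi> (gmul G (ginv G (g i)) \<eta>)))\<^sup>2) \<partial>count_space (rng_fibre G x)) \<le> 1"
      using norm[OF units_fibre(2)[OF gi(1)]] gi
        nn_integral_translate[OF gi(1), of "\<lambda>\<eta>. ennreal ((cmod (\<xi> \<eta>))\<^sup>2)"] by simp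
    then show "(\<lambda>\<eta>. (cmod (\<xi> (gmul G (ginv G (g i)) \<eta>)))\<^sup>2) summable_on rng_fibre G x"
      using norm_infsum_le_nn_integral(1)[where f = "\<lambda>\<eta>. (cmod (\<xi> (gmul G (ginv G (g i)) \<eta>)))\<^sup>2"
          and E = "rng_fibre G x" and C = 1] by simp
  qed
next
  fix i j assume "i < k" "j < k"
  then have "g i \<in> space (arrows G)" "g j \<in> space (arrows G)" "rng G (g i) = x" "rng G (g j) = x"
    using g by (auto simp: rng_fibre_def)
  then show "(\<Sum>\<^sub>\<infinity>\<eta>\<in>rng_fibre G x. cnj (\<xi> (gmul G (ginv G (g i)) \<eta>)) * \<xi> (gmul G (ginv G (g j)) \<eta>)) =
      fibre_coeff G \<xi> (gmul G (ginv G (g i)) (g j))"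
    using fibre_coeff_quotient[of "g i" "g j" \<xi>] by simp
qed

text \<open>The arrows \<open>g i\<close> may repeat, so the matrix is block diagonal with constant
  blocks. It is the Gram matrix of the vectors supported at \<open>g i\<close> with value the square
  root of \<open>d (src G (g i))\<close>.\<close>

lemma unit_multiplier_pos_semidef:
  assumes d: "\<And>x. x \<in> units G \<Longrightarrow> D x = complex_of_real (d x) \<and> 0 \<le> d x"
    and g: "\<And>i. i < k \<Longrightarrow> g i \<in> rng_fibre G x"
  shows "pos_semidef k (\<lambda>i j. let q = gmul G (ginv G (g i)) (g j) in if q = rng G q then D q else 0)"
proof (rule pos_semidef_cong)
  let ?a = "\<lambda>i h. if g i = h then complex_of_real (sqrt (d (src G h))) else 0"
  show "pos_semidef k (\<lambda>i j. \<Sum>\<^sub>\<infinity>h\<in>g ` {..<k}. cnj (?a i h) * ?a j h)"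
    by (rule pos_semidef_gram) simp
  fix i j assume ij: "i < k" "j < k"
  then have s: "g i \<in> space (arrows G)" "g j \<in> space (arrows G)" "rng G (g j) = rng G (g i)"
    using g by (auto simp: rng_fibre_def)
  let ?q = "gmul G (ginv G (g i)) (g j)"
  have q: "?q = rng G ?q \<longleftrightarrow> g i = g j" using quotient_unit_iff[OF s] .
  have "(\<Sum>\<^sub>\<infinity>h\<in>g ` {..<k}. cnj (?a i h) * ?a j h) = (\<Sum>h\<in>g ` {..<k}. cnj (?a i h) * ?a j h)" by simp
  also have "\<dots> = (\<Sum>h\<in>g ` {..<k}. if h = g i then (if g i = g j then complex_of_real (d (src G (g i))) else 0) else 0)"
    using d[OF units_fibre(2)[OF s(1)]]
    by (intro sum.cong refl) (auto simp flip: of_real_mult)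
  also have "\<dots> = (if g i = g j then complex_of_real (d (src G (g i))) else 0)"
    using ij by (subst sum.delta) auto
  also have "\<dots> = (let q = ?q in if q = rng G q then D q else 0)"
  proof (cases "g i = g j")
    case True
    then have "?q = src G (g i)" using ginv_gmul[OF s(1)] by simp
    then show ?thesis using True q d[OF units_fibre(2)[OF s(1)]] by (simp add: Let_def)
  qed (use q in \<open>simp add: Let_def\<close>)
  finally show "(\<Sum>\<^sub>\<infinity>h\<in>g ` {..<k}. cnj (?a i h) * ?a j h) = (let q = ?q in if q = rng G q then D q else 0)" .
qed

lemma fibre_coeff_bounded:
  assumes norm: "\<And>x. x \<in> units G \<Longrightarrow> (\<integral>\<^sup>+ \<gamma>. ennreal ((cmod (\<xi> \<gamma>))\<^sup>2) \<partial>count_space (rng_fibre G x)) \<le> 1"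
    and \<gamma>: "\<gamma> \<in> space (arrows G)"
  shows "cmod (fibre_coeff G \<xi> \<gamma>) \<le> 1"
  unfolding fibre_coeff_def
proof (rule norm_infsum_le_nn_integral(2))
  let ?E = "rng_fibre G (rng G \<gamma>)"
  let ?A = "\<lambda>y. ennreal ((cmod (\<xi> y))\<^sup>2)" and ?B = "\<lambda>y. ennreal ((cmod (\<xi> (gmul G (ginv G \<gamma>) y)))\<^sup>2)"
  let ?c = "ennreal (1 / 2)"
  have half: "ennreal (1 / 2 * t) = ?c * ennreal t" if "0 \<le> t" for t
    using that by (intro ennreal_mult) auto
  have "ennreal (cmod (cnj a * b)) \<le> ?c * ennreal ((cmod a)\<^sup>2) + ?c * ennreal ((cmod b)\<^sup>2)" for a b :: complex
  proof -
    have "cmod (cnj a * b) \<le> 1 / 2 * (cmod a)\<^sup>2 + 1 / 2 * (cmod b)\<^sup>2"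
      using sum_squares_bound[of "cmod a" "cmod b"] by (simp add: norm_mult)
    then have "ennreal (cmod (cnj a * b)) \<le> ennreal (1 / 2 * (cmod a)\<^sup>2 + 1 / 2 * (cmod b)\<^sup>2)"
      by (rule ennreal_leI)
    also have "\<dots> = ?c * ennreal ((cmod a)\<^sup>2) + ?c * ennreal ((cmod b)\<^sup>2)"
      unfolding half[symmetric, OF zero_le_power2] by (rule ennreal_plus) auto
    finally show ?thesis .
  qed
  then have "(\<integral>\<^sup>+ y. ennreal (cmod (cnj (\<xi> y) * \<xi> (gmul G (ginv G \<gamma>) y))) \<partial>count_space ?E) \<le>
      (\<integral>\<^sup>+ y. ?c * ?A y + ?c * ?B y \<partial>count_space ?E)"
    by (intro nn_integral_mono)
  also have "\<dots> = ?c * (\<integral>\<^sup>+ y. ?A y \<partial>count_space ?E) + ?c * (\<integral>\<^sup>+ y. ?B y \<partial>count_space ?E)"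
    by (simp add: nn_integral_add nn_integral_cmult)
  also have "\<dots> \<le> ?c * 1 + ?c * 1"
    using norm[OF units_fibre(1)[OF \<gamma>]] norm[OF units_fibre(2)[OF \<gamma>]]
      nn_integral_translate[OF \<gamma>, of ?A] by (intro add_mono mult_left_mono) auto
  also have "\<dots> = ennreal (1 / 2 + 1 / 2)" unfolding mult_1_right by (rule ennreal_plus[symmetric]) auto
  also have "\<dots> = ennreal 1" by simp
  finally show "(\<integral>\<^sup>+ y. ennreal (cmod (cnj (\<xi> y) * \<xi> (gmul G (ginv G \<gamma>) y))) \<partial>count_space ?E) \<le> ennreal 1" .
qed simp

text \<open>A unit yields a positive semidefinite matrix of size 1, hence a nonnegative real value.
  With the bound by 1, the repair term \<open>1 - F\<close> is a nonnegative real.\<close>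

lemma fibre_coeff_unit:
  assumes norm: "\<And>x. x \<in> units G \<Longrightarrow> (\<integral>\<^sup>+ \<gamma>. ennreal ((cmod (\<xi> \<gamma>))\<^sup>2) \<partial>count_space (rng_fibre G x)) \<le> 1"
    and x: "x \<in> units G"
  shows "Im (fibre_coeff G \<xi> x) = 0" "Re (fibre_coeff G \<xi> x) \<le> 1"
proof -
  note u = unit_arrow[OF x]
  have "pos_semidef 1 (\<lambda>i j. fibre_coeff G \<xi> (gmul G (ginv G x) x))"
    using fibre_coeff_pos_semidef[OF norm, of 1 "\<lambda>_. x" x] u by (simp add: rng_fibre_def)
  then have "fibre_coeff G \<xi> x \<in> \<real>\<^sub>\<ge>\<^sub>0"
    using u ginv_gmul[OF u(1)] unfolding pos_semidef_def by (auto dest!: spec[of _ "\<lambda>_. 1"])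
  then show "Im (fibre_coeff G \<xi> x) = 0" by (simp add: complex_nonneg_Reals_iff)
  show "Re (fibre_coeff G \<xi> x) \<le> 1"
    using fibre_coeff_bounded[OF norm u(1)] complex_Re_le_cmod order_trans by blast
qed

definition localised :: "('a \<Rightarrow> complex) \<Rightarrow> 'a set \<Rightarrow> 'a \<Rightarrow> complex" where
  "localised \<xi> Y \<gamma> = indicator Y (rng G \<gamma>) * indicator Y (src G \<gamma>) * fibre_coeff G \<xi> \<gamma> +
     (if \<gamma> = rng G \<gamma> then 1 - indicator Y (rng G \<gamma>) * fibre_coeff G \<xi> \<gamma> else 0)"

lemma localised_unit:
  assumes "x \<in> units G"
  shows "localised \<xi> Y x = 1"
  using unit_arrow[OF assms] by (simp add: localised_def indicator_def)

lemma localised_positive_definite: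
  assumes [measurable]: "fibre_coeff G \<xi> \<in> borel_measurable (arrows G)" "Y \<in> sets \<mu>"
    and norm: "\<And>x. x \<in> units G \<Longrightarrow> (\<integral>\<^sup>+ \<gamma>. ennreal ((cmod (\<xi> \<gamma>))\<^sup>2) \<partial>count_space (rng_fibre G x)) \<le> 1"
  shows "positive_definite G \<mu> (localised \<xi> Y)"
  unfolding positive_definite_def
\<comment> \<open>The exceptional set can be empty because the norm bound holds at every
  unit.\<close>
proof (intro conjI bexI[of _ "{}"] ballI allI impI)
  have [measurable]: "Measurable.pred (arrows G) (\<lambda>\<gamma>. \<gamma> = rng G \<gamma>)"
    using units_sets by (simp add: pred_def)
  show "localised \<xi> Y \<in> borel_measurable (arrows G)"
    unfolding localised_def[abs_def] by measurable
  fix x k and g :: "nat \<Rightarrow> 'a"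
  assume "\<forall>i<k. g i \<in> rng_fibre G x"
  then have g: "\<And>i. i < k \<Longrightarrow> g i \<in> rng_fibre G x" by blast
  let ?\<xi> = "\<lambda>\<gamma>. indicator Y (rng G \<gamma>) * \<xi> \<gamma>"
  let ?D = "\<lambda>q. 1 - indicator Y (rng G q) * fibre_coeff G \<xi> q"
  have "pos_semidef k (\<lambda>i j. fibre_coeff G ?\<xi> (gmul G (ginv G (g i)) (g j)))"
  proof (rule fibre_coeff_pos_semidef[OF _ g])
    fix x assume "x \<in> units G"
    have "(\<integral>\<^sup>+ \<gamma>. ennreal ((cmod (?\<xi> \<gamma>))\<^sup>2) \<partial>count_space (rng_fibre G x)) \<le>
        (\<integral>\<^sup>+ \<gamma>. ennreal ((cmod (\<xi> \<gamma>))\<^sup>2) \<partial>count_space (rng_fibre G x))"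
      by (intro nn_integral_mono) (auto simp: indicator_def)
    then show "(\<integral>\<^sup>+ \<gamma>. ennreal ((cmod (?\<xi> \<gamma>))\<^sup>2) \<partial>count_space (rng_fibre G x)) \<le> 1"
      using norm[OF \<open>x \<in> units G\<close>] by (rule order_trans)
  qed
  moreover have "pos_semidef k (\<lambda>i j. let q = gmul G (ginv G (g i)) (g j) in if q = rng G q then ?D q else 0)"
  proof (rule unit_multiplier_pos_semidef[OF _ g])
    fix x assume x: "x \<in> units G"
    show "?D x = complex_of_real (1 - indicator Y (rng G x) * Re (fibre_coeff G \<xi> x)) \<and>
        0 \<le> 1 - indicator Y (rng G x) * Re (fibre_coeff G \<xi> x)"
      using fibre_coeff_unit[OF norm x] by (auto simp: indicator_def complex_eq_iff)
  qed
  ultimately have "pos_semidef k (\<lambda>i j. fibre_coeff G ?\<xi> (gmul G (ginv G (g i)) (g j)) +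
      (let q = gmul G (ginv G (g i)) (g j) in if q = rng G q then ?D q else 0))"
    by (rule pos_semidef_add)
  then show "pos_semidef k (\<lambda>i j. localised \<xi> Y (gmul G (ginv G (g i)) (g j)))"
  proof (rule pos_semidef_cong)
    fix i j assume "i < k" "j < k"
    then have "gmul G (ginv G (g i)) (g j) \<in> space (arrows G)"
      using g by (intro ginv_gmul_closed) (auto simp: rng_fibre_def)
    then show "fibre_coeff G ?\<xi> (gmul G (ginv G (g i)) (g j)) +
        (let q = gmul G (ginv G (g i)) (g j) in if q = rng G q then ?D q else 0) =
        localised \<xi> Y (gmul G (ginv G (g i)) (g j))"
      by (simp add: fibre_coeff_cut localised_def Let_def)
  qed
qed simp

lemma localised_finite_level_sets:
  assumes [measurable]: "fibre_coeff G \<xi> \<in> borel_measurable (arrows G)" "Y \<in> sets \<mu>"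
    and fin: "emeasure \<nu> {\<gamma> \<in> space (arrows G). rng G \<gamma> \<in> Y \<and> src G \<gamma> \<in> Y \<and> \<epsilon> < cmod (fibre_coeff G \<xi> \<gamma>)} < \<infinity>"
      (is "emeasure \<nu> ?B < \<infinity>")
    and \<epsilon>: "0 < \<epsilon>"
  shows "emeasure \<nu> {\<gamma> \<in> space (arrows G). \<epsilon> < cmod (localised \<xi> Y \<gamma>)} < \<infinity>"
proof -
  let ?X = "{\<gamma> \<in> space (arrows G). \<gamma> = rng G \<gamma>}"
  have [measurable]: "?B \<in> sets (arrows G)" by measurable
  have "{\<gamma> \<in> space (arrows G). \<epsilon> < cmod (localised \<xi> Y \<gamma>)} \<subseteq> ?B \<union> ?X"
    using \<epsilon> by (auto simp: localised_def indicator_def split: if_splits)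
  then have "emeasure \<nu> {\<gamma> \<in> space (arrows G). \<epsilon> < cmod (localised \<xi> Y \<gamma>)} \<le> emeasure \<nu> (?B \<union> ?X)"
    by (rule emeasure_mono) simp
  also have "\<dots> \<le> emeasure \<nu> ?B + emeasure \<nu> ?X"
    by (rule emeasure_subadditive) simp_all
  also have "\<dots> < \<infinity>" using fin finite_units by simp
  finally show ?thesis .
qed

text \<open>Borel-Cantelli on the unit space, as \<open>(1 / 2) ^ n\<close> is summable;
  \<open>AE_units\<close> then moves the conclusion to both ends of almost every arrow.\<close>

lemma AE_eventually_ends:
  assumes Y: "\<And>n. Y n \<in> sets \<mu>" "\<And>n. emeasure \<mu> (space \<mu> - Y n) \<le> ennreal ((1 / 2) ^ n)"
  shows "AE \<gamma> in \<nu>. \<forall>\<^sub>F n in sequentially. rng G \<gamma> \<in> Y n \<and> src G \<gamma> \<in> Y n"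
proof -
  have m: "measure \<mu> (space \<mu> - Y n) \<le> (1 / 2) ^ n" for n
    using Y(2)[of n] by (simp add: emeasure_eq_measure)
  have "summable (\<lambda>n. measure \<mu> (space \<mu> - Y n))"
    by (rule summable_comparison_test'[where g = "\<lambda>n. (1 / 2) ^ n" and N = 0]) (use m in auto)
  then have "AE x in \<mu>. \<forall>\<^sub>F n in sequentially. x \<in> space \<mu> - (space \<mu> - Y n)"
    using Y(1) by (intro borel_cantelli_AE1) (auto simp: less_top[symmetric])
  then have "AE x in \<mu>. \<forall>\<^sub>F n in sequentially. x \<in> Y n"
    by eventually_elim (auto elim: eventually_mono)
  from AE_units[OF this] show ?thesis
    by eventually_elim (simp add: eventually_conj_iff)
qed

end

section \<open>Almost everywhere convergence\<close>

lemma tendsto_1_if_Re_tendsto_1: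
  fixes f :: "nat \<Rightarrow> complex"
  assumes "\<And>n. cmod (f n) \<le> 1" "(\<lambda>n. Re (f n)) \<longlonglongrightarrow> 1"
  shows "f \<longlonglongrightarrow> 1"
proof (rule LIM_zero_cancel, rule Lim_null_comparison)
  have "cmod (f n - 1) \<le> sqrt (2 * (1 - Re (f n)))" for n
  proof (rule real_le_rsqrt)
    have "(cmod (f n))\<^sup>2 \<le> 1" using assms(1)[of n] by (simp add: power_le_one)
    moreover have "(cmod (f n - 1))\<^sup>2 = (cmod (f n))\<^sup>2 - 2 * Re (f n) + 1"
      unfolding cmod_power2 by (simp add: power2_eq_square algebra_simps)
    ultimately show "(cmod (f n - 1))\<^sup>2 \<le> 2 * (1 - Re (f n))" by simp
  qed
  then show "\<forall>\<^sub>F n in sequentially. norm (f n - 1) \<le> sqrt (2 * (1 - Re (f n)))" by simp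
  have "(\<lambda>n. sqrt (2 * (1 - Re (f n)))) \<longlonglongrightarrow> sqrt (2 * (1 - 1))"
    by (intro tendsto_intros assms)
  then show "(\<lambda>n. sqrt (2 * (1 - Re (f n)))) \<longlonglongrightarrow> 0" by simp
qed

text \<open>Since \<open>1 - Re (F n x)\<close> is nonnegative, convergence of the integrals against
  the single positive \<open>h\<close> is already \<open>L\<^sup>1\<close> convergence of
  \<open>(1 - Re F n) * h\<close> to 0. A subsequence converges almost everywhere, and
  \<open>h\<close> can be divided out.\<close>

lemma AE_subseq_tendsto_1:
  fixes F :: "nat \<Rightarrow> 'a \<Rightarrow> complex" and h :: "'a \<Rightarrow> real"
  assumes [measurable]: "\<And>n. F n \<in> borel_measurable M"
    and h: "integrable M h" "\<And>x. x \<in> space M \<Longrightarrow> 0 < h x"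
    and bound: "\<And>n x. x \<in> space M \<Longrightarrow> cmod (F n x) \<le> 1"
    and lim: "(\<lambda>n. \<integral>x. F n x * complex_of_real (h x) \<partial>M) \<longlonglongrightarrow> (\<integral>x. complex_of_real (h x) \<partial>M)"
  obtains r :: "nat \<Rightarrow> nat" where "AE x in M. (\<lambda>n. F (r n) x) \<longlonglongrightarrow> 1"
proof -
  have [measurable]: "h \<in> borel_measurable M" using h(1) by auto
  have int: "integrable M (\<lambda>x. F n x * complex_of_real (h x))" for n
  proof (rule Bochner_Integration.integrable_bound[OF h(1)])
    show "AE x in M. norm (F n x * complex_of_real (h x)) \<le> norm (h x)"
      using AE_space
      by eventually_elim (simp add: norm_mult mult_left_le_one_le bound)
  qed measurable
  have Re_int: "Re (\<integral>x. F n x * complex_of_real (h x) \<partial>M) = (\<integral>x. Re (F n x) * h x \<partial>M)"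
    and int_Re: "integrable M (\<lambda>x. Re (F n x) * h x)" for n
    using integral_Re[OF int[of n]] integrable_Re[OF int[of n]] by simp_all
  define u where "u n x = (1 - Re (F n x)) * h x" for n x
  have u_int: "integrable M (u n)" for n
    unfolding u_def left_diff_distrib using h(1) int_Re by auto
  have "(\<integral>x. norm (u n x) \<partial>M) = (\<integral>x. h x \<partial>M) - (\<integral>x. Re (F n x) * h x \<partial>M)" for n
  proof -
    have "(\<integral>x. norm (u n x) \<partial>M) = (\<integral>x. h x - Re (F n x) * h x \<partial>M)"
    proof (intro Bochner_Integration.integral_cong refl)
      fix x assume x: "x \<in> space M"
      have "Re (F n x) \<le> 1" using bound[OF x, of n] complex_Re_le_cmod order_trans by blast
      then show "norm (u n x) = h x - Re (F n x) * h x"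
        using h(2)[OF x] by (simp add: u_def abs_mult left_diff_distrib)
    qed
    then show ?thesis using h(1) int_Re by simp
  qed
  moreover have "(\<lambda>n. (\<integral>x. h x \<partial>M) - (\<integral>x. Re (F n x) * h x \<partial>M)) \<longlonglongrightarrow> 0"
  proof -
    have "(\<lambda>n. \<integral>x. Re (F n x) * h x \<partial>M) \<longlonglongrightarrow> (\<integral>x. h x \<partial>M)"
      using tendsto_Re[OF lim] by (simp add: Re_int)
    from tendsto_diff[OF tendsto_const this, of "\<integral>x. h x \<partial>M"] show ?thesis by simp
  qed
  ultimately have "(\<lambda>n. \<integral>x. norm (u n x) \<partial>M) \<longlonglongrightarrow> 0" by simp
  from tendsto_L1_AE_subseq[OF u_int this] obtain r :: "nat \<Rightarrow> nat"
    where r: "AE x in M. (\<lambda>n. u (r n) x) \<longlonglongrightarrow> 0" by blast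
  have "AE x in M. (\<lambda>n. F (r n) x) \<longlonglongrightarrow> 1"
    using r AE_space
  proof eventually_elim
    case (elim x)
    have "(\<lambda>n. 1 - u (r n) x / h x) \<longlonglongrightarrow> 1 - 0 / h x"
      using h(2)[OF elim(2)] by (intro tendsto_intros elim(1)) simp
    moreover have "1 - u (r n) x / h x = Re (F (r n) x)" for n
      using h(2)[OF elim(2)] by (simp add: u_def)
    ultimately have "(\<lambda>n. Re (F (r n) x)) \<longlonglongrightarrow> 1" by simp
    then show ?case using bound[OF elim(2)] by (intro tendsto_1_if_Re_tendsto_1)
  qed
  then show thesis by (rule that)
qed

section \<open>Sigma-finiteness of the arrow measure and the passage to property (H)\<close>

context countable_measured_groupoid
begin

text \<open>Outside countably many sets of finite measure all \<open>F n\<close> vanish almost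
  everywhere. If that remainder were not null, semifiniteness would give a part \<open>C\<close> of
  positive finite measure, and testing the weak limit 1 against its indicator would give measure
  0.\<close>

lemma sigma_finite_arrow_measure:
  assumes F [measurable]: "\<And>n. F n \<in> borel_measurable (arrows G)"
    and Y [measurable]: "\<And>n k. Y n k \<in> sets \<mu>"
    and small: "\<And>n k. emeasure \<mu> (space \<mu> - Y n k) \<le> ennreal ((1 / 2) ^ k)"
    and fin: "\<And>n k \<epsilon>. 0 < \<epsilon> \<Longrightarrow> emeasure \<nu>
       {\<gamma> \<in> space (arrows G). rng G \<gamma> \<in> Y n k \<and> src G \<gamma> \<in> Y n k \<and> \<epsilon> < cmod (F n \<gamma>)} < \<infinity>"
    and weak: "\<And>g. integrable \<nu> g \<Longrightarrow> (\<lambda>n. \<integral>\<gamma>. F n \<gamma> * g \<gamma> \<partial>\<nu>) \<longlonglongrightarrow> (\<integral>\<gamma>. g \<gamma> \<partial>\<nu>)"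
  shows "sigma_finite_measure \<nu>"
proof -
  \<comment> \<open>One index \<open>k\<close> serves both for the set \<open>Y n k\<close> and for
    the threshold. An arrow outside every \<open>S p\<close> whose ends eventually lie in
    \<open>Y n k\<close> satisfies \<open>|F n| \<le> 1 / Suc k\<close> for all large
    \<open>k\<close>, hence \<open>F n\<close> is 0 there.\<close>
  define S where "S p = {\<gamma> \<in> space (arrows G). rng G \<gamma> \<in> Y (fst p) (snd p) \<and> src G \<gamma> \<in> Y (fst p) (snd p) \<and>
      1 / Suc (snd p) < cmod (F (fst p) \<gamma>)}" for p :: "nat \<times> nat"
  have Sm [measurable]: "S p \<in> sets (arrows G)" for p unfolding S_def by measurable
  have Sfin: "emeasure \<nu> (S p) < \<infinity>" for p
    unfolding S_def by (rule fin) simp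
  let ?Z = "space (arrows G) - (\<Union>p. S p)"
  have Zm: "?Z \<in> sets (arrows G)" by (intro sets.compl_sets sets.countable_UN') auto
  have "AE \<gamma> in \<nu>. \<forall>n. \<forall>\<^sub>F k in sequentially. rng G \<gamma> \<in> Y n k \<and> src G \<gamma> \<in> Y n k"
    unfolding AE_all_countable by (intro allI AE_eventually_ends Y small)
  then have zero: "AE \<gamma> in \<nu>. \<gamma> \<in> ?Z \<longrightarrow> (\<forall>n. F n \<gamma> = 0)"
  proof eventually_elim
    case (elim \<gamma>)
    show ?case
    proof (intro impI allI)
      fix n assume \<gamma>: "\<gamma> \<in> ?Z"
      have "\<forall>\<^sub>F k in sequentially. cmod (F n \<gamma>) \<le> 1 / Suc k"
        using elim[rule_format, of n]
      proof eventually_elim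
        case (elim k)
        have "\<gamma> \<notin> S (n, k)" using \<gamma> by blast
        then show ?case using elim \<gamma> by (auto simp: S_def not_less)
      qed
      moreover have "(\<lambda>k. 1 / real (Suc k)) \<longlonglongrightarrow> 0"
        using LIMSEQ_inverse_real_of_nat by (simp add: inverse_eq_divide)
      ultimately have "cmod (F n \<gamma>) \<le> 0"
        by (intro tendsto_le[OF sequentially_bot _ tendsto_const]) auto
      then show "F n \<gamma> = 0" by simp
    qed
  qed
  have "emeasure \<nu> ?Z = 0"
  proof (rule ccontr)
    assume "emeasure \<nu> ?Z \<noteq> 0"
    then have "0 < emeasure \<nu> ?Z" by (simp add: zero_less_iff_neq_zero)
    then obtain C where C: "C \<in> sets (arrows G)" "C \<subseteq> ?Z" "0 < emeasure \<nu> C" "emeasure \<nu> C < \<infinity>"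
      using S.fibre_measure_semifinite[OF Zm] by blast
    let ?g = "\<lambda>\<gamma>. complex_of_real (indicator C \<gamma>)"
    have g: "integrable \<nu> ?g" "(\<integral>\<gamma>. ?g \<gamma> \<partial>\<nu>) = complex_of_real (measure \<nu> C)"
      using C sets.sets_into_space[OF C(1)] by (auto simp: Int_absorb2)
    have "(\<integral>\<gamma>. F n \<gamma> * ?g \<gamma> \<partial>\<nu>) = 0" for n
    proof (rule integral_eq_zero_AE)
      show "AE \<gamma> in \<nu>. F n \<gamma> * ?g \<gamma> = 0"
        using zero by eventually_elim (use C(2) in \<open>auto simp: indicator_def\<close>)
    qed
    then have "(\<lambda>n::nat. 0) \<longlonglongrightarrow> complex_of_real (measure \<nu> C)"
      using weak[OF g(1)] g(2) by simp
    then have "measure \<nu> C = 0" by (simp add: LIMSEQ_const_iff)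
    then show False using C(3,4) by (auto simp: measure_def enn2real_eq_0_iff)
  qed
  then show ?thesis
  proof (intro sigma_finite_measure.intro exI[of _ "insert ?Z (range S)"] conjI)
    show "\<Union> (insert ?Z (range S)) = space \<nu>"
      using sets.sets_into_space[OF Sm] by auto
    show "\<forall>a\<in>insert ?Z (range S). emeasure \<nu> a \<noteq> \<infinity>"
      using Sfin \<open>emeasure \<nu> ?Z = 0\<close> by (auto simp: less_top)
  qed (use Zm in auto)
qed

lemma property_H_if_amenable:
  assumes "amenable G \<mu>"
  shows "property_H G \<mu>"
proof -
  obtain \<xi>0 :: "nat \<Rightarrow> 'a \<Rightarrow> complex" where \<xi>0: "\<And>n. \<xi>0 n \<in> borel_measurable (arrows G)"
    "\<And>n. AE x in \<mu>. ((\<lambda>\<gamma>. (cmod (\<xi>0 n \<gamma>))\<^sup>2) has_sum 1) (rng_fibre G x)"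
    and weak0: "weak_star_tendsto \<nu> (\<lambda>n. fibre_coeff G (\<xi>0 n)) (\<lambda>_. 1)"
    using assms unfolding amenable_def arrow_measure_eq by blast
  \<comment> \<open>Borel measurability of the coefficients is extracted from membership in
    \<open>L\<^sup>\<infinity>(\<nu>)\<close>, as \<open>\<nu>\<close> and \<open>arrows G\<close>
    have the same measurable sets.\<close>
  have F0: "fibre_coeff G (\<xi>0 n) \<in> borel_measurable (arrows G)" for n
    using weak0 unfolding weak_star_tendsto_def in_L_infinity_def
    by (simp add: measurable_cong_sets[OF sets_fibre_measure refl])
  define sub where "sub n \<xi> \<longleftrightarrow> \<xi> \<in> borel_measurable (arrows G) \<and> fibre_coeff G \<xi> \<in> borel_measurable (arrows G) \<and>
      (\<forall>x\<in>units G. (\<integral>\<^sup>+ \<gamma>. ennreal ((cmod (\<xi> \<gamma>))\<^sup>2) \<partial>count_space (rng_fibre G x)) \<le> 1) \<and>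
      (AE \<gamma> in \<nu>. fibre_coeff G \<xi> \<gamma> = fibre_coeff G (\<xi>0 n) \<gamma>)" for n \<xi>
  have "\<exists>\<xi>. sub n \<xi>" for n
    by (rule subnormalised_cut[OF \<xi>0(1)[of n] F0[of n] \<xi>0(2)[of n]]) (auto simp: sub_def)
  then obtain \<xi> where \<xi>: "\<And>n. sub n (\<xi> n)" by metis
  define F where "F n = fibre_coeff G (\<xi> n)" for n
  have norm: "(\<integral>\<^sup>+ \<gamma>. ennreal ((cmod (\<xi> n \<gamma>))\<^sup>2) \<partial>count_space (rng_fibre G x)) \<le> 1" if "x \<in> units G" for n x
    using \<xi> that unfolding sub_def by blast
  have \<xi>m: "\<xi> n \<in> borel_measurable (arrows G)" and Fm [measurable]: "F n \<in> borel_measurable (arrows G)"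
    and FF0: "AE \<gamma> in \<nu>. F n \<gamma> = fibre_coeff G (\<xi>0 n) \<gamma>" for n
    using \<xi>[of n] unfolding sub_def F_def by blast+
  have weak: "(\<lambda>n. \<integral>\<gamma>. F n \<gamma> * g \<gamma> \<partial>\<nu>) \<longlonglongrightarrow> (\<integral>\<gamma>. g \<gamma> \<partial>\<nu>)" if g: "integrable \<nu> g" for g
  proof -
    have [measurable]: "g \<in> borel_measurable \<nu>" using g by auto
    have [measurable]: "F n \<in> borel_measurable \<nu>" "fibre_coeff G (\<xi>0 n) \<in> borel_measurable \<nu>" for n
      using Fm F0 by (simp_all add: measurable_cong_sets[OF sets_fibre_measure refl])
    have "(\<integral>\<gamma>. F n \<gamma> * g \<gamma> \<partial>\<nu>) = (\<integral>\<gamma>. fibre_coeff G (\<xi>0 n) \<gamma> * g \<gamma> \<partial>\<nu>)" for n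
    proof (rule integral_cong_AE)
      show "AE \<gamma> in \<nu>. F n \<gamma> * g \<gamma> = fibre_coeff G (\<xi>0 n) \<gamma> * g \<gamma>"
        using FF0[of n] by eventually_elim simp
    qed measurable
    then show ?thesis using weak0 g unfolding weak_star_tendsto_def by simp
  qed
  define lev where "lev n k Y \<longleftrightarrow> Y \<in> sets \<mu> \<and> emeasure \<mu> (space \<mu> - Y) \<le> ennreal ((1 / 2) ^ k) \<and>
      (\<forall>\<epsilon>>0. emeasure \<nu> {\<gamma> \<in> space (arrows G). rng G \<gamma> \<in> Y \<and> src G \<gamma> \<in> Y \<and> \<epsilon> < cmod (F n \<gamma>)} < \<infinity>)" for n k Y
  have "\<exists>Y. lev n k Y" for n k
  proof (rule finite_level_sets[OF \<xi>m Fm[unfolded F_def] norm])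
    show "(0::real) < (1 / 2) ^ k" by simp
  qed (auto simp: lev_def F_def)
  then obtain Y where "\<And>n k. lev n k (Y n k)" by metis
  then have Y [measurable]: "\<And>n k. Y n k \<in> sets \<mu>"
    and small: "\<And>n k. emeasure \<mu> (space \<mu> - Y n k) \<le> ennreal ((1 / 2) ^ k)"
    and fin: "\<And>n k \<epsilon>. 0 < \<epsilon> \<Longrightarrow> emeasure \<nu>
       {\<gamma> \<in> space (arrows G). rng G \<gamma> \<in> Y n k \<and> src G \<gamma> \<in> Y n k \<and> \<epsilon> < cmod (F n \<gamma>)} < \<infinity>"
    unfolding lev_def by blast+
  interpret \<nu>: sigma_finite_measure \<nu>
    by (rule sigma_finite_arrow_measure[OF Fm Y small fin weak])
  obtain h where h [measurable]: "h \<in> borel_measurable \<nu>" and h_fin: "integral\<^sup>N \<nu> h \<noteq> \<infinity>"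
    and h_pos: "\<And>\<gamma>. \<gamma> \<in> space \<nu> \<Longrightarrow> 0 < h \<gamma> \<and> h \<gamma> < \<infinity>"
    using \<nu>.Ex_finite_integrable_function by blast
  define hr where "hr \<gamma> = enn2real (h \<gamma>)" for \<gamma>
  have hr_eq: "ennreal (hr \<gamma>) = h \<gamma>" if "\<gamma> \<in> space \<nu>" for \<gamma>
    using h_pos[OF that] by (simp add: hr_def)
  have hr_int: "integrable \<nu> hr"
  proof (rule integrableI_nonneg)
    show "hr \<in> borel_measurable \<nu>" unfolding hr_def by measurable
    have "(\<integral>\<^sup>+ \<gamma>. ennreal (hr \<gamma>) \<partial>\<nu>) = integral\<^sup>N \<nu> h" using hr_eq by (intro nn_integral_cong)
    then show "(\<integral>\<^sup>+ \<gamma>. ennreal (hr \<gamma>) \<partial>\<nu>) < \<infinity>" using h_fin by (simp add: less_top)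
  qed (simp add: hr_def)
  obtain r :: "nat \<Rightarrow> nat" where r: "AE \<gamma> in \<nu>. (\<lambda>n. F (r n) \<gamma>) \<longlonglongrightarrow> 1"
  proof (rule AE_subseq_tendsto_1[of F \<nu> hr])
    show "F n \<in> borel_measurable \<nu>" for n
      using Fm by (simp add: measurable_cong_sets[OF sets_fibre_measure refl])
    show "0 < hr \<gamma>" if "\<gamma> \<in> space \<nu>" for \<gamma>
      using h_pos[OF that] by (simp add: hr_def enn2real_positive_iff)
    show "cmod (F n \<gamma>) \<le> 1" if "\<gamma> \<in> space \<nu>" for n \<gamma>
      unfolding F_def using that by (intro fibre_coeff_bounded[OF norm]) simp_all
    show "(\<lambda>n. \<integral>\<gamma>. F n \<gamma> * complex_of_real (hr \<gamma>) \<partial>\<nu>) \<longlonglongrightarrow> (\<integral>\<gamma>. complex_of_real (hr \<gamma>) \<partial>\<nu>)"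
      by (rule weak) (use hr_int in simp)
  qed (use hr_int in auto)
  \<comment> \<open>The second index of \<open>Y\<close> is \<open>i\<close>, not
    \<open>r i\<close>: the complements have measure at most \<open>(1 / 2) ^ i\<close> for any
    choice of \<open>r\<close>, so Borel-Cantelli applies.\<close>
  define \<Phi> where "\<Phi> i = localised (\<xi> (r i)) (Y (r i) i)" for i
  have "AE \<gamma> in \<nu>. (\<lambda>i. \<Phi> i \<gamma>) \<longlonglongrightarrow> 1"
    using r AE_eventually_ends[of "\<lambda>i. Y (r i) i", OF Y small]
  proof eventually_elim
    case (elim \<gamma>)
    \<comment> \<open>At units the repair makes the value exactly 1; at other arrows the cut is
      invisible once both ends lie in the set.\<close>
    have "\<forall>\<^sub>F i in sequentially. (if \<gamma> = rng G \<gamma> then 1 else F (r i) \<gamma>) = \<Phi> i \<gamma>"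
      using elim(2) by eventually_elim (auto simp: \<Phi>_def localised_def F_def indicator_def)
    moreover have "(\<lambda>i. if \<gamma> = rng G \<gamma> then 1 else F (r i) \<gamma>) \<longlonglongrightarrow> 1"
      using elim(1) by (cases "\<gamma> = rng G \<gamma>") (simp_all only: refl if_True if_False tendsto_const)
    ultimately show ?case by (rule Lim_transform_eventually[rotated])
  qed
  moreover have "positive_definite G \<mu> (\<Phi> n)" for n
    unfolding \<Phi>_def by (rule localised_positive_definite[OF Fm[unfolded F_def] Y norm])
  moreover have "AE x in \<mu>. \<Phi> n x = 1" for n
    using AE_space by eventually_elim (simp add: \<Phi>_def localised_unit space_unit_measure)
  moreover have "emeasure \<nu> {\<gamma> \<in> space (arrows G). cmod (\<Phi> n \<gamma>) > \<epsilon>} < \<infinity>" if "0 < \<epsilon>" for n \<epsilon>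
    unfolding \<Phi>_def
    by (rule localised_finite_level_sets[OF Fm[unfolded F_def] Y fin[OF that, unfolded F_def] that])
  ultimately show ?thesis
    unfolding property_H_def arrow_measure_eq by blast
qed

end

theorem corollary7p3:
  fixes G :: "'a groupoid_data" and \<mu> :: "'a measure"
  assumes "countable_measured_groupoid G \<mu>"
    and "amenable G \<mu>"
  shows "property_H G \<mu>"
  using assms by (rule countable_measured_groupoid.property_H_if_amenable)

end
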